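(* Let $\mathcal{D}=\{D_1,\ldots,D_\ell\}$ be an arrangement of smooth hypersurfaces with normal crossings on $\mathbf{P}^n$, where, for each $i\in\{1,\ldots,\ell\}$, $D_i=\{f_i=0\}$ with $f_i$ a homogeneous polynomial of degree $d_i$ in the homogeneous coordinates $x_0,\ldots,x_n$. Write $\partial_j f_i$ for the partial derivative of $f_i$ with respect to $x_j$. Then the dual bundle of the logarithmic bundle $\Omega^1_{\mathbf{P}^n}(\log\mathcal{D})$ admits the short exact sequence $$0\longrightarrow \Omega^1_{\mathbf{P}^n}(\log\mathcal{D})^{\vee}\longrightarrow \mathcal{O}_{\mathbf{P}^n}(1)^{n+1}\oplus\mathcal{O}_{\mathbf{P}^n}^{\ell-1}\stackrel{N}{\longrightarrow}\bigoplus_{i=1}^{\ell}\mathcal{O}_{\mathbf{P}^n}(d_i)\longrightarrow 0,$$ where $N$ is the $\ell\times(n+\ell)$ matrix $$N=\begin{pmatrix} \partial_0f_1&\cdots&\partial_nf_1&f_1&0&\cdots&0\\ \partial_0f_2&\cdots&\partial_nf_2&0&f_2&&\vdots\\ \vdots&&\vdots&\vdots&&\ddots&0\\ \partial_0f_{\ell-1}&\cdots&\partial_nf_{\ell-1}&0&\cdots&0&f_{\ell-1}\\ \partial_0f_\ell&\cdots&\partial_nf_\ell&0&\cdots&\cdots&0 \end{pmatrix}.$$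
   Context: Everything is over $\mathbf{C}$; $\mathbf{P}^n$ is the $n$-dimensional complex projective space. An arrangement on a smooth algebraic variety $X$ is a family $\mathcal{D}=\{D_1,\ldots,D_\ell\}$ of pairwise distinct smooth irreducible hypersurfaces of $X$; it has normal crossings if it is locally isomorphic (under holomorphic local coordinate changes) to a union of coordinate hyperplanes of $\mathbf{C}^n$, $n=\dim X$. For $\mathcal{D}$ with normal crossings, let $U=X\setminus\bigcup_i D_i$ and $j:U\hookrightarrow X$ the inclusion. The logarithmic bundle $\Omega^1_X(\log\mathcal{D})$ is the subsheaf of $j_*\Omega^1_U$ whose sections, near a point $x$ where $\mathcal{D}=\{z_1\cdots z_k=0\}$ in local coordinates $z_1,\ldots,z_n$, are the forms $\sum_{i=1}^k u_i\,\frac{dz_i}{z_i}+\sum_{i=k+1}^n v_i\,dz_i$ with $u_i,v_i$ holomorphic. It is locally free of rank $n$. *)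

theory Defs
  imports
    "HOL-Analysis.Analysis"
    "HOL-Library.Poly_Mapping"
    "HOL-Computational_Algebra.Factorial_Ring"
    "HOL-Algebra.Module"
begin

section \<open>Polynomials in the variables indexed by a finite type\<close>

type_synonym 'a mpoly = "('a \<Rightarrow>\<^sub>0 nat) \<Rightarrow>\<^sub>0 complex"

definition mp_eval :: "'a::finite mpoly \<Rightarrow> complex ^ 'a \<Rightarrow> complex" where
  "mp_eval p v = (\<Sum>m\<in>Poly_Mapping.keys p.
     Poly_Mapping.lookup p m * (\<Prod>j\<in>UNIV. (v $ j) ^ Poly_Mapping.lookup m j))"

text \<open>If the exponent of the variable \<open>j\<close> in \<open>m\<close> is \<open>0\<close>, the subtraction in the exponent
  truncates, but the coefficient vanishes.\<close>

definition mp_pderiv :: "'a \<Rightarrow> 'a mpoly \<Rightarrow> 'a mpoly" where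
  "mp_pderiv j p = (\<Sum>m\<in>Poly_Mapping.keys p.
     Poly_Mapping.single (m - Poly_Mapping.single j 1)
       (of_nat (Poly_Mapping.lookup m j) * Poly_Mapping.lookup p m))"

definition mp_homogeneous :: "nat \<Rightarrow> 'a::finite mpoly \<Rightarrow> bool" where
  "mp_homogeneous d p \<longleftrightarrow>
     (\<forall>m\<in>Poly_Mapping.keys p. (\<Sum>j\<in>UNIV. Poly_Mapping.lookup m j) = d)"

section \<open>Holomorphic functions of several variables\<close>

definition cholomorphic_on :: "(complex ^ 'a::finite \<Rightarrow> complex) \<Rightarrow> (complex ^ 'a) set \<Rightarrow> bool" where
  "cholomorphic_on g S \<longleftrightarrow> open S \<and>
     (\<forall>v\<in>S. \<exists>g'. (g has_derivative g') (at v) \<and> (\<forall>c w. g' (c *s w) = c * g' w))"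

section \<open>Complex projective space\<close>

text \<open>For a type \<open>'n\<close> with \<open>n\<close> elements, \<open>'n cproj\<close> is the projective space of dimension \<open>n\<close>: the
  homogeneous coordinates are indexed by \<open>'n option\<close>, which has \<open>n + 1\<close> elements.\<close>

definition proportional :: "complex ^ ('n::finite option) \<Rightarrow> complex ^ ('n option) \<Rightarrow> bool" where
  "proportional v w \<longleftrightarrow> v \<noteq> 0 \<and> w \<noteq> 0 \<and> (\<exists>c. w = c *s v)"

lemma part_equivp_proportional: "part_equivp (proportional :: complex ^ ('n::finite option) \<Rightarrow> _)"
proof (rule part_equivpI)
  show "\<exists>v :: complex ^ ('n option). proportional v v"
    by (rule exI[of _ "axis None 1"])
      (auto simp: proportional_def axis_eq_0_iff intro!: exI[of _ 1])
  show "symp (proportional :: complex ^ ('n option) \<Rightarrow> _)"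
  proof (rule sympI)
    fix v w :: "complex ^ ('n option)"
    assume "proportional v w"
    then obtain c where c: "v \<noteq> 0" "w \<noteq> 0" "w = c *s v" by (auto simp: proportional_def)
    then have "c \<noteq> 0" by auto
    then have "v = inverse c *s w" using c by (simp add: vector_smult_assoc)
    then show "proportional w v" using c(1,2) unfolding proportional_def by blast
  qed
  show "transp (proportional :: complex ^ ('n option) \<Rightarrow> _)"
    by (rule transpI) (auto simp: proportional_def vector_smult_assoc)
qed

quotient_type 'n cproj = "complex ^ ('n::finite option)" / partial: "proportional"
  morphisms rep_cproj cproj_class
  by (rule part_equivp_proportional)

text \<open>The preimage of a subset of the projective space in the space of nonzero vectors.\<close>

definition cone :: "'n::finite cproj set \<Rightarrow> (complex ^ ('n option)) set" where
  "cone W = {v. v \<noteq> 0 \<and> cproj_class v \<in> W}"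

lemma cone_Int: "cone (A \<inter> B) = cone A \<inter> cone B"
  by (auto simp: cone_def)

lemma cone_Union: "cone (\<Union>K) = (\<Union>A\<in>K. cone A)"
  by (auto simp: cone_def)

lemma open_cone_UNIV: "open (cone UNIV)"
proof -
  have "cone UNIV = - {0 :: complex ^ ('a option)}" by (auto simp: cone_def)
  then show ?thesis by (simp add: open_Compl)
qed

instantiation cproj :: (finite) topological_space
begin

definition open_cproj :: "'a cproj set \<Rightarrow> bool" where
  "open_cproj W \<longleftrightarrow> open (cone W)"

instance
  by standard (auto simp: open_cproj_def cone_Int cone_Union open_cone_UNIV)

end

definition holomorphic_fun :: "'n::finite cproj set \<Rightarrow> ('n cproj \<Rightarrow> complex) \<Rightarrow> bool" where
  "holomorphic_fun W g \<longleftrightarrow> cholomorphic_on (\<lambda>v. g (cproj_class v)) (cone W)"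

text \<open>Holomorphic local coordinates on the open set \<open>V\<close>: an isomorphism of \<open>V\<close>, with its sheaf of
  holomorphic functions, onto an open subset of \<open>complex ^ 'n\<close>.\<close>

definition local_coordinates ::
    "'n::finite cproj set \<Rightarrow> ('n cproj \<Rightarrow> complex ^ 'n) \<Rightarrow> bool" where
  "local_coordinates V z \<longleftrightarrow> open V \<and> open (z ` V) \<and> inj_on z V \<and>
     homeomorphism V (z ` V) z (inv_into V z) \<and>
     (\<forall>V' g. open V' \<and> V' \<subseteq> V \<longrightarrow>
        (holomorphic_fun V' g \<longleftrightarrow> cholomorphic_on (\<lambda>y. g (inv_into V z y)) (z ` V')))"

section \<open>Sheaves of modules over the structure sheaf\<close>

definition structure_ring :: "'n::finite cproj set \<Rightarrow> ('n cproj \<Rightarrow> complex) ring" where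
  "structure_ring W =
     \<lparr>carrier = {g \<in> extensional W. holomorphic_fun W g},
      mult = (\<lambda>g h. \<lambda>p\<in>W. g p * h p),
      one = (\<lambda>p\<in>W. 1),
      zero = (\<lambda>p\<in>W. 0),
      add = (\<lambda>g h. \<lambda>p\<in>W. g p + h p)\<rparr>"

text \<open>\<open>Sec F W\<close> is the module of sections of \<open>F\<close> over the open set \<open>W\<close>, and \<open>Res F V\<close> is the
  restriction to \<open>V\<close> of sections over any larger open set. The fields \<open>mult\<close> and \<open>one\<close>,
  which the records for modules inherit from those for rings, are irrelevant for modules.\<close>

record ('n, 's) omodule_sheaf =
  Sec :: "'n::finite cproj set \<Rightarrow> ('n cproj \<Rightarrow> complex, 's) module"
  Res :: "'n::finite cproj set \<Rightarrow> 's \<Rightarrow> 's"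

definition omodule_hom ::
    "('n::finite, 's) omodule_sheaf \<Rightarrow> ('n, 't) omodule_sheaf \<Rightarrow>
     ('n cproj set \<Rightarrow> 's \<Rightarrow> 't) \<Rightarrow> 'n cproj set \<Rightarrow> bool" where
  "omodule_hom F G \<phi> W \<longleftrightarrow>
     (\<forall>V. open V \<and> V \<subseteq> W \<longrightarrow>
        \<phi> V \<in> carrier (Sec F V) \<rightarrow> carrier (Sec G V) \<and>
        (\<forall>s\<in>carrier (Sec F V). \<forall>t\<in>carrier (Sec F V).
           \<phi> V (s \<oplus>\<^bsub>Sec F V\<^esub> t) = \<phi> V s \<oplus>\<^bsub>Sec G V\<^esub> \<phi> V t) \<and>
        (\<forall>g\<in>carrier (structure_ring V). \<forall>s\<in>carrier (Sec F V).
           \<phi> V (g \<odot>\<^bsub>Sec F V\<^esub> s) = g \<odot>\<^bsub>Sec G V\<^esub> \<phi> V s) \<and>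
        (\<forall>V'. open V' \<and> V' \<subseteq> V \<longrightarrow>
           (\<forall>s\<in>carrier (Sec F V). \<phi> V' (Res F V' s) = Res G V' (\<phi> V s))))"

definition short_exact_sequence ::
    "('n::finite, 'r) omodule_sheaf \<Rightarrow> ('n, 's) omodule_sheaf \<Rightarrow> ('n, 't) omodule_sheaf \<Rightarrow>
     ('n cproj set \<Rightarrow> 'r \<Rightarrow> 's) \<Rightarrow> ('n cproj set \<Rightarrow> 's \<Rightarrow> 't) \<Rightarrow> bool" where
  "short_exact_sequence F G H \<alpha> \<beta> \<longleftrightarrow>
     omodule_hom F G \<alpha> UNIV \<and> omodule_hom G H \<beta> UNIV \<and>
     (\<forall>W. open W \<longrightarrow>
        inj_on (\<alpha> W) (carrier (Sec F W)) \<and>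
        (\<forall>s\<in>carrier (Sec G W). \<beta> W s = \<zero>\<^bsub>Sec H W\<^esub> \<longleftrightarrow>
           (\<forall>p\<in>W. \<exists>V. open V \<and> p \<in> V \<and> V \<subseteq> W \<and>
              (\<exists>r\<in>carrier (Sec F V). \<alpha> V r = Res G V s))) \<and>
        (\<forall>t\<in>carrier (Sec H W). \<forall>p\<in>W. \<exists>V. open V \<and> p \<in> V \<and> V \<subseteq> W \<and>
           (\<exists>s\<in>carrier (Sec G V). \<beta> V s = Res H V t)))"

definition structure_sheaf :: "('n::finite, 'n cproj \<Rightarrow> complex) omodule_sheaf" where
  "structure_sheaf =
     \<lparr>Sec = (\<lambda>W.
        \<lparr>carrier = carrier (structure_ring W),
         mult = mult (structure_ring W),
         one = one (structure_ring W),
         zero = zero (structure_ring W),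
         add = add (structure_ring W),
         smult = mult (structure_ring W)\<rparr>),
      Res = (\<lambda>V g. restrict g V)\<rparr>"

text \<open>The sections over \<open>W\<close> of the dual of \<open>F\<close> are the homomorphisms from the restriction of \<open>F\<close> to
  \<open>W\<close> into the structure sheaf of \<open>W\<close>.\<close>

definition dual_sheaf ::
    "('n::finite, 's) omodule_sheaf \<Rightarrow>
     ('n, 'n cproj set \<Rightarrow> 's \<Rightarrow> 'n cproj \<Rightarrow> complex) omodule_sheaf" where
  "dual_sheaf F =
     \<lparr>Sec = (\<lambda>W.
        \<lparr>carrier = {\<phi> \<in> (\<Pi>\<^sub>E V\<in>{V. open V \<and> V \<subseteq> W}. extensional (carrier (Sec F V))).
                     omodule_hom F structure_sheaf \<phi> W},
         mult = undefined,
         one = undefined,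
         zero = (\<lambda>V\<in>{V. open V \<and> V \<subseteq> W}. \<lambda>s\<in>carrier (Sec F V). \<lambda>p\<in>V. 0),
         add = (\<lambda>\<phi> \<psi>. \<lambda>V\<in>{V. open V \<and> V \<subseteq> W}. \<lambda>s\<in>carrier (Sec F V). \<lambda>p\<in>V. \<phi> V s p + \<psi> V s p),
         smult = (\<lambda>g \<phi>. \<lambda>V\<in>{V. open V \<and> V \<subseteq> W}. \<lambda>s\<in>carrier (Sec F V). \<lambda>p\<in>V. g p * \<phi> V s p)\<rparr>),
      Res = (\<lambda>V \<phi>. restrict \<phi> {V'. open V' \<and> V' \<subseteq> V})\<rparr>"

text \<open>The direct sum of the sheaves \<open>F c\<close>, for \<open>c\<close> in a finite set \<open>C\<close>.\<close>

definition direct_sum ::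
    "'c set \<Rightarrow> ('c \<Rightarrow> ('n::finite, 's) omodule_sheaf) \<Rightarrow> ('n, 'c \<Rightarrow> 's) omodule_sheaf" where
  "direct_sum C F =
     \<lparr>Sec = (\<lambda>W.
        \<lparr>carrier = (\<Pi>\<^sub>E c\<in>C. carrier (Sec (F c) W)),
         mult = undefined,
         one = undefined,
         zero = (\<lambda>c\<in>C. \<zero>\<^bsub>Sec (F c) W\<^esub>),
         add = (\<lambda>s t. \<lambda>c\<in>C. s c \<oplus>\<^bsub>Sec (F c) W\<^esub> t c),
         smult = (\<lambda>g s. \<lambda>c\<in>C. g \<odot>\<^bsub>Sec (F c) W\<^esub> s c)\<rparr>),
      Res = (\<lambda>V s. \<lambda>c\<in>C. Res (F c) V (s c))\<rparr>"

text \<open>The line bundle \<open>O(d)\<close>: its sections over \<open>W\<close> are the holomorphic functions on the cone over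
  \<open>W\<close> that are homogeneous of degree \<open>d\<close>. For \<open>d = 0\<close> these are the functions on \<open>W\<close>, pulled back
  to the cone, so that \<open>O(0)\<close> is the structure sheaf.\<close>

definition twisting_sheaf :: "int \<Rightarrow> ('n::finite, complex ^ ('n option) \<Rightarrow> complex) omodule_sheaf" where
  "twisting_sheaf d =
     \<lparr>Sec = (\<lambda>W.
        \<lparr>carrier = {s \<in> extensional (cone W). cholomorphic_on s (cone W) \<and>
                     (\<forall>v\<in>cone W. \<forall>c. c \<noteq> 0 \<longrightarrow> s (c *s v) = c powi d * s v)},
         mult = undefined,
         one = undefined,
         zero = (\<lambda>v\<in>cone W. 0),
         add = (\<lambda>s t. \<lambda>v\<in>cone W. s v + t v),
         smult = (\<lambda>g s. \<lambda>v\<in>cone W. g (cproj_class v) * s v)\<rparr>),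
      Res = (\<lambda>V s. restrict s (cone V))\<rparr>"

text \<open>Multiplication of column vectors, with entries indexed by \<open>C\<close>, by a matrix of polynomials
  with rows indexed by \<open>I\<close> and columns indexed by \<open>C\<close>.\<close>

definition matrix_map ::
    "'i set \<Rightarrow> 'c set \<Rightarrow> ('i \<Rightarrow> 'c \<Rightarrow> 'n::finite option mpoly) \<Rightarrow> 'n cproj set \<Rightarrow>
     ('c \<Rightarrow> complex ^ ('n option) \<Rightarrow> complex) \<Rightarrow> 'i \<Rightarrow> complex ^ ('n option) \<Rightarrow> complex" where
  "matrix_map I C M W s = (\<lambda>i\<in>I. \<lambda>v\<in>cone W. \<Sum>c\<in>C. mp_eval (M i c) v * s c v)"

section \<open>Differential forms\<close>

text \<open>Every tangent vector of the projective space at \<open>cproj_class v\<close> is the image of a vector \<open>w\<close>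
  under the differential at \<open>v\<close> of the submersion \<open>cproj_class\<close>. A differential form \<open>\<omega>\<close> is
  encoded by the function \<open>\<lambda>v w. \<omega> v w\<close> giving its value on this image, that is, by its pullback
  to the cone. In particular, \<open>differential g\<close> encodes the differential of the function \<open>g\<close>.\<close>

definition differential ::
    "('n::finite cproj \<Rightarrow> complex) \<Rightarrow> complex ^ ('n option) \<Rightarrow> complex ^ ('n option) \<Rightarrow> complex" where
  "differential g v w = frechet_derivative (\<lambda>v. g (cproj_class v)) (at v) w"

definition one_forms ::
    "'n::finite cproj set \<Rightarrow> (complex ^ ('n option) \<Rightarrow> complex ^ ('n option) \<Rightarrow> complex) set" where
  "one_forms W = {\<omega> \<in> extensional (cone W).
     \<forall>p\<in>W. \<exists>V z u. p \<in> V \<and> V \<subseteq> W \<and> local_coordinates V z \<and> (\<forall>k. holomorphic_fun V (u k)) \<and>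
       (\<forall>v\<in>cone V. \<forall>w. \<omega> v w =
          (\<Sum>k\<in>UNIV. u k (cproj_class v) * differential (\<lambda>q. z q $ k) v w))}"

section \<open>Arrangements with normal crossings and their logarithmic bundles\<close>

text \<open>Local coordinates \<open>z\<close> on \<open>V\<close>, centred at \<open>p\<close>, that transform the family \<open>D i\<close>, for \<open>i\<close> in \<open>I\<close>,
  into a family of distinct coordinate hyperplanes: if \<open>p\<close> lies on \<open>D i\<close>, then \<open>D i\<close> becomes the
  hyperplane on which the coordinate with index \<open>\<sigma> i\<close> vanishes, and the other \<open>D i\<close> do not meet
  \<open>V\<close>.\<close>

definition adapted_coordinates ::
    "'i set \<Rightarrow> ('i \<Rightarrow> 'n::finite cproj set) \<Rightarrow> 'n cproj \<Rightarrow>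
     'n cproj set \<Rightarrow> ('n cproj \<Rightarrow> complex ^ 'n) \<Rightarrow> ('i \<Rightarrow> 'n) \<Rightarrow> bool" where
  "adapted_coordinates I D p V z \<sigma> \<longleftrightarrow>
     local_coordinates V z \<and> p \<in> V \<and> z p = 0 \<and> inj_on \<sigma> {i\<in>I. p \<in> D i} \<and>
     (\<forall>i\<in>I. D i \<inter> V = (if p \<in> D i then {q\<in>V. z q $ \<sigma> i = 0} else {}))"

definition normal_crossings :: "'i set \<Rightarrow> ('i \<Rightarrow> 'n::finite cproj set) \<Rightarrow> bool" where
  "normal_crossings I D \<longleftrightarrow> (\<forall>p. \<exists>V z \<sigma>. adapted_coordinates I D p V z \<sigma>)"

definition log_bundle ::
    "'i set \<Rightarrow> ('i \<Rightarrow> 'n::finite cproj set) \<Rightarrow>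
     ('n, complex ^ ('n option) \<Rightarrow> complex ^ ('n option) \<Rightarrow> complex) omodule_sheaf" where
  "log_bundle I D = (let U = - (\<Union>i\<in>I. D i) in
     \<lparr>Sec = (\<lambda>W.
        \<lparr>carrier = {\<omega> \<in> one_forms (W \<inter> U).
           \<forall>p\<in>W. \<exists>V z \<sigma> u. V \<subseteq> W \<and> adapted_coordinates I D p V z \<sigma> \<and>
             (\<forall>k. holomorphic_fun V (u k)) \<and>
             (\<forall>v\<in>cone (V \<inter> U). \<forall>w. \<omega> v w =
                (\<Sum>k\<in>\<sigma> ` {i\<in>I. p \<in> D i}.
                   u k (cproj_class v) * (differential (\<lambda>q. z q $ k) v w / z (cproj_class v) $ k)) +
                (\<Sum>k\<in>- \<sigma> ` {i\<in>I. p \<in> D i}.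
                   u k (cproj_class v) * differential (\<lambda>q. z q $ k) v w))},
         mult = undefined,
         one = undefined,
         zero = (\<lambda>v\<in>cone (W \<inter> U). \<lambda>w. 0),
         add = (\<lambda>\<omega> \<eta>. \<lambda>v\<in>cone (W \<inter> U). \<lambda>w. \<omega> v w + \<eta> v w),
         smult = (\<lambda>g \<omega>. \<lambda>v\<in>cone (W \<inter> U). \<lambda>w. g (cproj_class v) * \<omega> v w)\<rparr>),
      Res = (\<lambda>V \<omega>. restrict \<omega> (cone (V \<inter> U)))\<rparr>)"

text \<open>\<open>D\<close> is a smooth irreducible hypersurface of degree \<open>d\<close>, and \<open>f\<close> is its (reduced) equation:
  the irreducible homogeneous polynomial that generates the ideal of \<open>D\<close>. Smoothness is the
  Jacobian criterion.\<close>

definition smooth_hypersurface ::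
    "'n::finite cproj set \<Rightarrow> 'n option mpoly \<Rightarrow> nat \<Rightarrow> bool" where
  "smooth_hypersurface D f d \<longleftrightarrow>
     mp_homogeneous d f \<and> irreducible f \<and>
     D = {p. \<exists>v. v \<noteq> 0 \<and> p = cproj_class v \<and> mp_eval f v = 0} \<and>
     (\<forall>v. v \<noteq> 0 \<and> mp_eval f v = 0 \<longrightarrow> (\<exists>j. mp_eval (mp_pderiv j f) v \<noteq> 0))"

section \<open>The matrix of the sequence\<close>

text \<open>The first \<open>n + 1\<close> columns are indexed by \<open>Inl j\<close>, for the variables \<open>j\<close>, and the last \<open>l - 1\<close>
  columns by \<open>Inr k\<close>, for \<open>k = 1, \<dots>, l - 1\<close>; the rows are indexed by \<open>1, \<dots>, l\<close>.\<close>

definition N_columns :: "nat \<Rightarrow> ('n option + nat) set" where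
  "N_columns l = Inl ` UNIV \<union> Inr ` {1..<l}"

definition N_matrix ::
    "(nat \<Rightarrow> 'n option mpoly) \<Rightarrow> nat \<Rightarrow> 'n option + nat \<Rightarrow> 'n option mpoly" where
  "N_matrix f i c = (case c of Inl j \<Rightarrow> mp_pderiv j (f i) | Inr k \<Rightarrow> if k = i then f i else 0)"

end

theory Submission
  imports Defs "HOL-Complex_Analysis.Cauchy_Integral_Formula"
begin

text \<open>
  On the chart \<open>x\<^sub>m \<noteq> 0\<close> the logarithmic bundle is generated by the forms
  \<open>(dx\<^sub>j - x\<^sub>j / d\<^sub>l d log f\<^sub>l) / x\<^sub>m\<close> and \<open>d log f\<^sub>i - d\<^sub>i / d\<^sub>l d log f\<^sub>l\<close>, because by the normal crossings
  and Jacobian conditions \<open>f\<^sub>i / x\<^sub>m ^ d\<^sub>i\<close> is a unit times a coordinate. Hence a functional on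
  logarithmic forms is determined by its values on these forms, which, up to signs and powers of \<open>x\<^sub>m\<close>,
  make up a column annihilated by \<open>N\<close>, by Euler's relation. Conversely, the first \<open>n + 1\<close> entries of a
  column in the kernel of \<open>N\<close> are a vector field on the cone, and contraction with it maps
  logarithmic forms to functions on the complement of the divisors that extend holomorphically, again
  because of the generators. The last map is surjective because the gradients of those \<open>f\<^sub>i\<close> that
  vanish at a point are independent, and remain so when the gradient of \<open>f\<^sub>l\<close> is added.
\<close>

text \<open>The corrections by \<open>d log f_l\<close> have one purpose. On the radial vector field
  of the cone \<open>dx_j\<close> and \<open>d log f_i\<close> take the values \<open>x_j\<close>
  and \<open>d_i\<close>, and \<open>d log f_l\<close> takes the value \<open>d_l\<close>;
  subtracting the matching multiple kills the radial direction, so that the forms descend to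
  projective space. For i = l the second kind of form becomes zero, which is why N has no column for
  \<open>f_l\<close>. The n + l forms generate a bundle of rank n, so a functional cannot be
  prescribed freely on them: each of the l rows of N records one relation. By definition a
  logarithmic form is expanded in adapted coordinates that may change from form to form. The
  generators depend on the chart only, and this makes sums and functionals manageable. Forms are
  functions off the divisors only. Hence the contraction is extended across the divisors as a limit,
  unique because the complement is dense. Holomorphy means a complex-linear derivative at each
  point, nothing more. That derivatives are again holomorphic, as division by a coordinate requires,
  is drawn from the one-variable Cauchy formula on complex lines.\<close>

section \<open>Complex-linear derivatives and holomorphic functions of several variables\<close>

definition chas_derivative ::
    "(complex ^ 'a::finite \<Rightarrow> complex) \<Rightarrow> (complex ^ 'a \<Rightarrow> complex) \<Rightarrow> complex ^ 'a \<Rightarrow> bool" where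
  "chas_derivative g g' v \<longleftrightarrow> (g has_derivative g') (at v) \<and> (\<forall>c w. g' (c *s w) = c * g' w)"

lemma chas_derivative_imp_frechet: "chas_derivative g g' v \<Longrightarrow> frechet_derivative g (at v) = g'"
  by (auto simp: chas_derivative_def dest: frechet_derivative_at)

lemma chas_derivative_unique: "chas_derivative g g' v \<Longrightarrow> chas_derivative g g'' v \<Longrightarrow> g' = g''"
  using chas_derivative_imp_frechet by metis

lemma cholomorphic_onI:
  "open S \<Longrightarrow> (\<And>v. v \<in> S \<Longrightarrow> \<exists>g'. chas_derivative g g' v) \<Longrightarrow> cholomorphic_on g S"
  by (auto simp: cholomorphic_on_def chas_derivative_def)

lemma cholomorphic_on_open: "cholomorphic_on g S \<Longrightarrow> open S"
  by (auto simp: cholomorphic_on_def)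

lemma cholomorphic_onD:
  "cholomorphic_on g S \<Longrightarrow> v \<in> S \<Longrightarrow> chas_derivative g (frechet_derivative g (at v)) v"
  using chas_derivative_imp_frechet by (fastforce simp: cholomorphic_on_def chas_derivative_def)

lemma chas_derivative_linear:
  "chas_derivative g g' v \<Longrightarrow> linear g'"
  by (auto simp: chas_derivative_def has_derivative_linear)

lemma chas_derivative_scale: "chas_derivative g g' v \<Longrightarrow> g' (c *s w) = c * g' w"
  by (auto simp: chas_derivative_def)

lemma chas_derivative_expand:
  fixes v :: "complex ^ 'a::finite"
  assumes "chas_derivative g g' v"
  shows "g' w = (\<Sum>j\<in>UNIV. w $ j * g' (axis j 1))"
proof -
  have "g' w = g' (\<Sum>j\<in>UNIV. w $ j *s axis j 1)"
    by (simp add: basis_expansion)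
  also have "\<dots> = (\<Sum>j\<in>UNIV. g' (w $ j *s axis j 1))"
    using chas_derivative_linear[OF assms] by (simp add: linear_sum)
  finally show ?thesis by (simp add: chas_derivative_scale[OF assms])
qed

lemma chas_derivative_transform:
  assumes "chas_derivative g g' v" "open T" "v \<in> T" "\<And>x. x \<in> T \<Longrightarrow> g x = h x"
  shows "chas_derivative h g' v"
  using assms has_derivative_transform_within_open[of g g' v UNIV T h]
  by (auto simp: chas_derivative_def)

lemma chas_derivative_const: "chas_derivative (\<lambda>v. a) (\<lambda>w. 0) v"
  by (simp add: chas_derivative_def)

lemma chas_derivative_nth: "chas_derivative (\<lambda>v. v $ j) (\<lambda>w. w $ j) v"
  by (auto simp: chas_derivative_def intro!: bounded_linear_imp_has_derivative bounded_linear_vec_nth)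

lemma chas_derivative_add:
  "chas_derivative g g' v \<Longrightarrow> chas_derivative h h' v \<Longrightarrow>
   chas_derivative (\<lambda>x. g x + h x) (\<lambda>w. g' w + h' w) v"
  by (auto simp: chas_derivative_def distrib_left intro: has_derivative_add)

lemma chas_derivative_diff:
  "chas_derivative g g' v \<Longrightarrow> chas_derivative h h' v \<Longrightarrow>
   chas_derivative (\<lambda>x. g x - h x) (\<lambda>w. g' w - h' w) v"
  by (auto simp: chas_derivative_def right_diff_distrib intro: has_derivative_diff)

lemma chas_derivative_minus:
  "chas_derivative g g' v \<Longrightarrow> chas_derivative (\<lambda>x. - g x) (\<lambda>w. - g' w) v"
  by (auto simp: chas_derivative_def intro: has_derivative_minus)

lemma chas_derivative_mult:
  "chas_derivative g g' v \<Longrightarrow> chas_derivative h h' v \<Longrightarrow>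
   chas_derivative (\<lambda>x. g x * h x) (\<lambda>w. g v * h' w + g' w * h v) v"
  by (auto simp: chas_derivative_def algebra_simps intro: has_derivative_mult)

lemma chas_derivative_cmult:
  "chas_derivative g g' v \<Longrightarrow> chas_derivative (\<lambda>x. a * g x) (\<lambda>w. a * g' w) v"
  using chas_derivative_mult[OF chas_derivative_const] by fastforce

lemma chas_derivative_inverse:
  assumes "chas_derivative g g' v" "g v \<noteq> 0"
  shows "chas_derivative (\<lambda>x. inverse (g x)) (\<lambda>w. - (inverse (g v) * g' w * inverse (g v))) v"
  using assms by (auto simp: chas_derivative_def intro!: has_derivative_inverse)

lemma chas_derivative_divide:
  assumes "chas_derivative g g' v" "chas_derivative h h' v" "h v \<noteq> 0"
  shows "chas_derivative (\<lambda>x. g x / h x) (\<lambda>w. g' w / h v - g v * h' w / (h v)\<^sup>2) v"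
proof -
  have "chas_derivative (\<lambda>x. g x * inverse (h x))
     (\<lambda>w. g v * - (inverse (h v) * h' w * inverse (h v)) + g' w * inverse (h v)) v"
    by (intro chas_derivative_mult chas_derivative_inverse assms)
  then show ?thesis
    by (simp add: divide_inverse power2_eq_square algebra_simps)
qed

lemma chas_derivative_sum:
  "(\<And>i. i \<in> I \<Longrightarrow> chas_derivative (g i) (g' i) v) \<Longrightarrow>
   chas_derivative (\<lambda>x. \<Sum>i\<in>I. g i x) (\<lambda>w. \<Sum>i\<in>I. g' i w) v"
  by (auto simp: chas_derivative_def sum_distrib_left intro: has_derivative_sum)

lemma chas_derivative_power:
  assumes "chas_derivative g g' v"
  shows "chas_derivative (\<lambda>x. g x ^ n) (\<lambda>w. of_nat n * g' w * g v ^ (n - 1)) v"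
  using assms has_derivative_power[of g g' v UNIV n] by (auto simp: chas_derivative_def)

lemma chas_derivative_prod:
  assumes "\<And>i. i \<in> I \<Longrightarrow> chas_derivative (g i) (g' i) v"
  shows "chas_derivative (\<lambda>x. \<Prod>i\<in>I. g i x) (\<lambda>w. \<Sum>i\<in>I. g' i w * (\<Prod>j\<in>I - {i}. g j v)) v"
  using assms has_derivative_prod[of I g g' v UNIV]
  by (auto simp: chas_derivative_def sum_distrib_left mult_ac intro!: sum.cong)

lemma chas_derivative_compose:
  fixes h :: "complex ^ 'a::finite \<Rightarrow> complex ^ 'b::finite"
  assumes h: "\<And>j. chas_derivative (\<lambda>x. h x $ j) (h' j) v"
    and g: "chas_derivative g g' (h v)"
  shows "chas_derivative (\<lambda>x. g (h x)) (\<lambda>w. g' (\<chi> j. h' j w)) v"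
proof -
  have "(h has_derivative (\<lambda>w. \<chi> j. h' j w)) (at v)"
    unfolding has_derivative_componentwise_within[of h]
  proof (rule ballI)
    fix i :: "complex ^ 'b" assume "i \<in> Basis"
    \<comment> \<open>The real basis vectors of the target have a single non-zero entry, so the
      inner product with one of them sees only component j.\<close>
    then obtain j u where i: "i = axis j u" by (auto simp: Basis_vec_def)
    have "((\<lambda>x. h x $ j) has_derivative h' j) (at v)" using h by (simp add: chas_derivative_def)
    then have "((\<lambda>x. h x $ j \<bullet> u) has_derivative (\<lambda>w. h' j w \<bullet> u)) (at v)"
      by (rule has_derivative_inner_left)
    then show "((\<lambda>x. h x \<bullet> i) has_derivative (\<lambda>w. (\<chi> j. h' j w) \<bullet> i)) (at v)"
      by (simp add: i inner_axis)
  qed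
  then have "((\<lambda>x. g (h x)) has_derivative (\<lambda>w. g' (\<chi> j. h' j w))) (at v)"
    using g has_derivative_compose[of h _ v UNIV g g'] by (auto simp: chas_derivative_def)
  moreover have "g' (\<chi> j. h' j (c *s w)) = c * g' (\<chi> j. h' j w)" for c w
  proof -
    have "(\<chi> j. h' j (c *s w)) = c *s (\<chi> j. h' j w)"
      using chas_derivative_scale[OF h] by (simp add: vec_eq_iff)
    then show ?thesis using chas_derivative_scale[OF g] by simp
  qed
  ultimately show ?thesis by (simp add: chas_derivative_def)
qed

lemma cholomorphic_on_cong:
  assumes "cholomorphic_on g S" "\<And>x. x \<in> S \<Longrightarrow> g x = h x"
  shows "cholomorphic_on h S"
proof (rule cholomorphic_onI)
  show "open S" using assms cholomorphic_on_open by blast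
  show "\<exists>g'. chas_derivative h g' v" if "v \<in> S" for v
    using chas_derivative_transform[OF cholomorphic_onD[OF assms(1) that] \<open>open S\<close> that] assms(2)
    by blast
qed

lemma cholomorphic_on_cong_iff:
  assumes "\<And>x. x \<in> S \<Longrightarrow> g x = h x"
  shows "cholomorphic_on g S \<longleftrightarrow> cholomorphic_on h S"
  using assms cholomorphic_on_cong[of g S h] cholomorphic_on_cong[of h S g] by metis

lemma cholomorphic_on_subset: "cholomorphic_on g S \<Longrightarrow> open T \<Longrightarrow> T \<subseteq> S \<Longrightarrow> cholomorphic_on g T"
  by (rule cholomorphic_onI) (auto dest: cholomorphic_onD)

lemma cholomorphic_on_local:
  assumes "open S" "\<And>v. v \<in> S \<Longrightarrow> \<exists>T. v \<in> T \<and> cholomorphic_on g T"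
  shows "cholomorphic_on g S"
  using assms(1) by (rule cholomorphic_onI) (use assms(2) cholomorphic_onD in blast)

lemma cholomorphic_on_continuous: "cholomorphic_on g S \<Longrightarrow> continuous_on S g"
  by (rule continuous_at_imp_continuous_on)
    (auto simp: chas_derivative_def dest!: cholomorphic_onD intro: has_derivative_continuous)

lemma cholomorphic_on_const: "open S \<Longrightarrow> cholomorphic_on (\<lambda>v. a) S"
  using chas_derivative_const by (blast intro: cholomorphic_onI)

lemma cholomorphic_on_nth: "open S \<Longrightarrow> cholomorphic_on (\<lambda>v. v $ j) S"
  using chas_derivative_nth by (blast intro: cholomorphic_onI)

lemma cholomorphic_on_add:
  "cholomorphic_on g S \<Longrightarrow> cholomorphic_on h S \<Longrightarrow> cholomorphic_on (\<lambda>v. g v + h v) S"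
  by (rule cholomorphic_onI, erule cholomorphic_on_open, rule exI, rule chas_derivative_add; erule (1) cholomorphic_onD)

lemma cholomorphic_on_diff:
  "cholomorphic_on g S \<Longrightarrow> cholomorphic_on h S \<Longrightarrow> cholomorphic_on (\<lambda>v. g v - h v) S"
  by (rule cholomorphic_onI, erule cholomorphic_on_open, rule exI, rule chas_derivative_diff; erule (1) cholomorphic_onD)

lemma cholomorphic_on_minus:
  "cholomorphic_on g S \<Longrightarrow> cholomorphic_on (\<lambda>v. - g v) S"
  by (rule cholomorphic_onI, erule cholomorphic_on_open, rule exI, rule chas_derivative_minus; erule (1) cholomorphic_onD)

lemma cholomorphic_on_mult:
  "cholomorphic_on g S \<Longrightarrow> cholomorphic_on h S \<Longrightarrow> cholomorphic_on (\<lambda>v. g v * h v) S"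
  by (rule cholomorphic_onI, erule cholomorphic_on_open, rule exI, rule chas_derivative_mult; erule (1) cholomorphic_onD)

lemma cholomorphic_on_divide:
  "cholomorphic_on g S \<Longrightarrow> cholomorphic_on h S \<Longrightarrow> (\<And>v. v \<in> S \<Longrightarrow> h v \<noteq> 0) \<Longrightarrow>
   cholomorphic_on (\<lambda>v. g v / h v) S"
  by (rule cholomorphic_onI, erule cholomorphic_on_open, rule exI, rule chas_derivative_divide)
    (auto intro: cholomorphic_onD)

lemma cholomorphic_on_power:
  "cholomorphic_on g S \<Longrightarrow> cholomorphic_on (\<lambda>v. g v ^ n) S"
  by (rule cholomorphic_onI, erule cholomorphic_on_open, rule exI, rule chas_derivative_power; erule (1) cholomorphic_onD)

lemma cholomorphic_on_sum:
  assumes "open S" "\<And>i. i \<in> I \<Longrightarrow> cholomorphic_on (g i) S"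
  shows "cholomorphic_on (\<lambda>v. \<Sum>i\<in>I. g i v) S"
proof (rule cholomorphic_onI)
  fix v assume "v \<in> S"
  then show "\<exists>g'. chas_derivative (\<lambda>v. \<Sum>i\<in>I. g i v) g' v"
    using chas_derivative_sum[of I g "\<lambda>i. frechet_derivative (g i) (at v)" v] assms
      cholomorphic_onD by blast
qed fact

lemma cholomorphic_on_compose:
  assumes "open S" "\<And>j. cholomorphic_on (\<lambda>x. h x $ j) S" "cholomorphic_on g T"
    and "\<And>x. x \<in> S \<Longrightarrow> h x \<in> T"
  shows "cholomorphic_on (\<lambda>x. g (h x)) S"
proof (rule cholomorphic_onI)
  fix v assume v: "v \<in> S"
  show "\<exists>g'. chas_derivative (\<lambda>x. g (h x)) g' v"
    using chas_derivative_compose[OF cholomorphic_onD[OF assms(2) v]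
        cholomorphic_onD[OF assms(3) assms(4)[OF v]]] by blast
qed fact

lemma continuous_on_vec_iff:
  fixes h :: "'b::topological_space \<Rightarrow> complex ^ 'a::finite"
  assumes "\<And>j. continuous_on S (\<lambda>x. h x $ j)"
  shows "continuous_on S h"
  using continuous_on_vec_lambda[of S "\<lambda>j x. h x $ j"] assms by simp

section \<open>Polynomial functions\<close>

lemma mp_eval_superset:
  assumes "finite K" "Poly_Mapping.keys p \<subseteq> K"
  shows "mp_eval p v = (\<Sum>m\<in>K. Poly_Mapping.lookup p m * (\<Prod>j\<in>UNIV. (v $ j) ^ Poly_Mapping.lookup m j))"
  unfolding mp_eval_def using assms
  by (intro sum.mono_neutral_left) (auto simp: in_keys_iff)

lemma mp_eval_zero [simp]: "mp_eval 0 v = 0"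
  by (simp add: mp_eval_def)

lemma mp_eval_add: "mp_eval (p + q) v = mp_eval p v + mp_eval q v"
proof -
  let ?K = "Poly_Mapping.keys p \<union> Poly_Mapping.keys q"
  have "mp_eval r v = (\<Sum>m\<in>?K. Poly_Mapping.lookup r m * (\<Prod>j\<in>UNIV. (v $ j) ^ Poly_Mapping.lookup m j))"
    if "r \<in> {p, q, p + q}" for r
    using that Poly_Mapping.keys_add[of p q] by (intro mp_eval_superset) auto
  then show ?thesis by (simp add: lookup_add distrib_right sum.distrib)
qed

lemma mp_eval_sum: "mp_eval (\<Sum>i\<in>I. p i) v = (\<Sum>i\<in>I. mp_eval (p i) v)"
  by (induction I rule: infinite_finite_induct) (auto simp: mp_eval_add)

lemma mp_eval_single:
  "mp_eval (Poly_Mapping.single m a) v = a * (\<Prod>j\<in>UNIV. (v $ j) ^ Poly_Mapping.lookup m j)"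
  by (cases "a = 0") (auto simp: mp_eval_def)

lemma mp_eval_chas_derivative:
  fixes p :: "'a::finite mpoly"
  shows "chas_derivative (mp_eval p) (\<lambda>w. \<Sum>j\<in>UNIV. mp_eval (mp_pderiv j p) v * w $ j) v"
proof -
  have "chas_derivative (\<lambda>v. \<Sum>m\<in>Poly_Mapping.keys p.
       Poly_Mapping.lookup p m * (\<Prod>j\<in>UNIV. (v $ j) ^ Poly_Mapping.lookup m j))
     (\<lambda>w. \<Sum>m\<in>Poly_Mapping.keys p. Poly_Mapping.lookup p m *
        (\<Sum>j\<in>UNIV. of_nat (Poly_Mapping.lookup m j) * w $ j * (v $ j) ^ (Poly_Mapping.lookup m j - 1) *
           (\<Prod>i\<in>UNIV - {j}. (v $ i) ^ Poly_Mapping.lookup m i))) v"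
    by (intro chas_derivative_sum chas_derivative_cmult chas_derivative_prod chas_derivative_power
        chas_derivative_nth)
  also have "(\<lambda>v. \<Sum>m\<in>Poly_Mapping.keys p.
       Poly_Mapping.lookup p m * (\<Prod>j\<in>UNIV. (v $ j) ^ Poly_Mapping.lookup m j)) = mp_eval p"
    by (simp add: mp_eval_def fun_eq_iff)
  also have "(\<lambda>w. \<Sum>m\<in>Poly_Mapping.keys p. Poly_Mapping.lookup p m *
        (\<Sum>j\<in>UNIV. of_nat (Poly_Mapping.lookup m j) * w $ j * (v $ j) ^ (Poly_Mapping.lookup m j - 1) *
           (\<Prod>i\<in>UNIV - {j}. (v $ i) ^ Poly_Mapping.lookup m i)))
     = (\<lambda>w. \<Sum>j\<in>UNIV. mp_eval (mp_pderiv j p) v * w $ j)"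
  proof
    fix w :: "complex ^ 'a"
    \<comment> \<open>The truncated exponent occurs in the formal derivative and in the analytic
      power rule alike, so the two match even where the exponent is 0.\<close>
    have *: "(\<Prod>i\<in>UNIV. (v $ i) ^ Poly_Mapping.lookup (m - Poly_Mapping.single j 1) i) =
       (v $ j) ^ (Poly_Mapping.lookup m j - 1) * (\<Prod>i\<in>UNIV - {j}. (v $ i) ^ Poly_Mapping.lookup m i)" for m j
      by (subst prod.remove[of _ j]) (auto simp: lookup_minus lookup_single when_def intro!: prod.cong)
    have "(\<Sum>j\<in>UNIV. mp_eval (mp_pderiv j p) v * w $ j) =
        (\<Sum>j\<in>UNIV. \<Sum>m\<in>Poly_Mapping.keys p. Poly_Mapping.lookup p m *
          (of_nat (Poly_Mapping.lookup m j) * w $ j * (v $ j) ^ (Poly_Mapping.lookup m j - 1) *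
           (\<Prod>i\<in>UNIV - {j}. (v $ i) ^ Poly_Mapping.lookup m i)))"
      unfolding mp_pderiv_def mp_eval_sum mp_eval_single * sum_distrib_right
      by (intro sum.cong refl) (simp add: mult_ac)
    then show "(\<Sum>m\<in>Poly_Mapping.keys p. Poly_Mapping.lookup p m *
        (\<Sum>j\<in>UNIV. of_nat (Poly_Mapping.lookup m j) * w $ j * (v $ j) ^ (Poly_Mapping.lookup m j - 1) *
           (\<Prod>i\<in>UNIV - {j}. (v $ i) ^ Poly_Mapping.lookup m i)))
      = (\<Sum>j\<in>UNIV. mp_eval (mp_pderiv j p) v * w $ j)"
      unfolding sum_distrib_left by (subst sum.swap) simp
  qed
  finally show ?thesis .
qed

lemma mp_eval_cholomorphic: "open S \<Longrightarrow> cholomorphic_on (mp_eval p) S"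
  using mp_eval_chas_derivative by (blast intro: cholomorphic_onI)

lemma mp_eval_scale:
  assumes "mp_homogeneous d p"
  shows "mp_eval p (c *s v) = c ^ d * mp_eval p v"
proof -
  have "(\<Prod>j\<in>UNIV. ((c *s v) $ j) ^ Poly_Mapping.lookup m j) =
      c ^ d * (\<Prod>j\<in>UNIV. (v $ j) ^ Poly_Mapping.lookup m j)" if "m \<in> Poly_Mapping.keys p" for m
    using that assms
    by (auto simp: power_mult_distrib prod.distrib mp_homogeneous_def simp flip: power_sum)
  then show ?thesis
    unfolding mp_eval_def sum_distrib_left by (intro sum.cong refl) simp
qed

text \<open>The chain rule and uniqueness of the derivative of \<open>g (c *s x)\<close>. It is used
  with a = 1 for functions on projective space and with a = \<open>c ^ d\<close> for the
  equations.\<close>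

lemma homogeneous_derivative_scale:
  fixes g :: "complex ^ 'a::finite \<Rightarrow> complex"
  assumes "chas_derivative g g' v" "chas_derivative g g'' (c *s v)" "open S" "v \<in> S"
    and "\<And>x. x \<in> S \<Longrightarrow> g (c *s x) = a * g x"
  shows "c * g'' w = a * g' w"
proof -
  have "chas_derivative (\<lambda>x. (c *s x) $ j) (\<lambda>w. c * w $ j) v" for j
    using chas_derivative_cmult[OF chas_derivative_nth] by simp
  from chas_derivative_compose[OF this assms(2)]
  have "chas_derivative (\<lambda>x. g (c *s x)) (\<lambda>w. g'' (\<chi> j. c * w $ j)) v" .
  also have "(\<lambda>w. g'' (\<chi> j. c * w $ j)) = (\<lambda>w. c * g'' w)"
    using chas_derivative_scale[OF assms(2)] by (simp add: vector_scalar_mult_def)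
  finally have "chas_derivative (\<lambda>x. g (c *s x)) (\<lambda>w. c * g'' w) v" .
  then have "chas_derivative (\<lambda>x. a * g x) (\<lambda>w. c * g'' w) v"
    using assms(5) by (rule chas_derivative_transform[OF _ assms(3,4)])
  moreover have "chas_derivative (\<lambda>x. a * g x) (\<lambda>w. a * g' w) v"
    by (intro chas_derivative_cmult assms)
  ultimately show ?thesis using chas_derivative_unique by metis
qed

text \<open>Homogeneity is differentiated with respect to c at c = 1. The case k = 0 says that the
  differential of a function on projective space kills the radial direction.\<close>

lemma homogeneous_euler:
  fixes g :: "complex ^ 'a::finite \<Rightarrow> complex"
  assumes "chas_derivative g g' v"
    and "\<And>c. c \<noteq> 0 \<Longrightarrow> g (c *s v) = c powi k * g v"
  shows "g' v = of_int k * g v"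
proof -
  have "((\<lambda>c. c *s v) has_derivative (\<lambda>c. c *s v)) (at (1::complex))"
    by (rule bounded_linear_imp_has_derivative)
      (auto intro!: linear_conv_bounded_linear[THEN iffD1] linearI
        simp: vec_eq_iff algebra_simps)
  from has_derivative_compose[OF this, of g g']
  have "((\<lambda>c. g (c *s v)) has_derivative (\<lambda>c. g' (c *s v))) (at (1::complex))"
    using assms by (simp add: chas_derivative_def)
  then have "((\<lambda>c. g (c *s v)) has_field_derivative g' v) (at (1::complex))"
    unfolding chas_derivative_scale[OF assms(1)] has_field_derivative_def
    by (rule has_derivative_eq_rhs) (simp add: fun_eq_iff mult.commute)
  moreover have "((\<lambda>c. g (c *s v)) has_field_derivative of_int k * g v) (at (1::complex))"
  proof (rule has_field_derivative_transform_within_open[where S = "- {0}"])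
    show "((\<lambda>c. c powi k * g v) has_field_derivative of_int k * g v) (at (1::complex))"
      by (auto intro!: derivative_eq_intros)
  qed (use assms(2) in auto)
  ultimately show ?thesis by (rule DERIV_unique)
qed

section \<open>Holomorphic functions of several variables: Cauchy's formula and its consequences\<close>

lemma continuous_on_vector_smult:
  fixes h :: "'b::topological_space \<Rightarrow> complex ^ 'a::finite"
  assumes "continuous_on S c" "continuous_on S h"
  shows "continuous_on S (\<lambda>x. c x *s h x)"
  by (rule continuous_on_vec_iff) (auto intro!: continuous_intros assms)

lemma norm_vector_smult: "norm (c *s w) = norm c * norm (w :: complex ^ 'a::finite)"
  by (simp add: norm_vec_def norm_mult L2_set_right_distrib)

text \<open>On the complex line through v in direction w, F is a holomorphic function of one
  variable, whose derivative at 0 is the left-hand side. The circle is parametrised by the fixed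
  interval from 0 to 1, so that results on integrals with a parameter apply in v.\<close>

lemma cauchy_directional_derivative:
  fixes F :: "complex ^ 'a::finite \<Rightarrow> complex"
  assumes F: "cholomorphic_on F S" and r: "r > 0"
    and sub: "\<And>\<zeta>::complex. \<zeta> \<in> cball 0 r \<Longrightarrow> v + \<zeta> *s w \<in> S"
  shows "frechet_derivative F (at v) w =
    integral {0..1} (\<lambda>t. F (v + (of_real r * exp (2 * of_real pi * \<i> * of_real t)) *s w) /
                          (of_real r * exp (2 * of_real pi * \<i> * of_real t)))"
proof -
  define g where "g = (\<lambda>\<zeta>. F (v + \<zeta> *s w))"
  have der: "(g has_field_derivative frechet_derivative F (at (v + \<zeta> *s w)) w) (at \<zeta>)"
    if "\<zeta> \<in> cball 0 r" for \<zeta>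
  proof -
    let ?F' = "frechet_derivative F (at (v + \<zeta> *s w))"
    have F': "chas_derivative F ?F' (v + \<zeta> *s w)" using cholomorphic_onD[OF F sub[OF that]] .
    have "((\<lambda>\<zeta>. v + \<zeta> *s w) has_derivative (\<lambda>c. c *s w)) (at \<zeta>)"
      by (rule has_derivative_eq_rhs, rule has_derivative_add, rule has_derivative_const,
          rule bounded_linear_imp_has_derivative)
        (auto intro!: linear_conv_bounded_linear[THEN iffD1] linearI simp: vec_eq_iff algebra_simps)
    from has_derivative_compose[OF this, of F ?F']
    have "(g has_derivative (\<lambda>c. ?F' (c *s w))) (at \<zeta>)"
      using F' by (simp add: chas_derivative_def g_def)
    moreover have "(\<lambda>c. ?F' (c *s w)) = (*) (?F' w)"
      using chas_derivative_scale[OF F'] by (simp add: fun_eq_iff mult.commute)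
    ultimately show ?thesis by (simp add: has_field_derivative_def)
  qed
  have "g holomorphic_on ball 0 r"
    unfolding holomorphic_on_def field_differentiable_def
    by (rule ballI, rule exI, rule has_field_derivative_at_within, rule der) auto
  moreover have "continuous_on (cball 0 r) g"
    by (rule continuous_at_imp_continuous_on, rule ballI, rule DERIV_isCont, rule der)
  ultimately have "(g has_field_derivative (1 / (2 * of_real pi * \<i>) *
      contour_integral (circlepath 0 r) (\<lambda>u. g u / (u - 0)\<^sup>2))) (at 0)"
    using Cauchy_derivative_integral_circlepath(2)[of 0 r g 0] r by simp
  then have "frechet_derivative F (at v) w =
      1 / (2 * of_real pi * \<i>) * contour_integral (circlepath 0 r) (\<lambda>u. g u / (u - 0)\<^sup>2)"
    using der[of 0] r by (auto dest: DERIV_unique)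
  also have "\<dots> = integral {0..1} (\<lambda>t. 1 / (2 * of_real pi * \<i>) *
      (g (circlepath 0 r t) / (circlepath 0 r t - 0)\<^sup>2 * vector_derivative (circlepath 0 r) (at t)))"
    unfolding contour_integral_integral integral_mult_right ..
  \<comment> \<open>The velocity of the circle cancels the constant \<open>2 pi i\<close> and one of
    the two powers in the denominator.\<close>
  also have "\<dots> = integral {0..1} (\<lambda>t. F (v + (of_real r * exp (2 * of_real pi * \<i> * of_real t)) *s w) /
                          (of_real r * exp (2 * of_real pi * \<i> * of_real t)))"
    unfolding vector_derivative_circlepath using r
    by (intro integral_cong) (simp add: g_def circlepath power2_eq_square field_simps)
  finally show ?thesis .
qed

text \<open>One radius must serve all v near v0, since Cauchy's integral will be studied as a
  function of v. The \<open>+ 1\<close> in the radius covers w = 0.\<close>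

lemma cball_direction:
  fixes v0 :: "complex ^ 'a::finite"
  assumes "v0 \<in> S" "open S"
  obtains \<epsilon> r where "\<epsilon> > 0" "r > 0" "ball v0 \<epsilon> \<subseteq> S"
    "\<And>v \<zeta>::complex. v \<in> ball v0 \<epsilon> \<Longrightarrow> \<zeta> \<in> cball 0 r \<Longrightarrow> v + \<zeta> *s w \<in> S"
proof -
  obtain e where e: "e > 0" "ball v0 e \<subseteq> S" using assms openE by blast
  have n: "norm w + 1 > 0" by (smt (verit) norm_ge_zero)
  show thesis
  proof (rule that[of "e/2" "e / (2 * (norm w + 1))"])
    fix v and \<zeta> :: complex assume v: "v \<in> ball v0 (e/2)" and z: "\<zeta> \<in> cball 0 (e / (2 * (norm w + 1)))"
    have "norm \<zeta> * norm w \<le> e / (2 * (norm w + 1)) * (norm w + 1)"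
      using z n e(1) by (intro mult_mono) auto
    also have "\<dots> = e / 2" using n by (simp add: field_simps)
    finally have "norm (\<zeta> *s w) \<le> e / 2" by (simp add: norm_vector_smult)
    then have "dist v0 (v + \<zeta> *s w) < e"
      using v norm_triangle_ineq4[of "v0 - v" "\<zeta> *s w"] by (simp add: dist_norm algebra_simps)
    then show "v + \<zeta> *s w \<in> S" using e by auto
  qed (use e n in auto)
qed

lemma continuous_on_open_local:
  fixes f :: "'a::t2_space \<Rightarrow> 'b::topological_space"
  assumes "\<And>x. x \<in> S \<Longrightarrow> \<exists>T. open T \<and> x \<in> T \<and> continuous_on T f"
  shows "continuous_on S f"
proof (rule continuous_at_imp_continuous_on, rule ballI)
  show "isCont f x" if "x \<in> S" for x
    using assms[OF that] continuous_on_eq_continuous_at by blast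
qed

text \<open>Differentiability at each point does not give this directly, but Cauchy's integrand
  involves only F itself, which is continuous.\<close>

lemma continuous_on_directional_derivative:
  fixes F :: "complex ^ 'a::finite \<Rightarrow> complex"
  assumes F: "cholomorphic_on F S"
  shows "continuous_on S (\<lambda>v. frechet_derivative F (at v) w)"
proof (rule continuous_on_open_local)
  fix v0 assume "v0 \<in> S"
  then obtain \<epsilon> r where r: "\<epsilon> > 0" "r > 0" "ball v0 \<epsilon> \<subseteq> S"
    "\<And>v \<zeta>::complex. v \<in> ball v0 \<epsilon> \<Longrightarrow> \<zeta> \<in> cball 0 r \<Longrightarrow> v + \<zeta> *s w \<in> S"
    using cball_direction cholomorphic_on_open[OF F] by metis
  define e where "e = (\<lambda>t. of_real r * exp (2 * of_real pi * \<i> * of_real t))"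
  have e: "e t \<in> cball 0 r" "e t \<noteq> 0" for t
    using r by (auto simp: e_def norm_mult mult.commute mult.left_commute)
  have conte: "continuous_on T e" for T unfolding e_def by (intro continuous_intros)
  have inS: "v + e t *s w \<in> S" if "v \<in> ball v0 \<epsilon>" for v t using r(4)[OF that e(1)] .
  have "continuous_on (ball v0 \<epsilon> \<times> cbox 0 (1::real)) (\<lambda>(v, t). F (v + e t *s w) / e t)"
    unfolding split_beta
  proof (intro continuous_on_divide)
    show "continuous_on (ball v0 \<epsilon> \<times> cbox 0 (1::real)) (\<lambda>p. F (fst p + e (snd p) *s w))"
      by (intro continuous_on_compose2[OF cholomorphic_on_continuous[OF F]]
          continuous_on_compose2[OF conte[of UNIV]] continuous_intros continuous_on_vector_smult)
        (use inS in auto)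
    show "continuous_on (ball v0 \<epsilon> \<times> cbox 0 (1::real)) (\<lambda>p. e (snd p))"
      by (intro continuous_on_compose2[OF conte[of UNIV]] continuous_intros) auto
  qed (use e in auto)
  then have "continuous_on (ball v0 \<epsilon>) (\<lambda>v. integral (cbox 0 1) (\<lambda>t. F (v + e t *s w) / e t))"
    by (rule integral_continuous_on_param)
  moreover have "integral (cbox 0 1) (\<lambda>t. F (v + e t *s w) / e t) = frechet_derivative F (at v) w"
    if "v \<in> ball v0 \<epsilon>" for v
    using cauchy_directional_derivative[OF F r(2) r(4)[OF that]] by (simp add: e_def)
  ultimately have "continuous_on (ball v0 \<epsilon>) (\<lambda>v. frechet_derivative F (at v) w)"
    by (rule continuous_on_eq)
  then show "\<exists>T. open T \<and> v0 \<in> T \<and> continuous_on T (\<lambda>v. frechet_derivative F (at v) w)"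
    using r by (intro exI[of _ "ball v0 \<epsilon>"]) auto
qed

text \<open>Differentiation under the integral sign yields a real linear derivative; its
  compatibility with complex scalars is carried through the integral separately.\<close>

lemma cholomorphic_on_integral:
  fixes G :: "complex ^ 'a::finite \<Rightarrow> real \<Rightarrow> complex"
  assumes U: "open U" "convex U"
    and G': "\<And>v t. v \<in> U \<Longrightarrow> t \<in> {0..1} \<Longrightarrow> chas_derivative (\<lambda>v. G v t) (G' v t) v"
    and cont': "\<And>w. continuous_on (U \<times> {0..1}) (\<lambda>(v, t). G' v t w)"
    and cont: "\<And>v. v \<in> U \<Longrightarrow> continuous_on {0..1} (G v)"
  shows "cholomorphic_on (\<lambda>v. integral {0..1} (G v)) U"
proof (rule cholomorphic_onI)
  fix v0 assume v0: "v0 \<in> U"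
  \<comment> \<open>The Leibniz rule integrates the derivative as an element of the space of bounded
    linear maps, so continuity is checked there, one basis vector at a time.\<close>
  define B where "B = (\<lambda>v t. Blinfun (G' v t))"
  have B: "blinfun_apply (B v t) = G' v t" if "v \<in> U" "t \<in> {0..1}" for v t
    using G'[OF that] unfolding B_def
    by (intro bounded_linear_Blinfun_apply) (auto simp: chas_derivative_def has_derivative_def)
  have contB: "continuous_on (U \<times> cbox 0 1) (\<lambda>(v, t). B v t)"
  proof (rule continuous_on_blinfun_componentwise)
    fix i :: "complex ^ 'a" assume "i \<in> Basis"
    have "continuous_on (U \<times> cbox 0 1) (\<lambda>x. blinfun_apply (case x of (v, t) \<Rightarrow> B v t) i) \<longleftrightarrow>
        continuous_on (U \<times> cbox 0 1) (\<lambda>(v, t). G' v t i)"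
      by (rule continuous_on_cong) (auto simp: B)
    then show "continuous_on (U \<times> cbox 0 1) (\<lambda>x. blinfun_apply (case x of (v, t) \<Rightarrow> B v t) i)"
      using cont' by simp
  qed
  have h1: "((\<lambda>v. G v t) has_derivative blinfun_apply (B v t)) (at v within U)"
    if "v \<in> U" "t \<in> cbox 0 1" for v t
    using G'[of v t] that by (simp add: B chas_derivative_def has_derivative_at_withinI)
  have h2: "G v integrable_on cbox 0 1" if "v \<in> U" for v
    using cont[OF that] by (intro integrable_continuous) auto
  have "((\<lambda>v. integral (cbox 0 1) (G v)) has_derivative integral (cbox 0 1) (B v0)) (at v0 within U)"
    by (rule leibniz_rule[where f = G and fx = B and U = U and a = 0 and b = 1 and ?x0.0 = v0])
      (erule (1) h1 | erule h2 | rule contB v0 U(2))+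
  then have 1: "((\<lambda>v. integral {0..1} (G v)) has_derivative integral {0..1} (B v0)) (at v0)"
    by (simp add: at_within_open[OF v0 U(1)])
  have "continuous_on (cbox 0 1) (Pair v0 :: real \<Rightarrow> _)"
    by (rule continuous_on_Pair[OF continuous_on_const continuous_on_id])
  then have "continuous_on (cbox 0 1) (\<lambda>t. B v0 t)"
    using continuous_on_compose2[OF contB, of "cbox 0 1" "Pair v0"] v0 by auto
  then have int: "B v0 integrable_on {0..1}" using integrable_continuous by fastforce
  have "blinfun_apply (integral {0..1} (B v0)) (c *s w) = c * blinfun_apply (integral {0..1} (B v0)) w"
    for c w
  proof -
    have "blinfun_apply (integral {0..1} (B v0)) (c *s w) = integral {0..1} (\<lambda>t. B v0 t (c *s w))"
      using int by (rule blinfun_apply_integral)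
    also have "\<dots> = integral {0..1} (\<lambda>t. c * B v0 t w)"
      using v0 chas_derivative_scale[OF G'[OF v0]] by (intro integral_cong) (simp add: B)
    also have "\<dots> = c * integral {0..1} (\<lambda>t. B v0 t w)" by simp
    also have "integral {0..1} (\<lambda>t. B v0 t w) = blinfun_apply (integral {0..1} (B v0)) w"
      using int by (rule blinfun_apply_integral[symmetric])
    finally show ?thesis .
  qed
  with 1 show "\<exists>g'. chas_derivative (\<lambda>v. integral {0..1} (G v)) g' v0"
    unfolding chas_derivative_def by blast
qed fact

text \<open>Cauchy's integral is differentiated in v. The derivative of its integrand is continuous
  in both variables by \<open>continuous_on_directional_derivative\<close>.\<close>

lemma cholomorphic_on_directional_derivative:
  fixes F :: "complex ^ 'a::finite \<Rightarrow> complex"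
  assumes F: "cholomorphic_on F S"
  shows "cholomorphic_on (\<lambda>v. frechet_derivative F (at v) w) S"
proof (rule cholomorphic_on_local[OF cholomorphic_on_open[OF F]])
  fix v0 assume "v0 \<in> S"
  then obtain \<epsilon> r where r: "\<epsilon> > 0" "r > 0" "ball v0 \<epsilon> \<subseteq> S"
    "\<And>v \<zeta>::complex. v \<in> ball v0 \<epsilon> \<Longrightarrow> \<zeta> \<in> cball 0 r \<Longrightarrow> v + \<zeta> *s w \<in> S"
    using cball_direction cholomorphic_on_open[OF F] by metis
  define e where "e = (\<lambda>t. of_real r * exp (2 * of_real pi * \<i> * of_real t))"
  have e: "e t \<in> cball 0 r" "e t \<noteq> 0" for t
    using r by (auto simp: e_def norm_mult mult.commute mult.left_commute)
  have conte: "continuous_on T e" for T unfolding e_def by (intro continuous_intros)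
  have inS: "v + e t *s w \<in> S" if "v \<in> ball v0 \<epsilon>" for v t using r(4)[OF that e(1)] .
  have "cholomorphic_on (\<lambda>v. integral {0..1} (\<lambda>t. F (v + e t *s w) / e t)) (ball v0 \<epsilon>)"
  proof (rule cholomorphic_on_integral[where
        G' = "\<lambda>v t u. frechet_derivative F (at (v + e t *s w)) u / e t"])
    fix v t assume v: "v \<in> ball v0 \<epsilon>"
    have "chas_derivative (\<lambda>x. (x + e t *s w) $ j) (\<lambda>u. u $ j) v" for j
      using chas_derivative_add[OF chas_derivative_nth[of j] chas_derivative_const[of "e t * w $ j"]]
      by simp
    from chas_derivative_cmult[OF chas_derivative_compose[OF this cholomorphic_onD[OF F inS[OF v]]], of "inverse (e t)"]
    show "chas_derivative (\<lambda>v. F (v + e t *s w) / e t)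
        (\<lambda>u. frechet_derivative F (at (v + e t *s w)) u / e t) v"
      by (simp add: divide_inverse mult.commute)
  next
    fix u
    show "continuous_on (ball v0 \<epsilon> \<times> {0..1})
        (\<lambda>(v, t). frechet_derivative F (at (v + e t *s w)) u / e t)"
      unfolding split_beta
      by (intro continuous_on_divide continuous_on_compose2[OF continuous_on_directional_derivative[OF F]]
          continuous_on_compose2[OF conte[of UNIV]] continuous_intros continuous_on_vector_smult ballI)
        (use e(2) inS in \<open>auto\<close>)
  next
    fix v assume v: "v \<in> ball v0 \<epsilon>"
    show "continuous_on {0..1} (\<lambda>t. F (v + e t *s w) / e t)"
      by (intro continuous_on_divide continuous_on_compose2[OF cholomorphic_on_continuous[OF F]]
          conte continuous_intros continuous_on_vector_smult ballI) (use e(2) inS[OF v] in auto)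
  qed auto
  moreover have "integral {0..1} (\<lambda>t. F (v + e t *s w) / e t) = frechet_derivative F (at v) w"
    if "v \<in> ball v0 \<epsilon>" for v
    using cauchy_directional_derivative[OF F r(2) r(4)[OF that]] by (simp add: e_def)
  ultimately have "cholomorphic_on (\<lambda>v. frechet_derivative F (at v) w) (ball v0 \<epsilon>)"
    by (rule cholomorphic_on_cong)
  then show "\<exists>T. v0 \<in> T \<and> cholomorphic_on (\<lambda>v. frechet_derivative F (at v) w) T"
    using r(1) by (intro exI[of _ "ball v0 \<epsilon>"]) auto
qed

text \<open>The quotient is extended over the hyperplane by Hadamard's integral
  \<open>\<integral>\<^sub>0\<^sup>1 \<partial>\<^sub>k F(y\<^sub>1, \<dots>, t y\<^sub>k, \<dots>) dt\<close>.\<close>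

lemma cholomorphic_division:
  fixes F :: "complex ^ 'a::finite \<Rightarrow> complex"
  assumes F: "cholomorphic_on F S"
    and zero: "\<And>y. y \<in> S \<Longrightarrow> y $ k = 0 \<Longrightarrow> F y = 0"
  obtains h where "cholomorphic_on h S" "\<And>y. y \<in> S \<Longrightarrow> F y = y $ k * h y"
proof -
  define P where "P = (\<lambda>y. frechet_derivative F (at y) (axis k 1))"
  \<comment> \<open>On the hyperplane continuity forces the partial derivative as the value of the
    quotient.\<close>
  define h where "h = (\<lambda>y. if y $ k = 0 then P y else F y / y $ k)"
  have P: "cholomorphic_on P S"
    unfolding P_def using F by (rule cholomorphic_on_directional_derivative)
  have S: "open S" using F by (rule cholomorphic_on_open)
  have "cholomorphic_on h S"
  proof (rule cholomorphic_on_local[OF S])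
    fix y0 assume y0: "y0 \<in> S"
    show "\<exists>T. y0 \<in> T \<and> cholomorphic_on h T"
    proof (cases "y0 $ k = 0")
      case False
      define T where "T = S \<inter> {y. y $ k \<noteq> 0}"
      have "open {y :: complex ^ 'a. y $ k \<noteq> 0}"
        by (intro open_Collect_neq continuous_intros)
      then have T: "open T" "T \<subseteq> S" using S by (auto simp: T_def)
      have "cholomorphic_on (\<lambda>y. F y / y $ k) T"
        using T cholomorphic_on_subset[OF F T] by (intro cholomorphic_on_divide cholomorphic_on_nth)
          (auto simp: T_def)
      then have "cholomorphic_on h T"
        by (rule cholomorphic_on_cong) (auto simp: h_def T_def)
      then show ?thesis using y0 False by (intro exI[of _ T]) (auto simp: T_def)
    next
      case True
      obtain e where e: "e > 0" "ball y0 e \<subseteq> S" using y0 S openE by blast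
      \<comment> \<open>Only coordinate k is shrunk. The ball is mapped into itself because its
        centre lies on the hyperplane.\<close>
      define A where "A = (\<lambda>(t::real) (y::complex ^ 'a). \<chi> j. if j = k then of_real t * y $ j else y $ j)"
      have A: "A t y \<in> ball y0 e" if "y \<in> ball y0 e" "t \<in> {0..1}" for t y
      proof -
        have "norm (A t y - y0) \<le> norm (y - y0)"
          using that True unfolding A_def
          by (intro norm_le_componentwise_cart) (auto simp: norm_mult mult_left_le_one_le)
        then show ?thesis using that by (simp add: dist_norm norm_minus_commute)
      qed
      have contA: "continuous_on X (\<lambda>x. A (f x) (g x))"
        if "continuous_on X f" "continuous_on X g" for X :: "'b::topological_space set" and f g
      proof (rule continuous_on_vec_iff)
        show "continuous_on X (\<lambda>x. A (f x) (g x) $ j)" for j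
          using that by (cases "j = k") (auto simp: A_def intro!: continuous_intros)
      qed
      have "cholomorphic_on (\<lambda>y. integral {0..1} (\<lambda>t. P (A t y))) (ball y0 e)"
      proof (rule cholomorphic_on_integral[where
            G' = "\<lambda>y t u. frechet_derivative P (at (A t y)) (A t u)"])
        fix y and t :: real assume y: "y \<in> ball y0 e" and t: "t \<in> {0..1}"
        have "chas_derivative (\<lambda>y. A t y $ j) (\<lambda>u. A t u $ j) y" for j
          using chas_derivative_cmult[OF chas_derivative_nth[of j]] chas_derivative_nth
          by (cases "j = k") (auto simp: A_def)
        moreover have "A t y \<in> S" using A[OF y t] e(2) by auto
        ultimately have "chas_derivative (\<lambda>y. P (A t y))
            (\<lambda>u. frechet_derivative P (at (A t y)) (\<chi> j. A t u $ j)) y"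
          by (intro chas_derivative_compose cholomorphic_onD[OF P])
        then show "chas_derivative (\<lambda>y. P (A t y)) (\<lambda>u. frechet_derivative P (at (A t y)) (A t u)) y"
          by simp
      next
        fix u
        have *: "frechet_derivative P (at (A t y)) (A t u) =
            (\<Sum>j\<in>UNIV. A t u $ j * frechet_derivative P (at (A t y)) (axis j 1))"
          if "y \<in> ball y0 e" "t \<in> {0..1}" for y t
          using A[OF that] e(2) by (intro chas_derivative_expand[OF cholomorphic_onD[OF P]]) auto
        have "continuous_on (ball y0 e \<times> {0..1})
          (\<lambda>(y, t). \<Sum>j\<in>UNIV. A t u $ j * frechet_derivative P (at (A t y)) (axis j 1))"
          unfolding split_beta
          by (intro continuous_intros contA
              continuous_on_compose2[OF continuous_on_directional_derivative[OF P]])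
            (use A e(2) in auto)
        then show "continuous_on (ball y0 e \<times> {0..1})
          (\<lambda>(y, t). frechet_derivative P (at (A t y)) (A t u))"
          by (rule continuous_on_eq) (use * in auto)
      next
        fix y assume "y \<in> ball y0 e"
        then show "continuous_on {0..1} (\<lambda>t. P (A t y))"
          by (intro continuous_on_compose2[OF cholomorphic_on_continuous[OF P]] contA continuous_intros)
            (use A e(2) in auto)
      qed auto
      moreover have "integral {0..1} (\<lambda>t. P (A t y)) = h y" if y: "y \<in> ball y0 e" for y
      proof -
        \<comment> \<open>The integrand is the derivative of F along the path from the projection
          \<open>A 0 y\<close>, where F vanishes, to y.\<close>
        have "((\<lambda>t. y $ k * P (A t y)) has_integral F (A 1 y) - F (A 0 y)) {0..1}"
        proof (rule fundamental_theorem_of_calculus)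
          fix t :: real assume t: "t \<in> {0..1}"
          have F': "chas_derivative F (frechet_derivative F (at (A t y))) (A t y)"
            using A[OF y t] e(2) by (intro cholomorphic_onD[OF F]) auto
          define y' where "y' = A 0 y"
          have Aeq: "A s y = y' + s *\<^sub>R (y $ k *s axis k 1)" for s
            by (auto simp: y'_def A_def vec_eq_iff axis_def; simp add: scaleR_conv_of_real)
          have "((\<lambda>s. A s y) has_derivative (\<lambda>s. s *\<^sub>R (y $ k *s axis k 1))) (at t within {0..1})"
            unfolding Aeq by (auto intro!: derivative_eq_intros)
          from has_derivative_compose[OF this] F'
          have "((\<lambda>s. F (A s y)) has_derivative
             (\<lambda>s. frechet_derivative F (at (A t y)) (s *\<^sub>R (y $ k *s axis k 1)))) (at t within {0..1})"
            by (auto simp: chas_derivative_def)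
          moreover have "frechet_derivative F (at (A t y)) (s *\<^sub>R (y $ k *s axis k 1)) =
              s *\<^sub>R (y $ k * P (A t y))" for s
            using chas_derivative_linear[OF F'] chas_derivative_scale[OF F']
            by (simp add: linear_scale P_def)
          ultimately show "((\<lambda>s. F (A s y)) has_vector_derivative y $ k * P (A t y)) (at t within {0..1})"
            by (simp add: has_vector_derivative_def)
        qed simp
        moreover have "A 1 y = y" by (simp add: A_def vec_eq_iff)
        moreover have "F (A 0 y) = 0"
          using A[OF y, of 0] e(2) by (intro zero) (auto simp: A_def)
        ultimately have "integral {0..1} (\<lambda>t. y $ k * P (A t y)) = F y"
          by (intro integral_unique) simp
        then have eq: "y $ k * integral {0..1} (\<lambda>t. P (A t y)) = F y"
          unfolding integral_mult_right .
        show ?thesis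
        proof (cases "y $ k = 0")
          case True
          \<comment> \<open>On the hyperplane the path is constant, so the integral is
            \<open>P y\<close>, the value given to h there.\<close>
          then have "A t y = y" for t by (auto simp: A_def vec_eq_iff)
          then show ?thesis using True by (simp add: h_def)
        next
          case False
          then show ?thesis using eq by (simp add: h_def field_simps)
        qed
      qed
      ultimately have "cholomorphic_on h (ball y0 e)" by (rule cholomorphic_on_cong)
      then show ?thesis using e(1) by (intro exI[of _ "ball y0 e"]) auto
    qed
  qed
  moreover have "F y = y $ k * h y" if "y \<in> S" for y
    using zero[OF that] by (simp add: h_def)
  ultimately show thesis by (rule that)
qed

text \<open>Gaussian elimination by induction on the number of unknowns. The matrix is the identity
  at v0, so every pivot is 1 there and remains non-zero on a smaller neighbourhood.\<close>

lemma cholomorphic_linear_system: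
  fixes B :: "'i \<Rightarrow> 'i \<Rightarrow> complex ^ 'a::finite \<Rightarrow> complex"
  assumes "finite A" "v0 \<in> S" "open S"
    and "\<And>i k. i \<in> A \<Longrightarrow> k \<in> A \<Longrightarrow> cholomorphic_on (B i k) S"
    and "\<And>i k. i \<in> A \<Longrightarrow> k \<in> A \<Longrightarrow> B i k v0 = (if i = k then 1 else 0)"
    and "\<And>i. i \<in> A \<Longrightarrow> cholomorphic_on (t i) S"
  shows "\<exists>T c. open T \<and> v0 \<in> T \<and> T \<subseteq> S \<and> (\<forall>i\<in>A. cholomorphic_on (c i) T) \<and>
    (\<forall>x\<in>T. \<forall>i\<in>A. (\<Sum>k\<in>A. B i k x * c k x) = t i x)"
  using assms
proof (induction A arbitrary: B t S rule: finite_induct)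
  case empty
  then show ?case by auto
next
  case (insert a A)
  define S' where "S' = S \<inter> B a a -` (- {0})"
  have Baa: "cholomorphic_on (B a a) S" using insert.prems by auto
  have S': "open S'" "S' \<subseteq> S" "v0 \<in> S'"
    using insert.prems continuous_open_preimage[OF cholomorphic_on_continuous[OF Baa] insert.prems(2)]
    by (auto simp: S'_def open_Compl)
  have nz: "B a a x \<noteq> 0" if "x \<in> S'" for x using that by (auto simp: S'_def)
  have hB: "cholomorphic_on (B i k) S'" if "i \<in> insert a A" "k \<in> insert a A" for i k
    using cholomorphic_on_subset[OF insert.prems(3)[OF that] S'(1,2)] .
  have ht: "cholomorphic_on (t i) S'" if "i \<in> insert a A" for i
    using cholomorphic_on_subset[OF insert.prems(5)[OF that] S'(1,2)] .
  \<comment> \<open>The Schur complement of the pivot. It is again the identity at v0, because the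
    entries of column a in the other rows vanish there.\<close>
  define B' where "B' = (\<lambda>i k x. B i k x - B i a x * B a k x / B a a x)"
  define t' where "t' = (\<lambda>i x. t i x - B i a x * t a x / B a a x)"
  have "\<exists>T c. open T \<and> v0 \<in> T \<and> T \<subseteq> S' \<and> (\<forall>i\<in>A. cholomorphic_on (c i) T) \<and>
    (\<forall>x\<in>T. \<forall>i\<in>A. (\<Sum>k\<in>A. B' i k x * c k x) = t' i x)"
  proof (rule insert.IH[OF S'(3,1)])
    show "cholomorphic_on (B' i k) S'" if "i \<in> A" "k \<in> A" for i k
      unfolding B'_def using that nz
      by (intro cholomorphic_on_diff cholomorphic_on_divide cholomorphic_on_mult hB) auto
    show "cholomorphic_on (t' i) S'" if "i \<in> A" for i
      unfolding t'_def using that nz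
      by (intro cholomorphic_on_diff cholomorphic_on_divide cholomorphic_on_mult hB ht) auto
    show "B' i k v0 = (if i = k then 1 else 0)" if "i \<in> A" "k \<in> A" for i k
      using that insert.hyps(2) insert.prems(4) by (auto simp: B'_def)
  qed
  then obtain T c where T: "open T" "v0 \<in> T" "T \<subseteq> S'" "\<And>i. i \<in> A \<Longrightarrow> cholomorphic_on (c i) T"
    and eq: "\<And>x i. x \<in> T \<Longrightarrow> i \<in> A \<Longrightarrow> (\<Sum>k\<in>A. B' i k x * c k x) = t' i x"
    by blast
  \<comment> \<open>Back substitution: row a is solved for the eliminated unknown.\<close>
  define c' where "c' = (\<lambda>i x. if i = a then (t a x - (\<Sum>k\<in>A. B a k x * c k x)) / B a a x else c i x)"
  have c'A: "c' k = c k" if "k \<in> A" for k using that insert.hyps by (auto simp: c'_def)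
  have "cholomorphic_on (c' a) T"
    unfolding c'_def using T nz
    by (auto intro!: cholomorphic_on_diff cholomorphic_on_divide cholomorphic_on_mult
        cholomorphic_on_sum cholomorphic_on_subset[OF hB] cholomorphic_on_subset[OF ht])
  moreover have "(\<Sum>k\<in>insert a A. B i k x * c' k x) = t i x" if x: "x \<in> T" and i: "i \<in> insert a A" for x i
  proof -
    have nzx: "B a a x \<noteq> 0" using x T nz by auto
    have "(\<Sum>k\<in>insert a A. B i k x * c' k x) =
        B i a x * c' a x + (\<Sum>k\<in>A. B i k x * c k x)"
      using insert.hyps c'A by (simp cong: sum.cong)
    also have "\<dots> = t i x"
    proof (cases "i = a")
      case True
      then show ?thesis using nzx by (simp add: c'_def)
    next
      case False
      then have "i \<in> A" using i by simp
      have "(\<Sum>k\<in>A. B' i k x * c k x) =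
          (\<Sum>k\<in>A. B i k x * c k x) - B i a x / B a a x * (\<Sum>k\<in>A. B a k x * c k x)"
        by (simp add: B'_def algebra_simps sum_subtractf sum_distrib_left)
      then have *: "(\<Sum>k\<in>A. B i k x * c k x) =
          t' i x + B i a x / B a a x * (\<Sum>k\<in>A. B a k x * c k x)"
        using eq[OF x \<open>i \<in> A\<close>] by simp
      show ?thesis unfolding * using nzx by (simp add: t'_def c'_def field_simps)
    qed
    finally show ?thesis .
  qed
  ultimately show ?case
    using T S' c'A by (intro exI[of _ T] exI[of _ c']) auto
qed

section \<open>Projective space\<close>

lemma rep_cproj_nonzero [simp]: "rep_cproj q \<noteq> 0"
  using Quotient3_rep_reflp[OF Quotient3_cproj, of q] by (simp add: proportional_def)

lemma cproj_class_rep [simp]: "cproj_class (rep_cproj q) = q"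
  using Quotient3_abs_rep[OF Quotient3_cproj] .

lemma proportional_refl: "v \<noteq> 0 \<Longrightarrow> proportional v v"
  by (auto simp: proportional_def intro!: exI[of _ 1])

lemma cproj_class_eq_iff:
  "v \<noteq> 0 \<Longrightarrow> w \<noteq> 0 \<Longrightarrow> cproj_class v = cproj_class w \<longleftrightarrow> (\<exists>c. w = c *s v)"
  using Quotient3_rel[OF Quotient3_cproj, of v w] proportional_refl[of v] proportional_refl[of w]
  by (auto simp: proportional_def)

lemma cproj_class_scale: "c \<noteq> 0 \<Longrightarrow> cproj_class (c *s v) = cproj_class v"
proof (cases "v = 0")
  case False
  assume "c \<noteq> 0"
  then show ?thesis
    using False by (subst cproj_class_eq_iff)
      (auto simp: vec_eq_iff intro!: exI[of _ "inverse c"])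
qed simp

lemma rep_cproj_class:
  assumes "v \<noteq> 0"
  obtains c where "c \<noteq> 0" "rep_cproj (cproj_class v) = c *s v"
proof -
  obtain c where c: "rep_cproj (cproj_class v) = c *s v"
    using cproj_class_eq_iff[of v "rep_cproj (cproj_class v)"] assms by auto
  moreover have "c \<noteq> 0" using c rep_cproj_nonzero[of "cproj_class v"] by auto
  ultimately show thesis using that by blast
qed

lemma in_cone_iff: "v \<in> cone W \<longleftrightarrow> v \<noteq> 0 \<and> cproj_class v \<in> W"
  by (simp add: cone_def)

lemma cone_nonzero: "v \<in> cone W \<Longrightarrow> v \<noteq> 0"
  by (simp add: cone_def)

lemma rep_in_cone: "rep_cproj q \<in> cone W \<longleftrightarrow> q \<in> W"
  by (simp add: cone_def)

lemma cone_mono: "V \<subseteq> W \<Longrightarrow> cone V \<subseteq> cone W"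
  by (auto simp: cone_def)

lemma open_cone: "open W \<longleftrightarrow> open (cone W)"
  by (simp add: open_cproj_def)

lemma cone_scale: "v \<in> cone W \<Longrightarrow> c \<noteq> 0 \<Longrightarrow> c *s v \<in> cone W"
  by (auto simp: cone_def cproj_class_scale)

text \<open>A set stable under scaling is saturated, so openness of its image in projective space
  can be read off from the set itself.\<close>

lemma cone_class_image:
  assumes "0 \<notin> T" "\<And>v c. v \<in> T \<Longrightarrow> c \<noteq> 0 \<Longrightarrow> c *s v \<in> T"
  shows "cone (cproj_class ` T) = T"
proof -
  have "v \<in> T" if v: "v \<noteq> 0" "w \<in> T" "cproj_class w = cproj_class v" for v w
  proof -
    have "w \<noteq> 0" using v assms(1) by auto
    then obtain c where c: "v = c *s w"
      using iffD1[OF cproj_class_eq_iff[OF _ v(1)] v(3)] by blast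
    then have "c \<noteq> 0" using v(1) by auto
    then show ?thesis using c assms(2) v(2) by simp
  qed
  then show ?thesis using assms(1) by (auto simp: cone_def)
qed

lemma descend_class:
  assumes "\<And>v c. v \<in> cone W \<Longrightarrow> c \<noteq> 0 \<Longrightarrow> G (c *s v) = G v" "v \<in> cone W"
  shows "G (rep_cproj (cproj_class v)) = G v"
proof -
  obtain c where "c \<noteq> 0" "rep_cproj (cproj_class v) = c *s v"
    using rep_cproj_class cone_nonzero[OF assms(2)] .
  then show ?thesis using assms by simp
qed

text \<open>The choice made by \<open>rep_cproj\<close> has no continuity. Invariance under scaling
  makes it disappear once the function is pulled back to the cone, where holomorphy is
  tested.\<close>

lemma holomorphic_fun_descend:
  assumes "cholomorphic_on G (cone W)" "\<And>v c. v \<in> cone W \<Longrightarrow> c \<noteq> 0 \<Longrightarrow> G (c *s v) = G v"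
  shows "holomorphic_fun W (\<lambda>q. G (rep_cproj q))"
  unfolding holomorphic_fun_def
  by (rule cholomorphic_on_cong[OF assms(1)]) (simp add: descend_class[of W G] assms(2))

lemma holomorphic_fun_open: "holomorphic_fun W g \<Longrightarrow> open W"
  unfolding holomorphic_fun_def using cholomorphic_on_open open_cone by blast

lemma holomorphic_fun_cong:
  "holomorphic_fun W g \<Longrightarrow> (\<And>q. q \<in> W \<Longrightarrow> g q = h q) \<Longrightarrow> holomorphic_fun W h"
  unfolding holomorphic_fun_def by (erule cholomorphic_on_cong) (auto simp: cone_def)

lemma holomorphic_fun_subset:
  "holomorphic_fun W g \<Longrightarrow> open V \<Longrightarrow> V \<subseteq> W \<Longrightarrow> holomorphic_fun V g"
  unfolding holomorphic_fun_def using cholomorphic_on_subset cone_mono open_cone by metis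

lemma holomorphic_fun_local:
  assumes "open W" "\<And>q. q \<in> W \<Longrightarrow> \<exists>V. q \<in> V \<and> holomorphic_fun V g"
  shows "holomorphic_fun W g"
  unfolding holomorphic_fun_def
proof (rule cholomorphic_on_local)
  fix v assume v: "v \<in> cone W"
  then obtain V where "cproj_class v \<in> V" "holomorphic_fun V g"
    using assms(2)[of "cproj_class v"] by (auto simp: cone_def)
  then show "\<exists>T. v \<in> T \<and> cholomorphic_on (\<lambda>v. g (cproj_class v)) T"
    using v by (intro exI[of _ "cone V"]) (auto simp: cone_def holomorphic_fun_def)
qed (use assms open_cone in blast)

lemma holomorphic_fun_const: "open W \<Longrightarrow> holomorphic_fun W (\<lambda>q. a)"
  using open_cone by (auto simp: holomorphic_fun_def intro: cholomorphic_on_const)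

lemma holomorphic_fun_add:
  "holomorphic_fun W g \<Longrightarrow> holomorphic_fun W h \<Longrightarrow> holomorphic_fun W (\<lambda>q. g q + h q)"
  unfolding holomorphic_fun_def by (rule cholomorphic_on_add)

lemma holomorphic_fun_mult:
  "holomorphic_fun W g \<Longrightarrow> holomorphic_fun W h \<Longrightarrow> holomorphic_fun W (\<lambda>q. g q * h q)"
  unfolding holomorphic_fun_def by (rule cholomorphic_on_mult)

lemma holomorphic_fun_divide:
  "holomorphic_fun W g \<Longrightarrow> holomorphic_fun W h \<Longrightarrow> (\<And>q. q \<in> W \<Longrightarrow> h q \<noteq> 0) \<Longrightarrow>
   holomorphic_fun W (\<lambda>q. g q / h q)"
  unfolding holomorphic_fun_def by (rule cholomorphic_on_divide) (auto simp: cone_def)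

lemma holomorphic_fun_sum:
  "open W \<Longrightarrow> (\<And>i. i \<in> I \<Longrightarrow> holomorphic_fun W (g i)) \<Longrightarrow> holomorphic_fun W (\<lambda>q. \<Sum>i\<in>I. g i q)"
  unfolding holomorphic_fun_def by (rule cholomorphic_on_sum) (auto simp: open_cone)

definition chart :: "'n option \<Rightarrow> 'n::finite cproj set" where
  "chart m = {q. rep_cproj q $ m \<noteq> 0}"

lemma in_chart_class: "v \<noteq> 0 \<Longrightarrow> cproj_class v \<in> chart m \<longleftrightarrow> v $ m \<noteq> 0"
  by (rule rep_cproj_class[of v]) (auto simp: chart_def)

lemma cone_chart: "cone (chart m) = {v. v $ m \<noteq> 0}"
  by (auto simp: cone_def in_chart_class) (metis in_chart_class zero_index)

lemma cone_subset_chart: "V \<subseteq> chart m \<Longrightarrow> v \<in> cone V \<Longrightarrow> v $ m \<noteq> 0"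
  by (auto simp: cone_def in_chart_class)

lemma open_chart: "open (chart m)"
  unfolding open_cone cone_chart by (intro open_Collect_neq continuous_intros)

lemma ex_chart: "\<exists>m. q \<in> chart m"
  using rep_cproj_nonzero[of q] by (auto simp: chart_def vec_eq_iff)

lemma differential_chas_derivative:
  "holomorphic_fun W g \<Longrightarrow> v \<in> cone W \<Longrightarrow>
   chas_derivative (\<lambda>v. g (cproj_class v)) (differential g v) v"
  unfolding holomorphic_fun_def differential_def by (drule (1) cholomorphic_onD) simp

lemma differential_euler:
  assumes "holomorphic_fun W g" "v \<in> cone W"
  shows "differential g v v = 0"
  using homogeneous_euler[OF differential_chas_derivative[OF assms], of 0]
  by (simp add: cproj_class_scale)

lemma differential_scale:
  assumes "holomorphic_fun W g" "v \<in> cone W" "c \<noteq> 0"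
  shows "c * differential g (c *s v) w = differential g v w"
proof -
  have "c * differential g (c *s v) w = 1 * differential g v w"
    using assms holomorphic_fun_open[OF assms(1)] open_cone
    by (intro homogeneous_derivative_scale[OF differential_chas_derivative[OF assms(1,2)]
        differential_chas_derivative[OF assms(1) cone_scale[OF assms(2,3)]], of "cone W"])
      (auto simp: cproj_class_scale)
  then show ?thesis by simp
qed

text \<open>The partial derivatives of a function of degree 0 have degree -1; the factor
  \<open>v $ m\<close> restores degree 0, so that the product is a function on W.\<close>

lemma differential_partial:
  assumes "holomorphic_fun W g" "W \<subseteq> chart m"
  shows "holomorphic_fun W (\<lambda>q. rep_cproj q $ m * differential g (rep_cproj q) (axis j 1))"
    and "v \<in> cone W \<Longrightarrow> rep_cproj (cproj_class v) $ m * differential g (rep_cproj (cproj_class v)) (axis j 1)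
          = v $ m * differential g v (axis j 1)"
proof -
  let ?G = "\<lambda>v. v $ m * differential g v (axis j 1)"
  have inv: "?G (c *s v) = ?G v" if "v \<in> cone W" "c \<noteq> 0" for v c
    using differential_scale[OF assms(1) that, of "axis j 1"] by (simp add: mult_ac)
  have "open (cone W)" using holomorphic_fun_open[OF assms(1)] open_cone by blast
  then have "cholomorphic_on ?G (cone W)"
    using assms(1) unfolding differential_def holomorphic_fun_def
    by (intro cholomorphic_on_mult cholomorphic_on_nth cholomorphic_on_directional_derivative)
  then show "holomorphic_fun W (\<lambda>q. rep_cproj q $ m * differential g (rep_cproj q) (axis j 1))"
    using inv by (rule holomorphic_fun_descend)
  show "v \<in> cone W \<Longrightarrow> rep_cproj (cproj_class v) $ m * differential g (rep_cproj (cproj_class v)) (axis j 1)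
          = v $ m * differential g v (axis j 1)"
    using inv by (rule descend_class)
qed

section \<open>Local coordinates\<close>

lemma local_coordinates_open: "local_coordinates V z \<Longrightarrow> open V" "local_coordinates V z \<Longrightarrow> open (z ` V)"
  and local_coordinates_inj: "local_coordinates V z \<Longrightarrow> inj_on z V"
  by (auto simp: local_coordinates_def)

lemma local_coordinates_subset:
  assumes z: "local_coordinates V z" and V': "open V'" "V' \<subseteq> V"
  shows "local_coordinates V' z"
proof -
  have inj: "inj_on z V" "inj_on z V'"
    using z V' by (auto simp: local_coordinates_def intro: inj_on_subset)
  have hom: "homeomorphism V (z ` V) z (inv_into V z)" using z by (simp add: local_coordinates_def)
  have inv: "inv_into V' z y = inv_into V z y" if "y \<in> z ` V'" for y
    using that inj V' by (auto simp: inv_into_f_f subset_iff)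
  have op: "open (z ` V')"
  proof -
    have "openin (top_of_set V) V'" using V' by (simp add: openin_open_eq z[THEN local_coordinates_open(1)])
    then have "openin (top_of_set (z ` V)) (z ` V')"
      using homeomorphism_imp_open_map[OF hom] by blast
    then show ?thesis using local_coordinates_open(2)[OF z] openin_open_trans by blast
  qed
  have "homeomorphism V' (z ` V') z (inv_into V z)"
    using hom V' inj by (intro homeomorphism_of_subsets[OF hom]) auto
  then have "homeomorphism V' (z ` V') z (inv_into V' z)"
    by (rule homeomorphism_cong) (simp_all add: inv)
  moreover have "holomorphic_fun V'' g \<longleftrightarrow> cholomorphic_on (\<lambda>y. g (inv_into V' z y)) (z ` V'')"
    if "open V''" "V'' \<subseteq> V'" for V'' g
  proof -
    have "holomorphic_fun V'' g \<longleftrightarrow> cholomorphic_on (\<lambda>y. g (inv_into V z y)) (z ` V'')"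
      using z that V' unfolding local_coordinates_def by blast
    also have "\<dots> \<longleftrightarrow> cholomorphic_on (\<lambda>y. g (inv_into V' z y)) (z ` V'')"
      using that inv by (intro cholomorphic_on_cong_iff) (metis image_mono subsetD)
    finally show ?thesis .
  qed
  ultimately show ?thesis
    using V' op inj unfolding local_coordinates_def by blast
qed

lemma coordinates_pullback:
  "local_coordinates V z \<Longrightarrow> holomorphic_fun V g \<Longrightarrow> cholomorphic_on (\<lambda>y. g (inv_into V z y)) (z ` V)"
  unfolding local_coordinates_def by blast

lemma coordinates_holomorphic_fun:
  assumes z: "local_coordinates V z" and h: "cholomorphic_on h (z ` V)"
  shows "holomorphic_fun V (\<lambda>q. h (z q))"
proof -
  have "cholomorphic_on (\<lambda>y. h (z (inv_into V z y))) (z ` V)"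
    by (rule cholomorphic_on_cong[OF h]) (simp add: f_inv_into_f)
  then show ?thesis using z unfolding local_coordinates_def by blast
qed

lemma coordinate_holomorphic: "local_coordinates V z \<Longrightarrow> holomorphic_fun V (\<lambda>q. z q $ k)"
  by (rule coordinates_holomorphic_fun[where h = "\<lambda>y. y $ k"])
    (auto intro: cholomorphic_on_nth local_coordinates_open)

text \<open>The chain rule for g written as a function h of the coordinates. The coefficients are
  the partial derivatives of h, holomorphic by
  \<open>cholomorphic_on_directional_derivative\<close>.\<close>

lemma differential_in_coordinates:
  assumes z: "local_coordinates V z" and g: "holomorphic_fun V g"
  obtains u where "\<And>k. holomorphic_fun V (u k)"
    "\<And>v w. v \<in> cone V \<Longrightarrow>
       differential g v w = (\<Sum>k\<in>UNIV. u k (cproj_class v) * differential (\<lambda>q. z q $ k) v w)"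
proof
  define h where "h = (\<lambda>y. g (inv_into V z y))"
  have h: "cholomorphic_on h (z ` V)" unfolding h_def using z g by (rule coordinates_pullback)
  have gh: "g q = h (z q)" if "q \<in> V" for q
    using that local_coordinates_inj[OF z] by (simp add: h_def)
  show "holomorphic_fun V (\<lambda>q. frechet_derivative h (at (z q)) (axis k 1))" for k
    by (rule coordinates_holomorphic_fun[OF z cholomorphic_on_directional_derivative[OF h]])
  fix v w assume v: "v \<in> cone V"
  have "chas_derivative (\<lambda>v. h (z (cproj_class v)))
      (\<lambda>w. frechet_derivative h (at (z (cproj_class v))) (\<chi> k. differential (\<lambda>q. z q $ k) v w)) v"
    using v by (intro chas_derivative_compose differential_chas_derivative[OF coordinate_holomorphic[OF z]]
        cholomorphic_onD[OF h]) (auto simp: cone_def)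
  then have "chas_derivative (\<lambda>v. g (cproj_class v))
      (\<lambda>w. frechet_derivative h (at (z (cproj_class v))) (\<chi> k. differential (\<lambda>q. z q $ k) v w)) v"
    using local_coordinates_open(1)[OF z] v
    by (rule_tac chas_derivative_transform[where T = "cone V"]) (auto simp: open_cone gh cone_def)
  then have "differential g v w =
      frechet_derivative h (at (z (cproj_class v))) (\<chi> k. differential (\<lambda>q. z q $ k) v w)"
    using chas_derivative_unique[OF differential_chas_derivative[OF g v]] by metis
  also have "\<dots> = (\<Sum>k\<in>UNIV. (\<chi> k. differential (\<lambda>q. z q $ k) v w) $ k *
       frechet_derivative h (at (z (cproj_class v))) (axis k 1))"
    using v by (intro chas_derivative_expand[OF cholomorphic_onD[OF h]]) (auto simp: cone_def)
  finally show "differential g v w = (\<Sum>k\<in>UNIV. frechet_derivative h (at (z (cproj_class v))) (axis k 1)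
       * differential (\<lambda>q. z q $ k) v w)"
    by (simp add: mult.commute)
qed

lemma holomorphic_fun_ratio:
  assumes "open V" "V \<subseteq> chart m"
  shows "holomorphic_fun V (\<lambda>q. rep_cproj q $ j / rep_cproj q $ m)"
  using assms
  by (intro holomorphic_fun_descend[of "\<lambda>v. v $ j / v $ m"] cholomorphic_on_divide cholomorphic_on_nth)
    (auto simp: open_cone dest: cone_subset_chart)

lemma ratio_class: "v \<noteq> 0 \<Longrightarrow> rep_cproj (cproj_class v) $ j / rep_cproj (cproj_class v) $ m = v $ j / v $ m"
  by (rule rep_cproj_class[of v]) auto

text \<open>A local section \<open>y \<mapsto> L y\<close> of the projection from the cone, composed with the inverse of the
  coordinates, provides the tangent vectors dual to the differentials of the coordinates.\<close>

lemma coordinates_dual_vectors: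
  fixes z :: "'n::finite cproj \<Rightarrow> complex ^ 'n"
  assumes z: "local_coordinates V z" and v: "v \<in> cone V"
  obtains w :: "'n \<Rightarrow> complex ^ ('n option)"
  where "\<And>k k'. differential (\<lambda>q. z q $ k) v (w k') = (if k = k' then 1 else 0)"
proof -
  have v0: "v \<noteq> 0" using v by (simp add: cone_def)
  obtain m where m: "cproj_class v \<in> chart m" using ex_chart by blast
  then have vm: "v $ m \<noteq> 0" using in_chart_class v0 by blast
  define V' where "V' = V \<inter> chart m"
  have V': "open V'" "V' \<subseteq> V" "V' \<subseteq> chart m"
    using local_coordinates_open[OF z] open_chart by (auto simp: V'_def)
  have z': "local_coordinates V' z" using local_coordinates_subset[OF z V'(1,2)] .
  define p where "p = cproj_class v"
  have p: "p \<in> V'" using v m by (simp add: p_def V'_def cone_def)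
  \<comment> \<open>The representative whose entry m equals 1. Its entries are ratios of homogeneous
    coordinates, hence holomorphic in y.\<close>
  define L :: "complex ^ 'n \<Rightarrow> complex ^ ('n option)" where
    "L = (\<lambda>y. \<chi> j. rep_cproj (inv_into V' z y) $ j / rep_cproj (inv_into V' z y) $ m)"
  have L: "cholomorphic_on (\<lambda>y. L y $ j) (z ` V')" for j
    using coordinates_pullback[OF z' holomorphic_fun_ratio[OF V'(1,3)]] by (simp add: L_def)
  have Leq: "L y = inverse (rep_cproj (inv_into V' z y) $ m) *s rep_cproj (inv_into V' z y)" for y
    by (simp add: L_def vec_eq_iff divide_inverse mult.commute)
  have zL: "z (cproj_class (L y)) = y" if "y \<in> z ` V'" for y
  proof -
    have "inv_into V' z y \<in> V'" using that by (rule inv_into_into)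
    then have "rep_cproj (inv_into V' z y) $ m \<noteq> 0" using V'(3) by (auto simp: chart_def)
    then show ?thesis using that by (simp add: Leq cproj_class_scale f_inv_into_f)
  qed
  have L0: "L (z p) = inverse (v $ m) *s v"
    using ratio_class[OF v0] local_coordinates_inj[OF z'] p
    by (simp add: L_def p_def vec_eq_iff divide_inverse mult.commute)
  have L0V: "L (z p) \<in> cone V'"
    unfolding L0 using vm p v0 by (simp add: cone_def cproj_class_scale p_def)
  \<comment> \<open>Partial derivatives of L. Differentiating the identity that z of the class of
    \<open>L y\<close> is y shows them to be dual to the dz at \<open>L (z p)\<close>.\<close>
  define w where "w = (\<lambda>k. \<chi> j. frechet_derivative (\<lambda>y. L y $ j) (at (z p)) (axis k 1))"
  have "differential (\<lambda>q. z q $ k) (L (z p)) (w k') = (if k = k' then 1 else 0)" for k k'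
  proof -
    have "chas_derivative (\<lambda>y. z (cproj_class (L y)) $ k)
       (\<lambda>u. differential (\<lambda>q. z q $ k) (L (z p)) (\<chi> j. frechet_derivative (\<lambda>y. L y $ j) (at (z p)) u)) (z p)"
      using p by (intro chas_derivative_compose[where h = L] cholomorphic_onD[OF L]
          differential_chas_derivative[OF coordinate_holomorphic[OF z'] L0V]) auto
    then have "chas_derivative (\<lambda>y. y $ k)
       (\<lambda>u. differential (\<lambda>q. z q $ k) (L (z p)) (\<chi> j. frechet_derivative (\<lambda>y. L y $ j) (at (z p)) u)) (z p)"
      by (rule chas_derivative_transform[where T = "z ` V'"])
        (use p zL local_coordinates_open(2)[OF z'] in auto)
    from chas_derivative_unique[OF this chas_derivative_nth[of k "z p"]] show ?thesis
      by (simp add: w_def fun_eq_iff axis_def)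
  qed
  \<comment> \<open>Differentials have degree -1 in the base point, so passing from
    \<open>L (z p)\<close>, which is v divided by \<open>v $ m\<close>, back to v scales the tangent
    vectors by \<open>v $ m\<close>.\<close>
  moreover have "differential (\<lambda>q. z q $ k) v (v $ m *s u) = differential (\<lambda>q. z q $ k) (L (z p)) u" for k u
  proof -
    have "inverse (v $ m) * differential (\<lambda>q. z q $ k) (L (z p)) u = differential (\<lambda>q. z q $ k) v u"
      unfolding L0 using vm v by (intro differential_scale[OF coordinate_holomorphic[OF z]]) auto
    then show ?thesis
      using chas_derivative_scale[OF differential_chas_derivative[OF coordinate_holomorphic[OF z] v]] vm
      by (simp add: field_simps)
  qed
  ultimately show thesis by (intro that[of "\<lambda>k. v $ m *s w k"]) simp
qed

section \<open>Sections of twisting sheaves\<close>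

lemma twisted_carrier:
  "s \<in> carrier (Sec (direct_sum C (\<lambda>c. twisting_sheaf (e c))) W) \<longleftrightarrow>
   s \<in> extensional C \<and> (\<forall>c\<in>C. s c \<in> extensional (cone W) \<and> cholomorphic_on (s c) (cone W) \<and>
     (\<forall>v\<in>cone W. \<forall>a. a \<noteq> 0 \<longrightarrow> s c (a *s v) = a powi e c * s c v))"
  by (auto simp: direct_sum_def twisting_sheaf_def PiE_def Pi_def)

lemma twisted_ops:
  "zero (Sec (direct_sum C (\<lambda>c. twisting_sheaf (e c))) W) = (\<lambda>c\<in>C. \<lambda>v\<in>cone W. 0)"
  "add (Sec (direct_sum C (\<lambda>c. twisting_sheaf (e c))) W) s t = (\<lambda>c\<in>C. \<lambda>v\<in>cone W. s c v + t c v)"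
  "smult (Sec (direct_sum C (\<lambda>c. twisting_sheaf (e c))) W) g s =
     (\<lambda>c\<in>C. \<lambda>v\<in>cone W. g (cproj_class v) * s c v)"
  "Res (direct_sum C (\<lambda>c. twisting_sheaf (e c))) V s = (\<lambda>c\<in>C. restrict (s c) (cone V))"
  by (simp_all add: direct_sum_def twisting_sheaf_def)

lemma structure_sheaf_simps:
  "carrier (Sec structure_sheaf W) = {g \<in> extensional W. holomorphic_fun W g}"
  "add (Sec structure_sheaf W) g h = (\<lambda>p\<in>W. g p + h p)"
  "smult (Sec structure_sheaf W) g h = (\<lambda>p\<in>W. g p * h p)"
  "Res structure_sheaf V g = restrict g V"
  "carrier (structure_ring W) = {g \<in> extensional W. holomorphic_fun W g}"
  by (simp_all add: structure_sheaf_def structure_ring_def)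

section \<open>Logarithmic forms of an arrangement\<close>

text \<open>In the applications X is the part of the cone over V that lies off the divisors. The
  expansion is required only there, but its coefficients are holomorphic on all of V; this is what
  limits the poles of \<omega> to those of the E k.\<close>

definition hol_span ::
    "(complex ^ ('n option)) set \<Rightarrow> 'n::finite cproj set \<Rightarrow> 'k set \<Rightarrow>
     ('k \<Rightarrow> complex ^ ('n option) \<Rightarrow> complex ^ ('n option) \<Rightarrow> complex) \<Rightarrow>
     (complex ^ ('n option) \<Rightarrow> complex ^ ('n option) \<Rightarrow> complex) set" where
  "hol_span X V K E = {\<omega>. \<exists>u. (\<forall>k. holomorphic_fun V (u k)) \<and>
     (\<forall>v\<in>X. \<forall>w. \<omega> v w = (\<Sum>k\<in>K. u k (cproj_class v) * E k v w))}"

lemma hol_spanI: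
  "(\<And>k. holomorphic_fun V (u k)) \<Longrightarrow>
   (\<And>v w. v \<in> X \<Longrightarrow> \<omega> v w = (\<Sum>k\<in>K. u k (cproj_class v) * E k v w)) \<Longrightarrow> \<omega> \<in> hol_span X V K E"
  unfolding hol_span_def by blast

lemma hol_spanD:
  "\<omega> \<in> hol_span X V K E \<Longrightarrow> \<exists>u. (\<forall>k. holomorphic_fun V (u k)) \<and>
     (\<forall>v\<in>X. \<forall>w. \<omega> v w = (\<Sum>k\<in>K. u k (cproj_class v) * E k v w))"
  unfolding hol_span_def by blast

lemma hol_span_cong:
  "\<omega> \<in> hol_span X V K E \<Longrightarrow> (\<And>v w. v \<in> X \<Longrightarrow> \<omega>' v w = \<omega> v w) \<Longrightarrow> \<omega>' \<in> hol_span X V K E"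
  unfolding hol_span_def by auto

lemma hol_span_subset:
  assumes "\<omega> \<in> hol_span X V K E" "open V'" "V' \<subseteq> V" "X' \<subseteq> X"
  shows "\<omega> \<in> hol_span X' V' K E"
proof -
  obtain u where u: "\<And>k. holomorphic_fun V (u k)"
    "\<And>v w. v \<in> X \<Longrightarrow> \<omega> v w = (\<Sum>k\<in>K. u k (cproj_class v) * E k v w)"
    using hol_spanD[OF assms(1)] by blast
  show ?thesis
    by (rule hol_spanI[of _ u], rule holomorphic_fun_subset[OF u(1) assms(2,3)])
      (use u(2) assms(4) in blast)
qed

lemma hol_span_base:
  assumes "open V" "finite K" "k \<in> K"
  shows "E k \<in> hol_span X V K E"
  by (rule hol_spanI[where u = "\<lambda>k' q. if k' = k then 1 else 0"])
    (use assms in \<open>auto intro: holomorphic_fun_const simp: if_distrib[of "\<lambda>x. x * _"] cong: if_cong\<close>)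

lemma hol_span_add:
  assumes "\<omega> \<in> hol_span X V K E" "\<eta> \<in> hol_span X V K E"
  shows "(\<lambda>v w. \<omega> v w + \<eta> v w) \<in> hol_span X V K E"
proof -
  obtain u where u: "\<And>k. holomorphic_fun V (u k)"
    "\<And>v w. v \<in> X \<Longrightarrow> \<omega> v w = (\<Sum>k\<in>K. u k (cproj_class v) * E k v w)"
    using hol_spanD[OF assms(1)] by blast
  obtain u' where u': "\<And>k. holomorphic_fun V (u' k)"
    "\<And>v w. v \<in> X \<Longrightarrow> \<eta> v w = (\<Sum>k\<in>K. u' k (cproj_class v) * E k v w)"
    using hol_spanD[OF assms(2)] by blast
  show ?thesis using u u'
    by (intro hol_spanI[where u = "\<lambda>k q. u k q + u' k q"] holomorphic_fun_add)
      (auto simp: distrib_right sum.distrib)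
qed

lemma hol_span_smult:
  assumes "holomorphic_fun V g" "\<omega> \<in> hol_span X V K E"
  shows "(\<lambda>v w. g (cproj_class v) * \<omega> v w) \<in> hol_span X V K E"
proof -
  obtain u where "\<And>k. holomorphic_fun V (u k)"
    "\<And>v w. v \<in> X \<Longrightarrow> \<omega> v w = (\<Sum>k\<in>K. u k (cproj_class v) * E k v w)"
    using hol_spanD[OF assms(2)] by blast
  then show ?thesis using assms(1)
    by (intro hol_spanI[where u = "\<lambda>k q. g q * u k q"] holomorphic_fun_mult)
      (auto simp: sum_distrib_left mult.assoc)
qed

lemma hol_span_cmult:
  assumes "open V" "\<omega> \<in> hol_span X V K E"
  shows "(\<lambda>v w. a * \<omega> v w) \<in> hol_span X V K E"
  using hol_span_smult[OF holomorphic_fun_const[OF assms(1)] assms(2)] .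

lemma hol_span_diff:
  assumes "open V" "\<omega> \<in> hol_span X V K E" "\<eta> \<in> hol_span X V K E"
  shows "(\<lambda>v w. \<omega> v w - \<eta> v w) \<in> hol_span X V K E"
  using hol_span_add[OF assms(2) hol_span_cmult[OF assms(1,3), of "-1"]] by simp

lemma hol_span_sum:
  assumes "open V" "finite I" "\<And>i. i \<in> I \<Longrightarrow> \<omega> i \<in> hol_span X V K E"
  shows "(\<lambda>v w. \<Sum>i\<in>I. \<omega> i v w) \<in> hol_span X V K E"
  using assms(2,3)
proof (induction I rule: finite_induct)
  case empty
  show ?case
    by (rule hol_spanI[where u = "\<lambda>_ _. 0"]) (use assms(1) in \<open>auto intro: holomorphic_fun_const\<close>)
next
  case (insert i I)
  then show ?case using hol_span_add[of "\<omega> i" X V K E "\<lambda>v w. \<Sum>i\<in>I. \<omega> i v w"] by simp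
qed

lemma hol_span_trans:
  assumes "open V" "finite K" "\<omega> \<in> hol_span X V K E" "\<And>k. k \<in> K \<Longrightarrow> E k \<in> hol_span X V K' E'"
  shows "\<omega> \<in> hol_span X V K' E'"
proof -
  obtain u where u: "\<And>k. holomorphic_fun V (u k)"
    and eq: "\<And>v w. v \<in> X \<Longrightarrow> \<omega> v w = (\<Sum>k\<in>K. u k (cproj_class v) * E k v w)"
    using hol_spanD[OF assms(3)] by blast
  have "(\<lambda>v w. \<Sum>k\<in>K. u k (cproj_class v) * E k v w) \<in> hol_span X V K' E'"
    using assms by (intro hol_span_sum hol_span_smult u) auto
  then show ?thesis using eq by (rule hol_span_cong)
qed

lemma finite_N_columns [simp]: "finite (N_columns l :: ('n::finite option + nat) set)"
  by (simp add: N_columns_def)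

lemma sum_N_columns:
  "(\<Sum>c\<in>(N_columns l :: ('n::finite option + nat) set). a c) =
   (\<Sum>j\<in>UNIV. a (Inl j)) + (\<Sum>i\<in>{1..<l}. a (Inr i))"
  unfolding N_columns_def
  by (subst sum.union_disjoint) (auto simp: sum.reindex)

lemma restrict_eqI: "g \<in> extensional W \<Longrightarrow> (\<And>p. p \<in> W \<Longrightarrow> g p = h p) \<Longrightarrow> g = restrict h W"
  by (auto simp: fun_eq_iff extensional_def)

lemma inverse_holomorphic_fun:
  "holomorphic_fun V h \<Longrightarrow> (\<And>q. q \<in> V \<Longrightarrow> h q \<noteq> 0) \<Longrightarrow> holomorphic_fun V (\<lambda>q. inverse (h q))"
  using holomorphic_fun_divide[OF holomorphic_fun_const[OF holomorphic_fun_open], of V h h 1]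
  by (simp add: divide_inverse)

lemma eventually_eq_within:
  "(\<And>v. v \<in> S \<Longrightarrow> g v = h v) \<Longrightarrow> eventually (\<lambda>v. g v = h v) (at x within S)"
  by (auto simp: eventually_at_filter)

lemma sum_kronecker:
  "finite C \<Longrightarrow> c \<in> C \<Longrightarrow> (\<Sum>c'\<in>C. (if c' = c then 1 else 0) * X c') = (X c :: complex)"
  by (simp add: if_distrib[of "\<lambda>x. x * _"] cong: if_cong)

text \<open>In degree 0 only the constant monomial can occur, so the polynomial would be zero or a
  unit. This is what permits division by the degree of the last equation.\<close>

lemma homogeneous_irreducible_degree:
  fixes p :: "'a::finite mpoly"
  assumes "mp_homogeneous d p" "irreducible p"
  shows "d > 0"
proof (rule ccontr)
  assume "\<not> d > 0"
  have "Poly_Mapping.keys p \<subseteq> {0}"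
  proof
    fix m assume "m \<in> Poly_Mapping.keys p"
    then have "(\<Sum>j\<in>UNIV. Poly_Mapping.lookup m j) = 0"
      using assms(1) \<open>\<not> d > 0\<close> by (auto simp: mp_homogeneous_def)
    then have "Poly_Mapping.lookup m j = 0" for j by simp
    then show "m \<in> {0}" by (simp add: poly_mapping_eq_iff fun_eq_iff)
  qed
  then have "p = Poly_Mapping.single 0 (Poly_Mapping.lookup p 0)"
    by (intro poly_mapping_eqI) (auto simp: lookup_single when_def in_keys_iff subset_iff)
  moreover have "Poly_Mapping.lookup p 0 \<noteq> 0"
    using calculation assms(2) by (metis irreducible_def single_zero)
  ultimately have "1 = p * Poly_Mapping.single 0 (inverse (Poly_Mapping.lookup p 0))"
    by (metis add_0 mult_single right_inverse single_one)
  then have "p dvd 1" by (rule dvdI)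
  then show False using assms(2) by (simp add: irreducible_def)
qed

lemma differential_mult:
  assumes a: "holomorphic_fun V a" and b: "holomorphic_fun V b"
    and g: "\<And>q. q \<in> V \<Longrightarrow> g q = a q * b q" and v: "v \<in> cone V"
  shows "differential g v w = a (cproj_class v) * differential b v w + differential a v w * b (cproj_class v)"
proof -
  have V: "open (cone V)" using holomorphic_fun_open[OF a] open_cone by blast
  have "chas_derivative (\<lambda>v. a (cproj_class v) * b (cproj_class v))
     (\<lambda>w. a (cproj_class v) * differential b v w + differential a v w * b (cproj_class v)) v"
    using v by (intro chas_derivative_mult differential_chas_derivative[OF a] differential_chas_derivative[OF b])
  then have "chas_derivative (\<lambda>v. g (cproj_class v))
     (\<lambda>w. a (cproj_class v) * differential b v w + differential a v w * b (cproj_class v)) v"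
    by (rule chas_derivative_transform[OF _ V v]) (simp add: in_cone_iff g)
  from chas_derivative_imp_frechet[OF this] show ?thesis by (simp add: differential_def)
qed

section \<open>The hypersurfaces, their equations on the cone and the complement of the
  arrangement\<close>

locale hypersurface_arrangement =
  fixes D :: "nat \<Rightarrow> 'n::finite cproj set"
    and f :: "nat \<Rightarrow> 'n option mpoly"
    and d :: "nat \<Rightarrow> nat"
    and l :: nat
  assumes l: "l \<ge> 1"
    and smooth: "\<And>i. i \<in> {1..l} \<Longrightarrow> smooth_hypersurface (D i) (f i) (d i)"
    and crossings: "normal_crossings {1..l} D"
begin

definition U :: "'n cproj set" where "U = - (\<Union>i\<in>{1..l}. D i)"

definition ev :: "nat \<Rightarrow> complex ^ ('n option) \<Rightarrow> complex" where "ev i = mp_eval (f i)"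

definition dev :: "nat \<Rightarrow> complex ^ ('n option) \<Rightarrow> complex ^ ('n option) \<Rightarrow> complex" where
  "dev i v w = (\<Sum>j\<in>UNIV. mp_eval (mp_pderiv j (f i)) v * w $ j)"

lemma l_mem: "l \<in> {1..l}"
  using l by simp

lemma d_pos: "i \<in> {1..l} \<Longrightarrow> d i > 0"
  using smooth homogeneous_irreducible_degree unfolding smooth_hypersurface_def by blast

lemma d_nonzero: "of_nat (d l) \<noteq> (0 :: complex)"
  using d_pos[OF l_mem] by simp

lemma ev_derivative: "chas_derivative (ev i) (dev i v) v"
  unfolding ev_def using mp_eval_chas_derivative[of "f i" v]
  by (simp add: dev_def[abs_def])

lemma ev_scale: "i \<in> {1..l} \<Longrightarrow> ev i (c *s v) = c ^ d i * ev i v"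
  using smooth by (auto simp: ev_def smooth_hypersurface_def mp_eval_scale)

lemma ev_euler: "i \<in> {1..l} \<Longrightarrow> dev i v v = of_nat (d i) * ev i v"
  using homogeneous_euler[OF ev_derivative, of i v "int (d i)"] ev_scale by simp

text \<open>The gradient has degree \<open>d i - 1\<close>; the extra factor c on the left avoids
  the subtraction.\<close>

lemma dev_scale:
  assumes "i \<in> {1..l}"
  shows "c * dev i (c *s v) w = c ^ d i * dev i v w"
  by (rule homogeneous_derivative_scale[OF ev_derivative ev_derivative open_UNIV UNIV_I])
    (rule ev_scale[OF assms])

lemma in_D_iff:
  assumes "i \<in> {1..l}" "v \<noteq> 0"
  shows "cproj_class v \<in> D i \<longleftrightarrow> ev i v = 0"
proof
  assume "cproj_class v \<in> D i"
  then obtain w where w: "w \<noteq> 0" "cproj_class v = cproj_class w" "ev i w = 0"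
    using smooth[OF assms(1)] by (auto simp: smooth_hypersurface_def ev_def)
  then obtain c where "v = c *s w" using iffD1[OF cproj_class_eq_iff[OF w(1) assms(2)]] by metis
  then show "ev i v = 0" using w(3) ev_scale[OF assms(1)] by simp
next
  assume "ev i v = 0"
  then show "cproj_class v \<in> D i"
    using smooth[OF assms(1)] assms(2) by (auto simp: smooth_hypersurface_def ev_def)
qed

lemma in_cone_U: "v \<in> cone U \<longleftrightarrow> v \<noteq> 0 \<and> (\<forall>i\<in>{1..l}. ev i v \<noteq> 0)"
  using in_D_iff by (auto simp: U_def cone_def)

lemma ev_nonzero: "v \<in> cone U \<Longrightarrow> i \<in> {1..l} \<Longrightarrow> ev i v \<noteq> 0"
  using in_cone_U by blast

lemma ev_cholomorphic: "open S \<Longrightarrow> cholomorphic_on (ev i) S"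
  unfolding ev_def by (rule mp_eval_cholomorphic)

lemma open_U: "open U"
proof -
  have "cone U = (\<Inter>i\<in>{1..l}. {v. ev i v \<noteq> 0}) \<inter> {v. v \<noteq> 0}" by (auto simp: in_cone_U)
  moreover have "open {v. ev i v \<noteq> 0}" for i
    by (intro open_Collect_neq cholomorphic_on_continuous[OF ev_cholomorphic] continuous_on_const open_UNIV)
  moreover have "open {v :: complex ^ ('n option). v \<noteq> 0}" by (intro open_Collect_neq continuous_intros)
  ultimately show ?thesis by (auto simp: open_cone intro!: open_Int open_INT)
qed

section \<open>Dehomogenised equations, their logarithmic differentials and adapted
  coordinates\<close>

text \<open>This is \<open>d log (f_i / x_m ^ d_i)\<close>, the logarithmic differential of a
  function on the chart, in contrast to \<open>d log f_i\<close>, which lives on the cone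
  only.\<close>

definition logform :: "nat \<Rightarrow> 'n option \<Rightarrow> complex ^ ('n option) \<Rightarrow> complex ^ ('n option) \<Rightarrow> complex" where
  "logform i m v w = dev i v w / ev i v - of_nat (d i) * w $ m / v $ m"

definition equation :: "nat \<Rightarrow> 'n option \<Rightarrow> 'n cproj \<Rightarrow> complex" where
  "equation i m q = ev i (rep_cproj q) / (rep_cproj q $ m) ^ d i"

lemma equation_class:
  assumes "i \<in> {1..l}" "v \<noteq> 0"
  shows "equation i m (cproj_class v) = ev i v / (v $ m) ^ d i"
proof -
  obtain c where "c \<noteq> 0" "rep_cproj (cproj_class v) = c *s v" using rep_cproj_class[OF assms(2)] .
  then show ?thesis using ev_scale[OF assms(1)] by (simp add: equation_def power_mult_distrib)
qed

lemma equation_holomorphic: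
  assumes "i \<in> {1..l}" "open V" "V \<subseteq> chart m"
  shows "holomorphic_fun V (equation i m)"
proof -
  have "cholomorphic_on (\<lambda>v. ev i v / (v $ m) ^ d i) (cone V)"
    using assms cone_subset_chart[OF assms(3)]
    by (intro cholomorphic_on_divide cholomorphic_on_power cholomorphic_on_nth ev_cholomorphic)
      (auto simp: open_cone)
  then show ?thesis unfolding holomorphic_fun_def
    by (rule cholomorphic_on_cong) (simp add: equation_class[OF assms(1)] cone_nonzero)
qed

lemma equation_eq_0_iff:
  "i \<in> {1..l} \<Longrightarrow> q \<in> chart m \<Longrightarrow> equation i m q = 0 \<longleftrightarrow> q \<in> D i"
  using in_D_iff[of i "rep_cproj q"] by (simp add: equation_def chart_def)

lemma differential_equation:
  assumes "i \<in> {1..l}" "v $ m \<noteq> 0"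
  shows "differential (equation i m) v w =
    dev i v w / (v $ m) ^ d i - of_nat (d i) * ev i v * w $ m / (v $ m) ^ (d i + 1)"
proof -
  have v: "v \<in> cone (chart m)" using assms by (simp add: cone_chart)
  have "chas_derivative (\<lambda>v. ev i v / (v $ m) ^ d i) (\<lambda>w. dev i v w / (v $ m) ^ d i -
       ev i v * (of_nat (d i) * w $ m * (v $ m) ^ (d i - 1)) / ((v $ m) ^ d i)\<^sup>2) v"
    using assms by (intro chas_derivative_divide chas_derivative_power chas_derivative_nth ev_derivative) auto
  then have "chas_derivative (\<lambda>v. equation i m (cproj_class v)) (\<lambda>w. dev i v w / (v $ m) ^ d i -
       ev i v * (of_nat (d i) * w $ m * (v $ m) ^ (d i - 1)) / ((v $ m) ^ d i)\<^sup>2) v"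
    by (rule chas_derivative_transform[of _ _ _ "cone (chart m)"])
      (use v in \<open>auto simp: open_chart equation_class[OF assms(1)] cone_nonzero simp flip: open_cone\<close>)
  from chas_derivative_imp_frechet[OF this]
  have "differential (equation i m) v w = dev i v w / (v $ m) ^ d i -
       ev i v * (of_nat (d i) * w $ m * (v $ m) ^ (d i - 1)) / ((v $ m) ^ d i)\<^sup>2"
    by (simp add: differential_def)
  also have "ev i v * (of_nat (d i) * w $ m * (v $ m) ^ (d i - 1)) / ((v $ m) ^ d i)\<^sup>2 =
      of_nat (d i) * ev i v * w $ m * ((v $ m) ^ (d i - 1) / ((v $ m) ^ d i)\<^sup>2)"
    by simp
  \<comment> \<open>With truncated subtraction this would fail for d i = 0; positivity of the degree
    is essential.\<close>
  also have "(v $ m) ^ (d i - 1) / ((v $ m) ^ d i)\<^sup>2 = 1 / (v $ m) ^ (d i + 1)"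
    using d_pos[OF assms(1)] assms(2)
    by (cases "d i") (simp_all add: power2_eq_square field_simps)
  finally show ?thesis by simp
qed

lemma logform_equation:
  assumes "i \<in> {1..l}" "v $ m \<noteq> 0" "ev i v \<noteq> 0" 
  shows "logform i m v w = differential (equation i m) v w / equation i m (cproj_class v)"
proof -
  have "v \<noteq> 0" using assms(2) by auto
  then show ?thesis using assms
    by (simp add: logform_def differential_equation equation_class field_simps)
qed

definition through :: "'n cproj \<Rightarrow> nat set" where "through p = {i\<in>{1..l}. p \<in> D i}"

abbreviation adapted where "adapted \<equiv> adapted_coordinates {1..l} D"

lemma adapted_coordinatesD:
  assumes "adapted p V z \<sigma>"
  shows "local_coordinates V z" "open V" "p \<in> V" "z p = 0" "inj_on \<sigma> (through p)"
    and "\<And>i q. i \<in> through p \<Longrightarrow> q \<in> V \<Longrightarrow> q \<in> D i \<longleftrightarrow> z q $ \<sigma> i = 0"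
    and "\<And>i q. i \<in> {1..l} \<Longrightarrow> i \<notin> through p \<Longrightarrow> q \<in> V \<Longrightarrow> q \<notin> D i"
proof -
  have *: "local_coordinates V z" "p \<in> V" "z p = 0" "inj_on \<sigma> (through p)"
    and D: "\<forall>i\<in>{1..l}. D i \<inter> V = (if p \<in> D i then {q\<in>V. z q $ \<sigma> i = 0} else {})"
    using assms unfolding adapted_coordinates_def through_def by blast+
  show "local_coordinates V z" "open V" "p \<in> V" "z p = 0" "inj_on \<sigma> (through p)"
    using * local_coordinates_open by blast+
  show "q \<in> D i \<longleftrightarrow> z q $ \<sigma> i = 0" if "i \<in> through p" "q \<in> V" for i q
  proof -
    have "D i \<inter> V = {q\<in>V. z q $ \<sigma> i = 0}" using D that(1) by (simp add: through_def)
    then show ?thesis using that(2) by blast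
  qed
  show "q \<notin> D i" if "i \<in> {1..l}" "i \<notin> through p" "q \<in> V" for i q
  proof -
    have "D i \<inter> V = {}" using D that(1,2) by (simp add: through_def)
    then show ?thesis using that(3) by blast
  qed
qed

lemma adapted_subset:
  assumes ad: "adapted p V z \<sigma>" and V': "open V'" "V' \<subseteq> V" "p \<in> V'"
  shows "adapted p V' z \<sigma>"
  unfolding adapted_coordinates_def
proof (intro conjI ballI)
  note adD = adapted_coordinatesD[OF ad]
  show "local_coordinates V' z" using local_coordinates_subset[OF adD(1) V'(1,2)] .
  show "p \<in> V'" "z p = 0" using V' adD by blast+
  show "inj_on \<sigma> {i \<in> {1..l}. p \<in> D i}" using adD(5) by (simp add: through_def)
  show "D i \<inter> V' = (if p \<in> D i then {q\<in>V'. z q $ \<sigma> i = 0} else {})" if i: "i \<in> {1..l}" for i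
  proof (cases "p \<in> D i")
    case True
    then show ?thesis using adD(6)[of i] V'(2) i by (auto simp: through_def)
  next
    case False
    then show ?thesis using adD(7)[of i] V'(2) i by (auto simp: through_def)
  qed
qed

lemma adapted_exists: "\<exists>V z \<sigma>. adapted p V z \<sigma>"
  using crossings unfolding normal_crossings_def by blast

text \<open>The quotient is a unit because both sides vanish to first order: the left one by the
  Jacobian criterion, the right one because \<open>z\<close> are coordinates.\<close>

lemma equation_unit:
  assumes ad: "adapted p V z \<sigma>" and m: "V \<subseteq> chart m" and i: "i \<in> through p"
  obtains h where "holomorphic_fun V h" "\<And>q. q \<in> V \<Longrightarrow> h q \<noteq> 0"
    "\<And>q. q \<in> V \<Longrightarrow> equation i m q = z q $ \<sigma> i * h q"
proof -
  note adD = adapted_coordinatesD[OF ad]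
  have il: "i \<in> {1..l}" using i by (simp add: through_def)
  have eq0: "equation i m q = 0 \<longleftrightarrow> z q $ \<sigma> i = 0" if "q \<in> V" for q
    using equation_eq_0_iff[OF il, of q m] adD(6)[OF i that] m that by blast
  have hol: "holomorphic_fun V (equation i m)" using equation_holomorphic[OF il adD(2) m] .
  \<comment> \<open>In the coordinates the equation vanishes wherever coordinate
    \<open>\<sigma> i\<close> does, so it is divisible by that coordinate.\<close>
  obtain k where k: "cholomorphic_on k (z ` V)"
    "\<And>y. y \<in> z ` V \<Longrightarrow> equation i m (inv_into V z y) = y $ \<sigma> i * k y"
  proof (rule cholomorphic_division[OF coordinates_pullback[OF adD(1) hol]])
    show "equation i m (inv_into V z y) = 0" if "y \<in> z ` V" "y $ \<sigma> i = 0" for y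
      using that eq0[of "inv_into V z y"] by (simp add: inv_into_into f_inv_into_f)
  qed blast
  define h where "h = (\<lambda>q. k (z q))"
  have h: "holomorphic_fun V h" unfolding h_def using adD(1) k(1) by (rule coordinates_holomorphic_fun)
  have eq: "equation i m q = z q $ \<sigma> i * h q" if "q \<in> V" for q
    using k(2)[of "z q"] that local_coordinates_inj[OF adD(1)] by (simp add: h_def)
  moreover have "h q \<noteq> 0" if q: "q \<in> V" for q
  proof (cases "z q $ \<sigma> i = 0")
    case False
    then show ?thesis using eq[OF q] eq0[OF q] by auto
  next
    case True
    define v where "v = rep_cproj q"
    have v: "v \<noteq> 0" "cproj_class v = q" "v \<in> cone V" "v $ m \<noteq> 0"
      using q m by (auto simp: v_def rep_in_cone chart_def)
    have ev0: "ev i v = 0" using True eq0[OF q] equation_class[OF il v(1)] v by simp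
    obtain j where j: "mp_eval (mp_pderiv j (f i)) v \<noteq> 0"
      using smooth[OF il] v(1) ev0 by (auto simp: smooth_hypersurface_def ev_def)
    have "dev i v (axis j 1) = mp_eval (mp_pderiv j (f i)) v"
      by (simp add: dev_def axis_def if_distrib cong: if_cong)
    then have "differential (equation i m) v (axis j 1) \<noteq> 0"
      using j v ev0 by (simp add: differential_equation[OF il])
    \<comment> \<open>At a zero of the coordinate the product rule loses its term in dh, so a zero
      of h would contradict the preceding inequality.\<close>
    moreover have "differential (equation i m) v (axis j 1) =
        differential (\<lambda>q. z q $ \<sigma> i) v (axis j 1) * h q"
      using differential_mult[OF coordinate_holomorphic[OF adD(1)] h eq v(3)] True v(2) by simp
    ultimately show ?thesis by auto
  qed
  ultimately show thesis using that h by blast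
qed

lemma equation_nonzero:
  assumes "adapted p V z \<sigma>" "V \<subseteq> chart m" "i \<in> {1..l}" "i \<notin> through p" "q \<in> V"
  shows "equation i m q \<noteq> 0"
proof -
  have "q \<in> chart m" using assms(2,5) by blast
  from equation_eq_0_iff[OF assms(3) this] adapted_coordinatesD(7)[OF assms(1,3,4,5)]
  show ?thesis by simp
qed


section \<open>Generators of the logarithmic forms on a chart, compared with adapted
  coordinates\<close>

abbreviation cols :: "('n option + nat) set" where "cols \<equiv> N_columns l"

text \<open>The quotients \<open>dev i v w / ev i v\<close> are the values of
  \<open>d log f_i\<close>. Division by \<open>v $ m\<close> makes the first kind invariant when v
  and w are scaled together, as the second kind already is. The index is a column of N because the
  values of a functional on these forms will be the entries of a column vector.\<close>

definition frame ::
    "'n option \<Rightarrow> 'n option + nat \<Rightarrow> complex ^ ('n option) \<Rightarrow> complex ^ ('n option) \<Rightarrow> complex" where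
  "frame m c v w = (case c of
     Inl j \<Rightarrow> (w $ j - v $ j / of_nat (d l) * (dev l v w / ev l v)) / v $ m
   | Inr i \<Rightarrow> dev i v w / ev i v - of_nat (d i) / of_nat (d l) * (dev l v w / ev l v))"

abbreviation frame_span where
  "frame_span m V \<equiv> hol_span (cone (V \<inter> U)) V cols (frame m)"

text \<open>Expanding dg in the \<open>dx_j\<close> and replacing these by the corrected forms
  changes the sum by a multiple of \<open>differential g v v\<close>, which is zero by Euler's
  relation in degree 0.\<close>

lemma differential_in_frame:
  assumes g: "holomorphic_fun V g" and m: "V \<subseteq> chart m"
  shows "differential g \<in> frame_span m V"
proof (rule hol_spanI[where u = "\<lambda>c q. case c of
      Inl j \<Rightarrow> rep_cproj q $ m * differential g (rep_cproj q) (axis j 1) | Inr i \<Rightarrow> 0"])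
  show "holomorphic_fun V (\<lambda>q. case c of
      Inl j \<Rightarrow> rep_cproj q $ m * differential g (rep_cproj q) (axis j 1) | Inr i \<Rightarrow> 0)" for c :: "'n option + nat"
    using differential_partial(1)[OF g m] holomorphic_fun_const[OF holomorphic_fun_open[OF g]]
    by (cases c) auto
  fix v w :: "complex ^ ('n option)" assume v: "v \<in> cone (V \<inter> U)"
  then have v': "v \<in> cone V" by (simp add: cone_Int)
  have vm: "v $ m \<noteq> 0" using cone_subset_chart[OF m v'] .
  define r where "r = dev l v w / ev l v / of_nat (d l)"
  have dg: "chas_derivative (\<lambda>v. g (cproj_class v)) (differential g v) v"
    using differential_chas_derivative[OF g v'] .
  have "(\<Sum>j\<in>UNIV. v $ m * differential g v (axis j 1) * frame m (Inl j) v w) =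
      (\<Sum>j\<in>UNIV. w $ j * differential g v (axis j 1) - r * (v $ j * differential g v (axis j 1)))"
    using vm by (intro sum.cong) (simp_all add: frame_def r_def field_simps)
  also have "\<dots> = differential g v w - r * differential g v v"
    unfolding sum_subtractf chas_derivative_expand[OF dg, of w] chas_derivative_expand[OF dg, of v]
    by (simp add: sum_distrib_left)
  also have "\<dots> = differential g v w" using differential_euler[OF g v'] by simp
  finally show "differential g v w = (\<Sum>c\<in>cols. (case c of
      Inl j \<Rightarrow> rep_cproj (cproj_class v) $ m * differential g (rep_cproj (cproj_class v)) (axis j 1)
      | Inr i \<Rightarrow> 0) * frame m c v w)"
    using differential_partial(2)[OF g m v'] by (simp add: sum_N_columns)
qed

text \<open>In \<open>frame m (Inr i) - d_i * frame m (Inl m)\<close> the terms in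
  \<open>d log f_l\<close> cancel, and \<open>d log f_i - d_i dx_m / x_m\<close> remains.\<close>

lemma logform_in_frame:
  assumes "i \<in> {1..l}" "open V" "V \<subseteq> chart m"
  shows "logform i m \<in> frame_span m V"
proof -
  \<comment> \<open>There is no column \<open>Inr l\<close>, but the form that the formula gives for
    i = l is zero off the divisors.\<close>
  have 1: "frame m (Inr i) \<in> frame_span m V"
  proof (cases "i = l")
    case True
    show ?thesis
      by (rule hol_spanI[where u = "\<lambda>_ _. 0"])
        (use True d_nonzero assms(2) in \<open>auto intro: holomorphic_fun_const simp: frame_def\<close>)
  next
    case False
    then show ?thesis using assms by (intro hol_span_base) (auto simp: N_columns_def)
  qed
  have 2: "frame m (Inl m) \<in> frame_span m V"
    using assms by (intro hol_span_base) (auto simp: N_columns_def)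
  have "(\<lambda>v w. frame m (Inr i) v w - of_nat (d i) * frame m (Inl m) v w)
      \<in> frame_span m V"
    by (intro hol_span_diff hol_span_cmult 1 2 assms)
  then show ?thesis
  proof (rule hol_span_cong)
    fix v w :: "complex ^ ('n option)" assume "v \<in> cone (V \<inter> U)"
    then have "v $ m \<noteq> 0" using cone_subset_chart[OF assms(3)] by (simp add: cone_Int)
    then show "logform i m v w = frame m (Inr i) v w - of_nat (d i) * frame m (Inl m) v w"
      using d_nonzero by (simp add: frame_def logform_def field_simps)
  qed
qed

text \<open>The forms \<open>dz_k / z_k\<close> and \<open>dz_k\<close> of the definition of the
  logarithmic bundle as one family: the denominator 1 belongs to coordinates that are not equations
  of divisors through p. The two sums of that definition thereby become a single span.\<close>

definition log_coordinate_form ::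
    "'n cproj \<Rightarrow> ('n cproj \<Rightarrow> complex ^ 'n) \<Rightarrow> (nat \<Rightarrow> 'n) \<Rightarrow> 'n \<Rightarrow>
     complex ^ ('n option) \<Rightarrow> complex ^ ('n option) \<Rightarrow> complex" where
  "log_coordinate_form p z \<sigma> k v w =
     differential (\<lambda>q. z q $ k) v w / (if k \<in> \<sigma> ` through p then z (cproj_class v) $ k else 1)"

abbreviation coordinate_span where
  "coordinate_span p z \<sigma> V \<equiv> hol_span (cone (V \<inter> U)) V UNIV (log_coordinate_form p z \<sigma>)"

text \<open>By \<open>equation_unit\<close> the dehomogenised equation is the coordinate times a
  unit h, and d log turns the product into \<open>dz / z + dh / h\<close>.\<close>

lemma logform_unit:
  assumes ad: "adapted p V z \<sigma>" and m: "V \<subseteq> chart m" and i: "i \<in> through p"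
  obtains h where "holomorphic_fun V h" "\<And>q. q \<in> V \<Longrightarrow> h q \<noteq> 0"
    "\<And>v w. v \<in> cone (V \<inter> U) \<Longrightarrow> logform i m v w =
       log_coordinate_form p z \<sigma> (\<sigma> i) v w + inverse (h (cproj_class v)) * differential h v w"
proof -
  note adD = adapted_coordinatesD[OF ad]
  obtain h where h: "holomorphic_fun V h" "\<And>q. q \<in> V \<Longrightarrow> h q \<noteq> 0"
    "\<And>q. q \<in> V \<Longrightarrow> equation i m q = z q $ \<sigma> i * h q"
    using equation_unit[OF assms] by blast
  have il: "i \<in> {1..l}" using i by (simp add: through_def)
  have "logform i m v w =
       log_coordinate_form p z \<sigma> (\<sigma> i) v w + inverse (h (cproj_class v)) * differential h v w"
    if v: "v \<in> cone (V \<inter> U)" for v w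
  proof -
    have v': "v \<in> cone V" "v \<in> cone U" "cproj_class v \<in> V" using v by (auto simp: cone_Int in_cone_iff)
    have vm: "v $ m \<noteq> 0" using cone_subset_chart[OF m v'(1)] .
    have "cproj_class v \<notin> D i" using v'(2) il by (auto simp: in_cone_iff U_def)
    then have z0: "z (cproj_class v) $ \<sigma> i \<noteq> 0" using adD(6)[OF i v'(3)] by blast
    have "logform i m v w = differential (equation i m) v w / equation i m (cproj_class v)"
      using il vm ev_nonzero[OF v'(2) il] by (rule logform_equation)
    also have "\<dots> = (z (cproj_class v) $ \<sigma> i * differential h v w +
        differential (\<lambda>q. z q $ \<sigma> i) v w * h (cproj_class v)) / (z (cproj_class v) $ \<sigma> i * h (cproj_class v))"
      using differential_mult[OF coordinate_holomorphic[OF adD(1)] h(1) h(3) v'(1)] h(3)[OF v'(3)] by simp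
    also have "\<dots> = log_coordinate_form p z \<sigma> (\<sigma> i) v w + inverse (h (cproj_class v)) * differential h v w"
      using z0 h(2)[OF v'(3)] i by (simp add: log_coordinate_form_def field_simps)
    finally show ?thesis .
  qed
  then show thesis using that h by blast
qed

text \<open>For a coordinate that cuts out a divisor \<open>logform_unit\<close> is solved for
  \<open>dz / z\<close>; any other coordinate contributes the differential of a holomorphic
  function.\<close>

lemma log_coordinate_form_in_frame:
  assumes ad: "adapted p V z \<sigma>" and m: "V \<subseteq> chart m"
  shows "log_coordinate_form p z \<sigma> k \<in> frame_span m V"
proof -
  note adD = adapted_coordinatesD[OF ad]
  show ?thesis
  proof (cases "k \<in> \<sigma> ` through p")
    case True
    then obtain i where i: "i \<in> through p" "k = \<sigma> i" by blast
    then have il: "i \<in> {1..l}" by (simp add: through_def)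
    obtain h where h: "holomorphic_fun V h" "\<And>q. q \<in> V \<Longrightarrow> h q \<noteq> 0"
      "\<And>v w. v \<in> cone (V \<inter> U) \<Longrightarrow> logform i m v w =
       log_coordinate_form p z \<sigma> (\<sigma> i) v w + inverse (h (cproj_class v)) * differential h v w"
      using logform_unit[OF ad m i(1)] by blast
    have "(\<lambda>v w. logform i m v w - inverse (h (cproj_class v)) * differential h v w)
        \<in> frame_span m V"
      by (rule hol_span_diff[OF adD(2) logform_in_frame[OF il adD(2) m]
          hol_span_smult[OF inverse_holomorphic_fun[OF h(1,2)] differential_in_frame[OF h(1) m]]])
    then show ?thesis by (rule hol_span_cong) (simp add: h(3) i(2))
  next
    case False
    show ?thesis
      by (rule hol_span_cong[OF differential_in_frame[OF coordinate_holomorphic[OF adD(1), of k] m]])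
        (simp add: log_coordinate_form_def False)
  qed
qed

text \<open>Where \<open>dz_k\<close> is replaced by \<open>dz_k / z_k\<close>, the factor
  \<open>z_k\<close> moves into the coefficient; it does not vanish off the divisors.\<close>

lemma differential_in_log_coordinates:
  assumes ad: "adapted p V z \<sigma>" and g: "holomorphic_fun V g"
  shows "differential g \<in> coordinate_span p z \<sigma> V"
proof -
  note adD = adapted_coordinatesD[OF ad]
  obtain u where u: "\<And>k. holomorphic_fun V (u k)"
    "\<And>v w. v \<in> cone V \<Longrightarrow>
       differential g v w = (\<Sum>k\<in>UNIV. u k (cproj_class v) * differential (\<lambda>q. z q $ k) v w)"
    using differential_in_coordinates[OF adD(1) g] by blast
  show ?thesis
  proof (rule hol_spanI[where u = "\<lambda>k q. u k q * (if k \<in> \<sigma> ` through p then z q $ k else 1)"])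
    show "holomorphic_fun V (\<lambda>q. u k q * (if k \<in> \<sigma> ` through p then z q $ k else 1))" for k
      using holomorphic_fun_mult[OF u(1) coordinate_holomorphic[OF adD(1)], of k k] u(1)[of k]
      by (cases "k \<in> \<sigma> ` through p") simp_all
    fix v w :: "complex ^ ('n option)" assume "v \<in> cone (V \<inter> U)"
    then have v: "v \<in> cone V" "v \<in> cone U" "cproj_class v \<in> V" by (auto simp: cone_Int in_cone_iff)
    have "z (cproj_class v) $ k \<noteq> 0" if k: "k \<in> \<sigma> ` through p" for k
    proof -
      obtain i where i: "i \<in> through p" "k = \<sigma> i" using k by blast
      then have "cproj_class v \<notin> D i" using v(2) by (auto simp: in_cone_iff U_def through_def)
      then show ?thesis using adD(6)[OF i(1) v(3)] i(2) by blast
    qed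
    then show "differential g v w = (\<Sum>k\<in>UNIV. u k (cproj_class v) *
        (if k \<in> \<sigma> ` through p then z (cproj_class v) $ k else 1) * log_coordinate_form p z \<sigma> k v w)"
      unfolding u(2)[OF v(1)] by (intro sum.cong) (auto simp: log_coordinate_form_def)
  qed
qed

lemma logform_in_log_coordinates:
  assumes ad: "adapted p V z \<sigma>" and m: "V \<subseteq> chart m" and i: "i \<in> {1..l}"
  shows "logform i m \<in> coordinate_span p z \<sigma> V"
proof -
  note adD = adapted_coordinatesD[OF ad]
  show ?thesis
  proof (cases "i \<in> through p")
    case True
    obtain h where h: "holomorphic_fun V h" "\<And>q. q \<in> V \<Longrightarrow> h q \<noteq> 0"
      "\<And>v w. v \<in> cone (V \<inter> U) \<Longrightarrow> logform i m v w =
       log_coordinate_form p z \<sigma> (\<sigma> i) v w + inverse (h (cproj_class v)) * differential h v w"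
      using logform_unit[OF ad m True] by blast
    have "(\<lambda>v w. log_coordinate_form p z \<sigma> (\<sigma> i) v w + inverse (h (cproj_class v)) * differential h v w)
        \<in> coordinate_span p z \<sigma> V"
      by (rule hol_span_add[OF hol_span_base[OF adD(2) finite UNIV_I]
            hol_span_smult[OF inverse_holomorphic_fun[OF h(1,2)] differential_in_log_coordinates[OF ad h(1)]]])
    then show ?thesis by (rule hol_span_cong) (rule h(3))
  next
    case False
    \<comment> \<open>The divisor does not meet V, so its equation is a unit and the logarithmic
      differential has no pole.\<close>
    have eq: "holomorphic_fun V (equation i m)" using equation_holomorphic[OF i adD(2) m] .
    have "(\<lambda>v w. inverse (equation i m (cproj_class v)) * differential (equation i m) v w)
        \<in> coordinate_span p z \<sigma> V"
      by (rule hol_span_smult[OF inverse_holomorphic_fun[OF eq equation_nonzero[OF ad m i False]]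
            differential_in_log_coordinates[OF ad eq]])
    then show ?thesis
    proof (rule hol_span_cong)
      fix v w :: "complex ^ ('n option)" assume "v \<in> cone (V \<inter> U)"
      then have v: "v \<in> cone V" "v \<in> cone U" by (auto simp: cone_Int)
      show "logform i m v w = inverse (equation i m (cproj_class v)) * differential (equation i m) v w"
        unfolding logform_equation[OF i cone_subset_chart[OF m v(1)] ev_nonzero[OF v(2) i]]
        by (simp add: divide_inverse mult.commute)
    qed
  qed
qed

lemma differential_ratio:
  assumes "v $ m \<noteq> 0"
  shows "differential (\<lambda>q. rep_cproj q $ j / rep_cproj q $ m) v w = w $ j / v $ m - v $ j * w $ m / (v $ m)\<^sup>2"
proof -
  have v: "v \<in> cone (chart m)" using assms by (simp add: cone_chart)
  have "chas_derivative (\<lambda>v. v $ j / v $ m) (\<lambda>w. w $ j / v $ m - v $ j * w $ m / (v $ m)\<^sup>2) v"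
    by (rule chas_derivative_divide[OF chas_derivative_nth chas_derivative_nth assms])
  then have "chas_derivative (\<lambda>v. rep_cproj (cproj_class v) $ j / rep_cproj (cproj_class v) $ m)
      (\<lambda>w. w $ j / v $ m - v $ j * w $ m / (v $ m)\<^sup>2) v"
    by (rule chas_derivative_transform[OF _ iffD1[OF open_cone open_chart] v])
      (simp add: ratio_class cone_nonzero)
  from chas_derivative_imp_frechet[OF this] show ?thesis by (simp add: differential_def)
qed

text \<open>The converse comparison. \<open>Inl j\<close> is \<open>d (x_j / x_m)\<close> minus
  \<open>x_j / (d_l x_m)\<close> times \<open>logform l\<close>; \<open>Inr i\<close> is
  \<open>logform i\<close> minus \<open>d_i / d_l\<close> times \<open>logform l\<close>, where the
  terms in \<open>dx_m / x_m\<close> cancel.\<close>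

lemma frame_in_log_coordinates:
  assumes ad: "adapted p V z \<sigma>" and m: "V \<subseteq> chart m" and c: "c \<in> cols"
  shows "frame m c \<in> coordinate_span p z \<sigma> V"
proof -
  note V = adapted_coordinatesD(2)[OF ad]
  note lf = logform_in_log_coordinates[OF ad m]
  show ?thesis
  proof (cases c)
    case (Inl j)
    let ?X = "\<lambda>q. rep_cproj q $ j / rep_cproj q $ m"
    have X: "holomorphic_fun V ?X" using holomorphic_fun_ratio[OF V m] .
    have "(\<lambda>v w. differential ?X v w - ?X (cproj_class v) * (1 / of_nat (d l) * logform l m v w))
       \<in> coordinate_span p z \<sigma> V"
      by (rule hol_span_diff[OF V differential_in_log_coordinates[OF ad X]
            hol_span_smult[OF X hol_span_cmult[OF V lf[OF l_mem]]]])
    then show ?thesis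
    proof (rule hol_span_cong)
      fix v w :: "complex ^ ('n option)" assume "v \<in> cone (V \<inter> U)"
      then have v: "v \<noteq> 0" "v $ m \<noteq> 0"
        using cone_subset_chart[OF m] by (auto simp: cone_Int dest: cone_nonzero)
      show "frame m c v w = differential ?X v w - ?X (cproj_class v) * (1 / of_nat (d l) * logform l m v w)"
        unfolding differential_ratio[OF v(2)] ratio_class[OF v(1)] logform_def
        using v d_nonzero by (simp add: Inl frame_def field_simps power2_eq_square)
    qed
  next
    case (Inr i)
    then have i: "i \<in> {1..l}" using c by (auto simp: N_columns_def)
    have "(\<lambda>v w. logform i m v w - of_nat (d i) / of_nat (d l) * logform l m v w)
       \<in> coordinate_span p z \<sigma> V"
      by (rule hol_span_diff[OF V lf[OF i] hol_span_cmult[OF V lf[OF l_mem]]])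
    then show ?thesis
      by (rule hol_span_cong) (use d_nonzero in \<open>simp add: Inr frame_def logform_def field_simps\<close>)
  qed
qed

section \<open>Sections of the logarithmic bundle in terms of the generators\<close>

definition \<Omega> where "\<Omega> = log_bundle {1..l} D"

abbreviation log_forms where "log_forms W \<equiv> carrier (Sec \<Omega> W)"

lemma log_sum_split:
  "(\<Sum>k\<in>\<sigma> ` {i\<in>{1..l}. p \<in> D i}.
      u k (cproj_class v) * (differential (\<lambda>q. z q $ k) v w / z (cproj_class v) $ k)) +
   (\<Sum>k\<in>- \<sigma> ` {i\<in>{1..l}. p \<in> D i}. u k (cproj_class v) * differential (\<lambda>q. z q $ k) v w) =
   (\<Sum>k\<in>UNIV. u k (cproj_class v) * log_coordinate_form p z \<sigma> k v w)"
proof -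
  have "(\<Sum>k\<in>UNIV. u k (cproj_class v) * log_coordinate_form p z \<sigma> k v w) =
      (\<Sum>k\<in>\<sigma> ` through p \<union> - \<sigma> ` through p. u k (cproj_class v) * log_coordinate_form p z \<sigma> k v w)"
    by simp
  also have "\<dots> = (\<Sum>k\<in>\<sigma> ` through p. u k (cproj_class v) * log_coordinate_form p z \<sigma> k v w) +
      (\<Sum>k\<in>- \<sigma> ` through p. u k (cproj_class v) * log_coordinate_form p z \<sigma> k v w)"
    by (intro sum.union_disjoint) auto
  finally show ?thesis
    by (simp add: log_coordinate_form_def through_def cong: sum.cong_simp)
qed

lemma log_bundle_carrier:
  "\<omega> \<in> log_forms W \<longleftrightarrow> \<omega> \<in> one_forms (W \<inter> U) \<and>
    (\<forall>p\<in>W. \<exists>V z \<sigma>. V \<subseteq> W \<and> adapted p V z \<sigma> \<and>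
       \<omega> \<in> coordinate_span p z \<sigma> V)"
  unfolding \<Omega>_def log_bundle_def Let_def hol_span_def U_def[symmetric] omodule_sheaf.simps
    partial_object.simps mem_Collect_eq log_sum_split by blast

lemma log_bundle_local_frame:
  assumes \<omega>: "\<omega> \<in> log_forms W" and p: "p \<in> W" "p \<in> chart m"
  obtains V where "open V" "p \<in> V" "V \<subseteq> W" "V \<subseteq> chart m"
    "\<omega> \<in> frame_span m V"
proof -
  obtain V z \<sigma> where V: "V \<subseteq> W" "adapted p V z \<sigma>"
    and span: "\<omega> \<in> coordinate_span p z \<sigma> V"
    using \<omega> p(1) unfolding log_bundle_carrier by blast
  note adD = adapted_coordinatesD[OF V(2)]
  let ?V = "V \<inter> chart m"
  have V': "open ?V" "?V \<subseteq> V" "p \<in> ?V"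
    using open_Int[OF adD(2) open_chart] adD(3) p(2) by auto
  have ad: "adapted p ?V z \<sigma>" using adapted_subset[OF V(2) V'] .
  have "\<omega> \<in> coordinate_span p z \<sigma> ?V"
    by (rule hol_span_subset[OF span V'(1,2)]) (auto simp: cone_Int)
  then have "\<omega> \<in> frame_span m ?V"
    by (rule hol_span_trans[OF V'(1) finite]) (rule log_coordinate_form_in_frame[OF ad Int_lower2])
  then show thesis using that[of ?V] V' V(1) by blast
qed

lemma log_bundleI:
  assumes W: "open W" and ext: "\<omega> \<in> extensional (cone (W \<inter> U))"
    and loc: "\<And>p. p \<in> W \<Longrightarrow> \<exists>V m. open V \<and> p \<in> V \<and> V \<subseteq> chart m \<and>
      \<omega> \<in> frame_span m (V \<inter> W)"
  shows "\<omega> \<in> log_forms W"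
proof -
  have loc': "\<exists>V z \<sigma>. V \<subseteq> W \<and> adapted p V z \<sigma> \<and>
       \<omega> \<in> coordinate_span p z \<sigma> V" if p: "p \<in> W" for p
  proof -
    obtain V m where V: "open V" "p \<in> V" "V \<subseteq> chart m"
      and span: "\<omega> \<in> frame_span m (V \<inter> W)"
      using loc[OF p] by blast
    obtain V1 z \<sigma> where ad1: "adapted p V1 z \<sigma>" using adapted_exists by blast
    let ?V = "V1 \<inter> V \<inter> W"
    have V': "open ?V" "?V \<subseteq> V1" "p \<in> ?V" 
      using adapted_coordinatesD(2,3)[OF ad1] V W p by auto
    have ad: "adapted p ?V z \<sigma>" using adapted_subset[OF ad1 V'] .
    have m: "?V \<subseteq> chart m" using V(3) by blast
    have "\<omega> \<in> frame_span m ?V"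
      by (rule hol_span_subset[OF span V'(1)]) (auto simp: cone_Int)
    then have "\<omega> \<in> coordinate_span p z \<sigma> ?V"
      by (rule hol_span_trans[OF V'(1) finite_N_columns]) (rule frame_in_log_coordinates[OF ad m])
    then show ?thesis using ad by (intro exI[of _ ?V] exI[of _ z] exI[of _ \<sigma>]) auto
  qed
  moreover have "\<omega> \<in> one_forms (W \<inter> U)"
    unfolding one_forms_def
  proof (intro CollectI conjI ballI ext)
    fix p assume p: "p \<in> W \<inter> U"
    obtain V z \<sigma> where V: "V \<subseteq> W" "adapted p V z \<sigma>"
      and span: "\<omega> \<in> coordinate_span p z \<sigma> V"
      using loc'[of p] p by blast
    note adD = adapted_coordinatesD[OF V(2)]
    \<comment> \<open>No divisor passes through p, so all of V lies in U and all denominators are 1: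
      the logarithmic expansion is an ordinary one.\<close>
    have through: "through p = {}" using p by (auto simp: through_def U_def)
    have VU: "V \<subseteq> U" using adD(7) through by (auto simp: U_def)
    then have "V \<inter> U = V" by blast
    then obtain u where u: "\<And>k. holomorphic_fun V (u k)"
      "\<And>v w. v \<in> cone V \<Longrightarrow> \<omega> v w = (\<Sum>k\<in>UNIV. u k (cproj_class v) * log_coordinate_form p z \<sigma> k v w)"
      using hol_spanD[OF span] unfolding \<open>V \<inter> U = V\<close> by blast
    have "\<forall>v\<in>cone V. \<forall>w. \<omega> v w = (\<Sum>k\<in>UNIV. u k (cproj_class v) * differential (\<lambda>q. z q $ k) v w)"
      using u(2) by (simp add: log_coordinate_form_def through)
    then show "\<exists>V z u. p \<in> V \<and> V \<subseteq> W \<inter> U \<and> local_coordinates V z \<and> (\<forall>k. holomorphic_fun V (u k)) \<and>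
       (\<forall>v\<in>cone V. \<forall>w. \<omega> v w = (\<Sum>k\<in>UNIV. u k (cproj_class v) * differential (\<lambda>q. z q $ k) v w))"
      using V(1) VU adD(1,3) u(1)
      by (intro exI[of _ V] exI[of _ z] exI[of _ u]) auto
  qed
  ultimately show ?thesis unfolding log_bundle_carrier by blast
qed

section \<open>Functionals on logarithmic forms\<close>


lemma log_bundle_ops:
  "zero (Sec \<Omega> W) = (\<lambda>v\<in>cone (W \<inter> U). \<lambda>w. 0)"
  "add (Sec \<Omega> W) \<omega> \<eta> = (\<lambda>v\<in>cone (W \<inter> U). \<lambda>w. \<omega> v w + \<eta> v w)"
  "smult (Sec \<Omega> W) g \<omega> = (\<lambda>v\<in>cone (W \<inter> U). \<lambda>w. g (cproj_class v) * \<omega> v w)"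
  "Res \<Omega> V \<omega> = restrict \<omega> (cone (V \<inter> U))"
  by (simp_all add: \<Omega>_def log_bundle_def Let_def U_def)

text \<open>The coordinates supplied by the definition for the two forms may differ, so their
  coefficients cannot be added. Those with respect to the frame can, which gives closure under
  addition.\<close>

lemma log_bundle_local_frame2:
  assumes "\<omega> \<in> log_forms W" "\<eta> \<in> log_forms W" "p \<in> W" "p \<in> chart m"
  obtains V where "open V" "p \<in> V" "V \<subseteq> W" "V \<subseteq> chart m"
    "\<omega> \<in> frame_span m V"
    "\<eta> \<in> frame_span m V"
proof -
  obtain V1 where V1: "open V1" "p \<in> V1" "V1 \<subseteq> W" "V1 \<subseteq> chart m"
    "\<omega> \<in> frame_span m V1"
    using log_bundle_local_frame[OF assms(1,3,4)] .
  obtain V2 where V2: "open V2" "p \<in> V2" "V2 \<subseteq> W" "V2 \<subseteq> chart m"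
    "\<eta> \<in> frame_span m V2"
    using log_bundle_local_frame[OF assms(2,3,4)] .
  show thesis
  proof (rule that[of "V1 \<inter> V2"])
    show "open (V1 \<inter> V2)" using V1(1) V2(1) by (rule open_Int)
    then show "\<omega> \<in> frame_span m (V1 \<inter> V2)"
      "\<eta> \<in> frame_span m (V1 \<inter> V2)"
      by (auto intro!: hol_span_subset[OF V1(5)] hol_span_subset[OF V2(5)] simp: cone_Int)
  qed (use V1 V2 in auto)
qed

lemma log_bundleI':
  assumes W: "open W" and ext: "\<omega> \<in> extensional (cone (W \<inter> U))"
    and loc: "\<And>p m. p \<in> W \<Longrightarrow> p \<in> chart m \<Longrightarrow> \<exists>V. open V \<and> p \<in> V \<and> V \<subseteq> W \<and> V \<subseteq> chart m \<and>
      \<omega> \<in> frame_span m V"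
  shows "\<omega> \<in> log_forms W"
proof (rule log_bundleI[OF W ext])
  fix p assume p: "p \<in> W"
  obtain m where m: "p \<in> chart m" using ex_chart by blast
  obtain V where V: "open V" "p \<in> V" "V \<subseteq> W" "V \<subseteq> chart m"
    "\<omega> \<in> frame_span m V" using loc[OF p m] by blast
  moreover have "V \<inter> W = V" using V(3) by blast
  ultimately show "\<exists>V m. open V \<and> p \<in> V \<and> V \<subseteq> chart m \<and>
      \<omega> \<in> frame_span m (V \<inter> W)"
    by (intro exI[of _ V] exI[of _ m]) simp
qed

lemma log_bundle_add:
  assumes W: "open W" and "\<omega> \<in> log_forms W" "\<eta> \<in> log_forms W"
  shows "(\<lambda>v\<in>cone (W \<inter> U). \<lambda>w. \<omega> v w + \<eta> v w) \<in> log_forms W"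
proof (rule log_bundleI'[OF W restrict_extensional])
  fix p m assume p: "p \<in> W" "p \<in> chart m"
  obtain V where V: "open V" "p \<in> V" "V \<subseteq> W" "V \<subseteq> chart m"
    "\<omega> \<in> frame_span m V"
    "\<eta> \<in> frame_span m V"
    using log_bundle_local_frame2[OF assms(2,3) p] .
  have "(\<lambda>v\<in>cone (W \<inter> U). \<lambda>w. \<omega> v w + \<eta> v w) \<in> frame_span m V"
    by (rule hol_span_cong[OF hol_span_add[OF V(5,6)]]) (use V(3) in \<open>auto simp: in_cone_iff\<close>)
  then show "\<exists>V. open V \<and> p \<in> V \<and> V \<subseteq> W \<and> V \<subseteq> chart m \<and>
      (\<lambda>v\<in>cone (W \<inter> U). \<lambda>w. \<omega> v w + \<eta> v w) \<in> frame_span m V"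
    using V(1-4) by blast
qed

lemma log_bundle_smult:
  assumes W: "open W" and g: "holomorphic_fun W g" and \<omega>: "\<omega> \<in> log_forms W"
  shows "(\<lambda>v\<in>cone (W \<inter> U). \<lambda>w. g (cproj_class v) * \<omega> v w) \<in> log_forms W"
proof (rule log_bundleI'[OF W restrict_extensional])
  fix p m assume p: "p \<in> W" "p \<in> chart m"
  obtain V where V: "open V" "p \<in> V" "V \<subseteq> W" "V \<subseteq> chart m"
    "\<omega> \<in> frame_span m V"
    using log_bundle_local_frame[OF \<omega> p] .
  have "(\<lambda>v\<in>cone (W \<inter> U). \<lambda>w. g (cproj_class v) * \<omega> v w) \<in> frame_span m V"
    by (rule hol_span_cong[OF hol_span_smult[OF holomorphic_fun_subset[OF g V(1,3)] V(5)]])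
      (use V(3) in \<open>auto simp: in_cone_iff\<close>)
  then show "\<exists>V. open V \<and> p \<in> V \<and> V \<subseteq> W \<and> V \<subseteq> chart m \<and>
      (\<lambda>v\<in>cone (W \<inter> U). \<lambda>w. g (cproj_class v) * \<omega> v w) \<in> frame_span m V"
    using V(1-4) by blast
qed

lemma log_bundle_restrict:
  assumes W: "open W'" "W' \<subseteq> W" and \<omega>: "\<omega> \<in> log_forms W"
  shows "restrict \<omega> (cone (W' \<inter> U)) \<in> log_forms W'"
proof (rule log_bundleI'[OF W(1) restrict_extensional])
  fix p m assume p: "p \<in> W'" "p \<in> chart m"
  then have "p \<in> W" using W(2) by blast
  then obtain V where V: "open V" "p \<in> V" "V \<subseteq> W" "V \<subseteq> chart m"
    "\<omega> \<in> frame_span m V"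
    using log_bundle_local_frame[OF \<omega> _ p(2)] by blast
  have V': "open (V \<inter> W')" using V(1) W(1) by (rule open_Int)
  have "\<omega> \<in> frame_span m (V \<inter> W')"
    by (rule hol_span_subset[OF V(5) V']) (auto simp: cone_Int)
  then have "restrict \<omega> (cone (W' \<inter> U)) \<in> frame_span m (V \<inter> W')"
    by (rule hol_span_cong) (auto simp: in_cone_iff)
  then show "\<exists>V. open V \<and> p \<in> V \<and> V \<subseteq> W' \<and> V \<subseteq> chart m \<and>
      restrict \<omega> (cone (W' \<inter> U)) \<in> frame_span m V"
    using V V' p(1) by (intro exI[of _ "V \<inter> W'"]) auto
qed

lemma log_bundle_span:
  assumes W: "open W" "W \<subseteq> chart m" and \<omega>: "\<omega> \<in> frame_span m W"
  shows "restrict \<omega> (cone (W \<inter> U)) \<in> log_forms W"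
proof (rule log_bundleI[OF W(1) restrict_extensional])
  fix p assume p: "p \<in> W"
  have "restrict \<omega> (cone (W \<inter> U)) \<in> frame_span m W"
    by (rule hol_span_cong[OF \<omega>]) simp
  then show "\<exists>V m. open V \<and> p \<in> V \<and> V \<subseteq> chart m \<and>
      restrict \<omega> (cone (W \<inter> U)) \<in> frame_span m (V \<inter> W)"
    using W p by (intro exI[of _ W] exI[of _ m]) simp
qed

definition frame_section where
  "frame_section m c W = restrict (frame m c) (cone (W \<inter> U))"

lemma frame_section_carrier:
  assumes "open W" "W \<subseteq> chart m" "c \<in> cols"
  shows "frame_section m c W \<in> log_forms W"
  unfolding frame_section_def
  by (rule log_bundle_span[OF assms(1,2) hol_span_base[OF assms(1) finite_N_columns assms(3)]])

abbreviation log_functional where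
  "log_functional W \<phi> \<equiv> omodule_hom \<Omega> structure_sheaf \<phi> W"

lemma log_functionalD:
  assumes h: "log_functional W \<phi>" and V: "open V" "V \<subseteq> W" and \<omega>: "\<omega> \<in> log_forms V"
  shows "\<phi> V \<omega> \<in> extensional V" "holomorphic_fun V (\<phi> V \<omega>)"
    and "\<And>\<eta> p. \<eta> \<in> log_forms V \<Longrightarrow> p \<in> V \<Longrightarrow>
        \<phi> V (\<lambda>v\<in>cone (V \<inter> U). \<lambda>w. \<omega> v w + \<eta> v w) p = \<phi> V \<omega> p + \<phi> V \<eta> p"
    and "\<And>g p. holomorphic_fun V g \<Longrightarrow> p \<in> V \<Longrightarrow>
        \<phi> V (\<lambda>v\<in>cone (V \<inter> U). \<lambda>w. g (cproj_class v) * \<omega> v w) p = g p * \<phi> V \<omega> p"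
    and "\<And>V' p. open V' \<Longrightarrow> V' \<subseteq> V \<Longrightarrow> p \<in> V' \<Longrightarrow> \<phi> V' (restrict \<omega> (cone (V' \<inter> U))) p = \<phi> V \<omega> p"
proof -
  note hV = h[unfolded omodule_hom_def structure_sheaf_simps log_bundle_ops, THEN spec, THEN mp, OF conjI[OF V]]
  note h1 = conjunct1[OF hV]
  note h2 = conjunct1[OF conjunct2[OF hV]]
  note h3 = conjunct1[OF conjunct2[OF conjunct2[OF hV]]]
  note h4 = conjunct2[OF conjunct2[OF conjunct2[OF hV]]]
  show "\<phi> V \<omega> \<in> extensional V" "holomorphic_fun V (\<phi> V \<omega>)"
    using funcset_mem[OF h1 \<omega>] by auto
  show "\<phi> V (\<lambda>v\<in>cone (V \<inter> U). \<lambda>w. \<omega> v w + \<eta> v w) p = \<phi> V \<omega> p + \<phi> V \<eta> p"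
    if "\<eta> \<in> log_forms V" "p \<in> V" for \<eta> p
    using fun_cong[OF bspec[OF bspec[OF h2 \<omega>] that(1)], of p] that(2) by simp
  show "\<phi> V (\<lambda>v\<in>cone (V \<inter> U). \<lambda>w. g (cproj_class v) * \<omega> v w) p = g p * \<phi> V \<omega> p"
    if g: "holomorphic_fun V g" and p: "p \<in> V" for g p
  proof -
    \<comment> \<open>Scalars of the structure ring must be extensional; cutting g down to V does
      not change the product form.\<close>
    have g': "restrict g V \<in> {g \<in> extensional V. holomorphic_fun V g}"
      using holomorphic_fun_cong[OF g, of "restrict g V"] by simp
    have "(\<lambda>v\<in>cone (V \<inter> U). \<lambda>w. restrict g V (cproj_class v) * \<omega> v w) =
        (\<lambda>v\<in>cone (V \<inter> U). \<lambda>w. g (cproj_class v) * \<omega> v w)"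
      by (rule restrict_ext) (auto simp: in_cone_iff)
    then show ?thesis using fun_cong[OF bspec[OF bspec[OF h3 g'] \<omega>], of p] p by simp
  qed
  show "\<phi> V' (restrict \<omega> (cone (V' \<inter> U))) p = \<phi> V \<omega> p" if "open V'" "V' \<subseteq> V" "p \<in> V'" for V' p
    using fun_cong[OF bspec[OF mp[OF spec[OF h4] conjI[OF that(1,2)]] \<omega>], of p] that(3) by simp
qed

lemma log_functionalI:
  assumes ext: "\<And>V \<omega>. open V \<Longrightarrow> V \<subseteq> W \<Longrightarrow> \<omega> \<in> log_forms V \<Longrightarrow> \<phi> V \<omega> \<in> extensional V"
    and hol: "\<And>V \<omega>. open V \<Longrightarrow> V \<subseteq> W \<Longrightarrow> \<omega> \<in> log_forms V \<Longrightarrow> holomorphic_fun V (\<phi> V \<omega>)"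
    and add: "\<And>V \<omega> \<eta> p. open V \<Longrightarrow> V \<subseteq> W \<Longrightarrow> \<omega> \<in> log_forms V \<Longrightarrow> \<eta> \<in> log_forms V \<Longrightarrow> p \<in> V \<Longrightarrow>
        \<phi> V (\<lambda>v\<in>cone (V \<inter> U). \<lambda>w. \<omega> v w + \<eta> v w) p = \<phi> V \<omega> p + \<phi> V \<eta> p"
    and smult: "\<And>V g \<omega> p. open V \<Longrightarrow> V \<subseteq> W \<Longrightarrow> holomorphic_fun V g \<Longrightarrow> \<omega> \<in> log_forms V \<Longrightarrow> p \<in> V \<Longrightarrow>
        \<phi> V (\<lambda>v\<in>cone (V \<inter> U). \<lambda>w. g (cproj_class v) * \<omega> v w) p = g p * \<phi> V \<omega> p"
    and res: "\<And>V V' \<omega> p. open V \<Longrightarrow> V \<subseteq> W \<Longrightarrow> open V' \<Longrightarrow> V' \<subseteq> V \<Longrightarrow> \<omega> \<in> log_forms V \<Longrightarrow> p \<in> V' \<Longrightarrow>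
        \<phi> V' (restrict \<omega> (cone (V' \<inter> U))) p = \<phi> V \<omega> p"
  shows "log_functional W \<phi>"
  unfolding omodule_hom_def structure_sheaf_simps log_bundle_ops
proof (rule allI, rule impI, elim conjE, intro conjI)
  fix V assume V: "open V" "V \<subseteq> W"
  show "\<phi> V \<in> log_forms V \<rightarrow> {g \<in> extensional V. holomorphic_fun V g}"
    using ext[OF V] hol[OF V] by blast
  show "\<forall>\<omega>\<in>log_forms V. \<forall>\<eta>\<in>log_forms V.
      \<phi> V (\<lambda>v\<in>cone (V \<inter> U). \<lambda>w. \<omega> v w + \<eta> v w) = (\<lambda>p\<in>V. \<phi> V \<omega> p + \<phi> V \<eta> p)"
    by (intro ballI restrict_eqI ext[OF V] log_bundle_add[OF V(1)] add[OF V])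
  show "\<forall>g\<in>{g \<in> extensional V. holomorphic_fun V g}. \<forall>\<omega>\<in>log_forms V.
      \<phi> V (\<lambda>v\<in>cone (V \<inter> U). \<lambda>w. g (cproj_class v) * \<omega> v w) = (\<lambda>p\<in>V. g p * \<phi> V \<omega> p)"
    by (intro ballI restrict_eqI ext[OF V] log_bundle_smult[OF V(1)] smult[OF V]) auto
  show "\<forall>V'. open V' \<and> V' \<subseteq> V \<longrightarrow> (\<forall>\<omega>\<in>log_forms V.
      \<phi> V' (restrict \<omega> (cone (V' \<inter> U))) = restrict (\<phi> V \<omega>) V')"
  proof (intro allI impI ballI, elim conjE)
    fix V' \<omega> assume V': "open V'" "V' \<subseteq> V" and \<omega>: "\<omega> \<in> log_forms V"
    have "V' \<subseteq> W" using V' V by blast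
    then show "\<phi> V' (restrict \<omega> (cone (V' \<inter> U))) = restrict (\<phi> V \<omega>) V'"
      by (intro restrict_eqI ext[OF V'(1)] log_bundle_restrict[OF V' \<omega>] res[OF V V' \<omega>])
  qed
qed

lemma dual_carrier:
  "\<phi> \<in> carrier (Sec (dual_sheaf \<Omega>) W) \<longleftrightarrow>
     \<phi> \<in> (\<Pi>\<^sub>E V\<in>{V. open V \<and> V \<subseteq> W}. extensional (log_forms V)) \<and> log_functional W \<phi>"
  by (simp add: dual_sheaf_def)

text \<open>A functional respects binary sums and multiples by functions; finite combinations follow
  by induction over subsets of the columns, with membership of the partial sums carried
  along.\<close>

lemma log_functional_combination:
  assumes \<phi>: "log_functional W \<phi>" and V: "open V" "V \<subseteq> W" "V \<subseteq> chart m"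
    and u: "\<And>c. holomorphic_fun V (u c)" and ext: "\<omega> \<in> extensional (cone (V \<inter> U))"
    and \<omega>: "\<And>v w. v \<in> cone (V \<inter> U) \<Longrightarrow> \<omega> v w = (\<Sum>c\<in>cols. u c (cproj_class v) * frame m c v w)"
    and p: "p \<in> V"
  shows "\<phi> V \<omega> p = (\<Sum>c\<in>cols. u c p * \<phi> V (frame_section m c V) p)"
proof -
  let ?S = "\<lambda>C. \<lambda>v\<in>cone (V \<inter> U). \<lambda>w. \<Sum>c\<in>C. u c (cproj_class v) * frame m c v w"
  have fs: "frame_section m c V \<in> log_forms V" if "c \<in> cols" for c
    using frame_section_carrier[OF V(1,3) that] .
  have key: "?S C \<in> log_forms V \<and> \<phi> V (?S C) p = (\<Sum>c\<in>C. u c p * \<phi> V (frame_section m c V) p)"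
    if "C \<subseteq> cols" "finite C" for C
    using that(2,1)
  proof (induction C rule: finite_induct)
    case empty
    \<comment> \<open>The empty sum is written as 0 times some generator, so that linearity yields
      the value 0.\<close>
    have "Inl m \<in> cols" by (simp add: N_columns_def)
    note f = fs[OF this]
    have 0: "holomorphic_fun V (\<lambda>q. 0)" using V(1) by (rule holomorphic_fun_const)
    have eq: "?S {} = (\<lambda>v\<in>cone (V \<inter> U). \<lambda>w. 0 * frame_section m (Inl m) V v w)"
      by (rule restrict_ext) simp
    have "\<phi> V (?S {}) p = 0 * \<phi> V (frame_section m (Inl m) V) p"
      unfolding eq by (rule log_functionalD(4)[OF \<phi> V(1,2) f 0 p])
    moreover have "?S {} \<in> log_forms V"
      unfolding eq by (rule log_bundle_smult[OF V(1) 0 f])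
    ultimately show ?case unfolding mult_zero_left sum.empty by blast
  next
    case (insert c C)
    then have f: "frame_section m c V \<in> log_forms V" using fs by simp
    let ?c = "\<lambda>v\<in>cone (V \<inter> U). \<lambda>w. u c (cproj_class v) * frame_section m c V v w"
    have c: "?c \<in> log_forms V" using log_bundle_smult[OF V(1) u f] .
    have S: "?S C \<in> log_forms V" "\<phi> V (?S C) p = (\<Sum>c\<in>C. u c p * \<phi> V (frame_section m c V) p)"
      using insert.IH insert.prems by blast+
    have eq: "?S (insert c C) = (\<lambda>v\<in>cone (V \<inter> U). \<lambda>w. ?c v w + ?S C v w)"
      by (rule restrict_ext) (use insert.hyps in \<open>auto simp: frame_section_def\<close>)
    have "\<phi> V (\<lambda>v\<in>cone (V \<inter> U). \<lambda>w. ?c v w + ?S C v w) p = \<phi> V ?c p + \<phi> V (?S C) p"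
      by (rule log_functionalD(3)[OF \<phi> V(1,2) c S(1) p])
    also have "\<phi> V ?c p = u c p * \<phi> V (frame_section m c V) p"
      by (rule log_functionalD(4)[OF \<phi> V(1,2) f u p])
    finally have "\<phi> V (?S (insert c C)) p = (\<Sum>c\<in>insert c C. u c p * \<phi> V (frame_section m c V) p)"
      unfolding eq unfolding S(2) sum.insert[OF insert.hyps] .
    moreover have "?S (insert c C) \<in> log_forms V"
      unfolding eq by (rule log_bundle_add[OF V(1) c S(1)])
    ultimately show ?case by blast
  qed
  have A: "\<phi> V (?S cols) p = (\<Sum>c\<in>cols. u c p * \<phi> V (frame_section m c V) p)"
    by (rule conjunct2[OF key[OF subset_refl finite_N_columns]])
  have B: "\<omega> = ?S cols" by (rule restrict_eqI[OF ext]) (simp add: fun_eq_iff \<omega>)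
  show ?thesis by (subst B) (rule A)
qed


section \<open>The map from the dual of the logarithmic bundle\<close>

definition twist :: "'n option + nat \<Rightarrow> int" where
  "twist c = (case c of Inl j \<Rightarrow> 1 | Inr k \<Rightarrow> 0)"

text \<open>The factor that makes weight times frame independent of the chart and gives the entries
  the degrees \<open>twist c\<close>. The sign -1 comes from the relation between the generators:
  its right-hand side, \<open>f_i\<close> times the form \<open>Inr i\<close>, moves to the left to
  become the second block of row i of N.\<close>

definition weight :: "'n option \<Rightarrow> 'n option + nat \<Rightarrow> complex ^ ('n option) \<Rightarrow> complex" where
  "weight m c v = (case c of Inl j \<Rightarrow> v $ m | Inr k \<Rightarrow> -1)"

abbreviation \<G> where "\<G> \<equiv> direct_sum cols (\<lambda>c. twisting_sheaf (twist c))"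

abbreviation \<H> where "\<H> \<equiv> direct_sum {1..l} (\<lambda>i. twisting_sheaf (int (d i)))"

abbreviation \<N> where "\<N> \<equiv> matrix_map {1..l} cols (N_matrix f)"

lemma weight_nonzero: "v $ m \<noteq> 0 \<Longrightarrow> weight m c v \<noteq> 0"
  by (simp add: weight_def split: sum.split)

lemma weight_scale: "a \<noteq> 0 \<Longrightarrow> weight m c (a *s v) = a powi twist c * weight m c v"
  by (simp add: weight_def twist_def split: sum.split)

lemma weight_cholomorphic: "open S \<Longrightarrow> cholomorphic_on (weight m c) S"
  unfolding weight_def by (cases c) (auto intro: cholomorphic_on_nth cholomorphic_on_const)

lemma weight_frame:
  "v $ m \<noteq> 0 \<Longrightarrow> v $ m' \<noteq> 0 \<Longrightarrow>
   weight m' c v * frame m' c v w = weight m c v * frame m c v w"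
  by (simp add: weight_def frame_def split: sum.split)

definition frame_value where
  "frame_value W \<phi> m c v =
     weight m c v * \<phi> (W \<inter> chart m) (frame_section m c (W \<inter> chart m)) (cproj_class v)"

text \<open>A chart is chosen separately at each v. By \<open>frame_value_chart\<close> the choice
  does not matter, so locally it may be taken constant.\<close>

definition dual_map where
  "dual_map W \<phi> = (\<lambda>c\<in>cols. \<lambda>v\<in>cone W. frame_value W \<phi> (SOME m. v $ m \<noteq> 0) c v)"

lemma frame_section_restrict:
  "V' \<subseteq> V \<Longrightarrow> restrict (frame_section m c V) (cone (V' \<inter> U)) = frame_section m c V'"
  unfolding frame_section_def by (rule ext) (auto simp: restrict_def in_cone_iff)

lemma frame_value_local:
  assumes \<phi>: "log_functional W \<phi>" and V: "open V" "V \<subseteq> W" "V \<subseteq> chart m" and W: "open W"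
    and c: "c \<in> cols" and v: "v \<in> cone V"
  shows "frame_value W \<phi> m c v = weight m c v * \<phi> V (frame_section m c V) (cproj_class v)"
proof -
  have W': "open (W \<inter> chart m)" using W open_chart by (rule open_Int)
  have f: "frame_section m c (W \<inter> chart m) \<in> log_forms (W \<inter> chart m)"
    using W' c by (intro frame_section_carrier) auto
  have "V \<subseteq> W \<inter> chart m" using V by blast
  from log_functionalD(5)[OF \<phi> W' _ f V(1) this] frame_section_restrict[OF this] v
  show ?thesis by (simp add: frame_value_def in_cone_iff)
qed

text \<open>On the overlap the two frames differ by the function \<open>x_m / x_m'\<close> for
  \<open>Inl\<close> and by 1 for \<open>Inr\<close>; the functional is linear over functions, and
  the weights compensate this factor.\<close>

lemma frame_value_chart:
  assumes \<phi>: "log_functional W \<phi>" and W: "open W" and c: "c \<in> cols" and v: "v \<in> cone W"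
    and m: "v $ m \<noteq> 0" "v $ m' \<noteq> 0"
  shows "frame_value W \<phi> m c v = frame_value W \<phi> m' c v"
proof -
  let ?V = "W \<inter> chart m \<inter> chart m'"
  have V: "open ?V" using W open_chart by (intro open_Int)
  have v': "v \<in> cone ?V" using v m by (simp add: cone_Int cone_chart)
  have f: "frame_section m c ?V \<in> log_forms ?V"
    using V c by (intro frame_section_carrier) auto
  define g where "g = (\<lambda>q. case c of Inl j \<Rightarrow> rep_cproj q $ m / rep_cproj q $ m' | Inr k \<Rightarrow> 1)"
  have g: "holomorphic_fun ?V g"
    unfolding g_def using holomorphic_fun_ratio[OF V, of m' m] holomorphic_fun_const[OF V, of 1]
    by (cases c) auto
  have gv: "weight m' c x * g (cproj_class x) = weight m c x" if "x \<in> cone ?V" for x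
    using that ratio_class[of x m m'] unfolding g_def weight_def
    by (cases c) (auto simp: cone_Int cone_chart in_cone_iff)
  have "frame_section m' c ?V = (\<lambda>v\<in>cone (?V \<inter> U). \<lambda>w. g (cproj_class v) * frame_section m c ?V v w)"
    unfolding frame_section_def
  proof (rule restrict_ext)
    fix x assume x: "x \<in> cone (?V \<inter> U)"
    then have x': "x \<in> cone ?V" by (simp add: cone_Int)
    then have xm: "x $ m \<noteq> 0" "x $ m' \<noteq> 0" by (simp_all add: cone_Int cone_chart)
    show "frame m' c x = (\<lambda>w. g (cproj_class x) * restrict (frame m c) (cone (?V \<inter> U)) x w)"
    proof
      fix w
      have "weight m' c x * frame m' c x w = weight m' c x * (g (cproj_class x) * frame m c x w)"
        using weight_frame[OF xm, of c w] gv[OF x'] by (simp flip: mult.assoc)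
      then show "frame m' c x w = g (cproj_class x) * restrict (frame m c) (cone (?V \<inter> U)) x w"
        using x weight_nonzero[OF xm(2), of c] by simp
    qed
  qed
  then have "\<phi> ?V (frame_section m' c ?V) (cproj_class v) =
      g (cproj_class v) * \<phi> ?V (frame_section m c ?V) (cproj_class v)"
    using log_functionalD(4)[OF \<phi> V _ f g, of "cproj_class v"] v' by (auto simp: in_cone_iff)
  moreover have "frame_value W \<phi> m c v = weight m c v * \<phi> ?V (frame_section m c ?V) (cproj_class v)"
    by (rule frame_value_local[OF \<phi> V _ _ W c v']) auto
  moreover have "frame_value W \<phi> m' c v = weight m' c v * \<phi> ?V (frame_section m' c ?V) (cproj_class v)"
    by (rule frame_value_local[OF \<phi> V _ _ W c v']) auto
  ultimately show ?thesis using gv[OF v'] by (simp flip: mult.assoc)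
qed

lemma dual_map_eq:
  assumes \<phi>: "log_functional W \<phi>" and V: "open V" "V \<subseteq> W" "V \<subseteq> chart m" and W: "open W"
    and c: "c \<in> cols" and v: "v \<in> cone V"
  shows "dual_map W \<phi> c v = weight m c v * \<phi> V (frame_section m c V) (cproj_class v)"
proof -
  have vW: "v \<in> cone W" using v V(2) cone_mono by blast
  have vm: "v $ m \<noteq> 0" using cone_subset_chart[OF V(3) v] .
  then have "v $ (SOME m. v $ m \<noteq> 0) \<noteq> 0" by (rule someI)
  then have "dual_map W \<phi> c v = frame_value W \<phi> m c v"
    using frame_value_chart[OF \<phi> W c vW _ vm] c vW by (simp add: dual_map_def)
  then show ?thesis using frame_value_local[OF assms] by simp
qed

lemma chart_neighbourhood:
  assumes "open W" "v \<in> cone W"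
  obtains m where "v $ m \<noteq> 0" "open (W \<inter> chart m)" "v \<in> cone (W \<inter> chart m)"
proof -
  obtain m where "v $ m \<noteq> 0" using assms(2) by (auto simp: cone_def vec_eq_iff)
  then show thesis
    using that[of m] assms open_chart open_Int by (auto simp: cone_Int cone_chart)
qed

text \<open>This recovers a functional from its image under \<open>dual_map\<close>. It yields
  injectivity and, applied to a relation between the generators, the equations of the
  kernel.\<close>

lemma functional_evaluation:
  assumes \<phi>: "log_functional W \<phi>" and W: "open W" and V: "open V" "V \<subseteq> W" "V \<subseteq> chart m"
    and u: "\<And>c. holomorphic_fun V (u c)" and ext: "\<omega> \<in> extensional (cone (V \<inter> U))"
    and \<omega>: "\<And>v w. v \<in> cone (V \<inter> U) \<Longrightarrow> \<omega> v w = (\<Sum>c\<in>cols. u c (cproj_class v) * frame m c v w)"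
    and v: "v \<in> cone V"
  shows "\<phi> V \<omega> (cproj_class v) = (\<Sum>c\<in>cols. u c (cproj_class v) * (dual_map W \<phi> c v / weight m c v))"
proof -
  have "cproj_class v \<in> V" using v by (simp add: in_cone_iff)
  from log_functional_combination[OF \<phi> V u ext \<omega> this]
  have "\<phi> V \<omega> (cproj_class v) =
    (\<Sum>c\<in>cols. u c (cproj_class v) * \<phi> V (frame_section m c V) (cproj_class v))" by simp
  also have "\<dots> = (\<Sum>c\<in>cols. u c (cproj_class v) * (dual_map W \<phi> c v / weight m c v))"
    using dual_map_eq[OF \<phi> V W _ v] weight_nonzero[OF cone_subset_chart[OF V(3) v]]
    by (intro sum.cong) auto
  finally show ?thesis .
qed

lemma dual_map_carrier:
  assumes \<phi>: "log_functional W \<phi>" and W: "open W"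
  shows "dual_map W \<phi> \<in> carrier (Sec \<G> W)"
  unfolding twisted_carrier
proof (intro conjI ballI allI impI)
  show "dual_map W \<phi> \<in> extensional cols" by (simp add: dual_map_def)
  fix c assume c: "c \<in> cols"
  then show "dual_map W \<phi> c \<in> extensional (cone W)" by (simp add: dual_map_def)
  show "cholomorphic_on (dual_map W \<phi> c) (cone W)"
  proof (rule cholomorphic_on_local[OF iffD1[OF open_cone W]])
    fix v assume v: "v \<in> cone W"
    obtain m where m: "v $ m \<noteq> 0" "open (W \<inter> chart m)" "v \<in> cone (W \<inter> chart m)"
      using chart_neighbourhood[OF W v] .
    let ?V = "W \<inter> chart m"
    have f: "frame_section m c ?V \<in> log_forms ?V"
      using m(2) c by (intro frame_section_carrier) auto
    have "cholomorphic_on (\<lambda>v. weight m c v * \<phi> ?V (frame_section m c ?V) (cproj_class v)) (cone ?V)"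
      using log_functionalD(2)[OF \<phi> m(2) _ f] m(2)
      by (intro cholomorphic_on_mult weight_cholomorphic) (auto simp: holomorphic_fun_def open_cone)
    then have "cholomorphic_on (dual_map W \<phi> c) (cone ?V)"
      by (rule cholomorphic_on_cong) (rule dual_map_eq[OF \<phi> m(2) _ _ W c, symmetric], auto)
    then show "\<exists>T. v \<in> T \<and> cholomorphic_on (dual_map W \<phi> c) T" using m(3) by blast
  qed
  fix v a assume v: "v \<in> cone W" and a: "a \<noteq> (0 :: complex)"
  obtain m where m: "v $ m \<noteq> 0" "open (W \<inter> chart m)" "v \<in> cone (W \<inter> chart m)"
    using chart_neighbourhood[OF W v] .
  show "dual_map W \<phi> c (a *s v) = a powi twist c * dual_map W \<phi> c v"
    using dual_map_eq[OF \<phi> m(2) Int_lower1 Int_lower2 W c m(3)]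
      dual_map_eq[OF \<phi> m(2) Int_lower1 Int_lower2 W c cone_scale[OF m(3) a]]
    by (simp add: weight_scale[OF a] cproj_class_scale[OF a])
qed

lemma dual_carrierD:
  assumes "\<phi> \<in> carrier (Sec (dual_sheaf \<Omega>) W)"
  shows "log_functional W \<phi>" "\<phi> \<in> extensional {V. open V \<and> V \<subseteq> W}"
    and "\<And>V. open V \<Longrightarrow> V \<subseteq> W \<Longrightarrow> \<phi> V \<in> extensional (log_forms V)"
  using assms unfolding dual_carrier by (auto simp: PiE_def)

lemma dual_ops:
  "add (Sec (dual_sheaf \<Omega>) W) \<phi> \<psi> = (\<lambda>V\<in>{V. open V \<and> V \<subseteq> W}. \<lambda>s\<in>log_forms V. \<lambda>p\<in>V. \<phi> V s p + \<psi> V s p)"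
  "smult (Sec (dual_sheaf \<Omega>) W) g \<phi> = (\<lambda>V\<in>{V. open V \<and> V \<subseteq> W}. \<lambda>s\<in>log_forms V. \<lambda>p\<in>V. g p * \<phi> V s p)"
  "Res (dual_sheaf \<Omega>) V \<phi> = restrict \<phi> {V'. open V' \<and> V' \<subseteq> V}"
  by (simp_all add: dual_sheaf_def)

text \<open>Nothing is assumed about \<phi>, so this applies to the sum or multiple of functionals
  without a proof that it is a functional again.\<close>

lemma dual_map_cong:
  assumes "open W" "\<And>c v m. c \<in> cols \<Longrightarrow> v \<in> cone W \<Longrightarrow> v $ m \<noteq> 0 \<Longrightarrow> frame_value W \<phi> m c v = g c v"
  shows "dual_map W \<phi> = (\<lambda>c\<in>cols. \<lambda>v\<in>cone W. g c v)"
proof -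
  have "v $ (SOME m. v $ m \<noteq> 0) \<noteq> 0" if "v \<in> cone W" for v :: "complex ^ ('n option)"
  proof -
    have "\<exists>m. v $ m \<noteq> 0" using that by (auto simp: cone_def vec_eq_iff)
    then show ?thesis by (rule someI_ex)
  qed
  then show ?thesis unfolding dual_map_def using assms(2) by (intro restrict_ext) simp
qed

lemma dual_map_apply:
  assumes "open W" "c \<in> cols" "v \<in> cone W" "v $ m \<noteq> 0" "log_functional W \<phi>"
  shows "dual_map W \<phi> c v = frame_value W \<phi> m c v"
proof -
  have "v $ (SOME m. v $ m \<noteq> 0) \<noteq> 0" using assms(4) by (rule someI)
  then show ?thesis
    using frame_value_chart[OF assms(5,1,2,3) _ assms(4)] assms(2,3) by (simp add: dual_map_def)
qed

lemma dual_map_hom: "omodule_hom (dual_sheaf \<Omega>) \<G> dual_map UNIV"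
  unfolding omodule_hom_def
proof (rule allI, rule impI, intro conjI)
  fix W :: "'n cproj set" assume "open W \<and> W \<subseteq> UNIV"
  then have W: "open W" by simp
  show "dual_map W \<in> carrier (Sec (dual_sheaf \<Omega>) W) \<rightarrow> carrier (Sec \<G> W)"
    using dual_map_carrier[OF dual_carrierD(1) W] by blast
next
  fix W :: "'n cproj set" assume "open W \<and> W \<subseteq> UNIV"
  then have W: "open W" by simp
  show "\<forall>\<phi>\<in>carrier (Sec (dual_sheaf \<Omega>) W). \<forall>\<psi>\<in>carrier (Sec (dual_sheaf \<Omega>) W).
      dual_map W (\<phi> \<oplus>\<^bsub>Sec (dual_sheaf \<Omega>) W\<^esub> \<psi>) = dual_map W \<phi> \<oplus>\<^bsub>Sec \<G> W\<^esub> dual_map W \<psi>"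
  proof (intro ballI)
    fix \<phi> \<psi> assume "\<phi> \<in> carrier (Sec (dual_sheaf \<Omega>) W)" "\<psi> \<in> carrier (Sec (dual_sheaf \<Omega>) W)"
    note \<phi> = dual_carrierD(1)[OF this(1)] and \<psi> = dual_carrierD(1)[OF this(2)]
    show "dual_map W (\<phi> \<oplus>\<^bsub>Sec (dual_sheaf \<Omega>) W\<^esub> \<psi>) = dual_map W \<phi> \<oplus>\<^bsub>Sec \<G> W\<^esub> dual_map W \<psi>"
      unfolding twisted_ops
    proof (rule dual_map_cong[OF W])
      fix c v m assume c: "c \<in> cols" and v: "v \<in> cone W" and m: "v $ m \<noteq> 0"
      have V: "open (W \<inter> chart m)" using W open_chart by (rule open_Int)
      then have "frame_section m c (W \<inter> chart m) \<in> log_forms (W \<inter> chart m)"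
        using c by (intro frame_section_carrier) auto
      moreover have "cproj_class v \<in> W \<inter> chart m" using v m by (simp add: in_cone_iff in_chart_class)
      ultimately show "frame_value W (\<phi> \<oplus>\<^bsub>Sec (dual_sheaf \<Omega>) W\<^esub> \<psi>) m c v = dual_map W \<phi> c v + dual_map W \<psi> c v"
        unfolding dual_map_apply[OF W c v m \<phi>] dual_map_apply[OF W c v m \<psi>]
        using V by (simp add: frame_value_def dual_ops distrib_left)
    qed
  qed
next
  fix W :: "'n cproj set" assume "open W \<and> W \<subseteq> UNIV"
  then have W: "open W" by simp
  show "\<forall>g\<in>carrier (structure_ring W). \<forall>\<phi>\<in>carrier (Sec (dual_sheaf \<Omega>) W).
      dual_map W (g \<odot>\<^bsub>Sec (dual_sheaf \<Omega>) W\<^esub> \<phi>) = g \<odot>\<^bsub>Sec \<G> W\<^esub> dual_map W \<phi>"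
  proof (intro ballI)
    fix g \<phi> assume "\<phi> \<in> carrier (Sec (dual_sheaf \<Omega>) W)"
    note \<phi> = dual_carrierD(1)[OF this(1)]
    show "dual_map W (g \<odot>\<^bsub>Sec (dual_sheaf \<Omega>) W\<^esub> \<phi>) = g \<odot>\<^bsub>Sec \<G> W\<^esub> dual_map W \<phi>"
      unfolding twisted_ops
    proof (rule dual_map_cong[OF W])
      fix c v m assume c: "c \<in> cols" and v: "v \<in> cone W" and m: "v $ m \<noteq> 0"
      have V: "open (W \<inter> chart m)" using W open_chart by (rule open_Int)
      then have "frame_section m c (W \<inter> chart m) \<in> log_forms (W \<inter> chart m)"
        using c by (intro frame_section_carrier) auto
      moreover have "cproj_class v \<in> W \<inter> chart m" using v m by (simp add: in_cone_iff in_chart_class)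
      ultimately show "frame_value W (g \<odot>\<^bsub>Sec (dual_sheaf \<Omega>) W\<^esub> \<phi>) m c v = g (cproj_class v) * dual_map W \<phi> c v"
        unfolding dual_map_apply[OF W c v m \<phi>]
        using V by (simp add: frame_value_def dual_ops)
    qed
  qed
next
  fix W :: "'n cproj set" assume "open W \<and> W \<subseteq> UNIV"
  then have W: "open W" by simp
  show "\<forall>W'. open W' \<and> W' \<subseteq> W \<longrightarrow> (\<forall>\<phi>\<in>carrier (Sec (dual_sheaf \<Omega>) W).
      dual_map W' (Res (dual_sheaf \<Omega>) W' \<phi>) = Res \<G> W' (dual_map W \<phi>))"
  proof (intro allI impI ballI, elim conjE)
    fix W' \<phi> assume W': "open W'" "W' \<subseteq> W" and "\<phi> \<in> carrier (Sec (dual_sheaf \<Omega>) W)"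
    note \<phi> = dual_carrierD(1)[OF this(3)]
    have "dual_map W' (Res (dual_sheaf \<Omega>) W' \<phi>) = (\<lambda>c\<in>cols. \<lambda>v\<in>cone W'. dual_map W \<phi> c v)"
    proof (rule dual_map_cong[OF W'(1)])
      fix c v m assume c: "c \<in> cols" and v: "v \<in> cone W'" and m: "v $ m \<noteq> 0"
      have V: "open (W' \<inter> chart m)" using W'(1) open_chart by (rule open_Int)
      have v': "v \<in> cone (W' \<inter> chart m)" using v m by (simp add: cone_Int cone_chart)
      have "dual_map W \<phi> c v = weight m c v * \<phi> (W' \<inter> chart m) (frame_section m c (W' \<inter> chart m)) (cproj_class v)"
        using W' by (intro dual_map_eq[OF \<phi> V _ _ W c v']) auto
      then show "frame_value W' (Res (dual_sheaf \<Omega>) W' \<phi>) m c v = dual_map W \<phi> c v"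
        using V by (simp add: frame_value_def dual_ops)
    qed
    then show "dual_map W' (Res (dual_sheaf \<Omega>) W' \<phi>) = Res \<G> W' (dual_map W \<phi>)"
      unfolding twisted_ops .
  qed
qed

lemma dual_map_inj:
  assumes W: "open W"
  shows "inj_on (dual_map W) (carrier (Sec (dual_sheaf \<Omega>) W))"
proof (rule inj_onI)
  fix \<phi> \<psi> assume \<phi>0: "\<phi> \<in> carrier (Sec (dual_sheaf \<Omega>) W)" and \<psi>0: "\<psi> \<in> carrier (Sec (dual_sheaf \<Omega>) W)"
    and eq: "dual_map W \<phi> = dual_map W \<psi>"
  note \<phi> = dual_carrierD[OF \<phi>0] and \<psi> = dual_carrierD[OF \<psi>0]
  have 1: "\<phi> V \<omega> p = \<psi> V \<omega> p" if V: "open V" "V \<subseteq> W" and \<omega>: "\<omega> \<in> log_forms V" and p: "p \<in> V" for V \<omega> p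
  proof -
    obtain m where m: "p \<in> chart m" using ex_chart by blast
    obtain V' where V': "open V'" "p \<in> V'" "V' \<subseteq> V" "V' \<subseteq> chart m"
      "\<omega> \<in> frame_span m V'"
      using log_bundle_local_frame[OF \<omega> p m] .
    obtain u where u: "\<And>c. holomorphic_fun V' (u c)"
      "\<And>v w. v \<in> cone (V' \<inter> U) \<Longrightarrow> \<omega> v w = (\<Sum>c\<in>cols. u c (cproj_class v) * frame m c v w)"
      using hol_spanD[OF V'(5)] by blast
    let ?\<omega> = "restrict \<omega> (cone (V' \<inter> U))"
    have V'W: "V' \<subseteq> W" using V'(3) V(2) by blast
    have r: "rep_cproj p \<in> cone V'" using V'(2) by (simp add: rep_in_cone)
    have h: "\<theta> V \<omega> p = (\<Sum>c\<in>cols. u c p * (dual_map W \<theta> c (rep_cproj p) / weight m c (rep_cproj p)))"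
      if "log_functional W \<theta>" for \<theta>
    proof -
      have "\<theta> V \<omega> p = \<theta> V' ?\<omega> (cproj_class (rep_cproj p))"
        using log_functionalD(5)[OF that V \<omega> V'(1,3,2)] by simp
      also have "\<dots> = (\<Sum>c\<in>cols. u c (cproj_class (rep_cproj p)) *
          (dual_map W \<theta> c (rep_cproj p) / weight m c (rep_cproj p)))"
        by (rule functional_evaluation[OF that W V'(1) V'W V'(4) u(1) _ _ r]) (auto simp: u(2))
      finally show ?thesis by simp
    qed
    show ?thesis unfolding h[OF \<phi>(1)] h[OF \<psi>(1)] eq ..
  qed
  have 2: "\<phi> V = \<psi> V" if V: "open V" "V \<subseteq> W" for V
  proof (rule extensionalityI[OF \<phi>(3)[OF V] \<psi>(3)[OF V]])
    fix \<omega> assume \<omega>: "\<omega> \<in> log_forms V"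
    show "\<phi> V \<omega> = \<psi> V \<omega>"
      by (rule extensionalityI[OF log_functionalD(1)[OF \<phi>(1) V \<omega>] log_functionalD(1)[OF \<psi>(1) V \<omega>]])
        (rule 1[OF V \<omega>])
  qed
  show "\<phi> = \<psi>"
    by (rule extensionalityI[OF \<phi>(2) \<psi>(2)]) (use 2 in blast)
qed


section \<open>The kernel of the matrix\<close>

definition vector_part :: "('n option + nat \<Rightarrow> complex ^ ('n option) \<Rightarrow> complex) \<Rightarrow>
    complex ^ ('n option) \<Rightarrow> complex ^ ('n option)" where
  "vector_part s v = (\<chi> j. s (Inl j) v)"

lemma dev_expand: "dev i v w = (\<Sum>j\<in>UNIV. w $ j * dev i v (axis j 1))"
  by (rule chas_derivative_expand[OF ev_derivative])

lemma dev_axis: "dev i v (axis j 1) = mp_eval (mp_pderiv j (f i)) v"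
  by (simp add: dev_def axis_def if_distrib cong: if_cong)

lemma dev_scale_arg: "dev i v (a *s w) = a * dev i v w"
  by (rule chas_derivative_scale[OF ev_derivative])

lemma N_sum:
  assumes "i \<in> {1..l}"
  shows "(\<Sum>c\<in>cols. mp_eval (N_matrix f i c) v * s c v) =
    dev i v (vector_part s v) + (if i < l then ev i v * s (Inr i) v else 0)"
proof -
  have "(\<Sum>k\<in>{1..<l}. mp_eval (if k = i then f i else 0) v * s (Inr k) v) =
      (\<Sum>k\<in>{1..<l}. if k = i then ev i v * s (Inr i) v else 0)"
    by (intro sum.cong) (auto simp: ev_def)
  also have "\<dots> = (if i < l then ev i v * s (Inr i) v else 0)"
    using assms by (simp add: sum.delta)
  finally show ?thesis
    by (simp add: sum_N_columns N_matrix_def dev_def vector_part_def)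
qed

lemma N_apply:
  assumes "i \<in> {1..l}" "v \<in> cone W"
  shows "\<N> W s i v = dev i v (vector_part s v) + (if i < l then ev i v * s (Inr i) v else 0)"
  using N_sum[OF assms(1)] assms by (simp add: matrix_map_def)

lemma N_carrier:
  assumes W: "open W" and s: "s \<in> carrier (Sec \<G> W)"
  shows "\<N> W s \<in> carrier (Sec \<H> W)"
  unfolding twisted_carrier
proof (intro conjI ballI allI impI)
  note s' = s[unfolded twisted_carrier]
  have W': "open (cone W)" using W open_cone by blast
  show "\<N> W s \<in> extensional {1..l}" by (simp add: matrix_map_def)
  fix i assume i: "i \<in> {1..l}"
  then show "\<N> W s i \<in> extensional (cone W)" by (simp add: matrix_map_def)
  have "cholomorphic_on (\<lambda>v. \<Sum>c\<in>cols. mp_eval (N_matrix f i c) v * s c v) (cone W)"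
    using s' by (intro cholomorphic_on_sum cholomorphic_on_mult mp_eval_cholomorphic W') auto
  then show "cholomorphic_on (\<N> W s i) (cone W)"
    by (rule cholomorphic_on_cong) (use i in \<open>simp add: matrix_map_def\<close>)
  fix v a assume v: "v \<in> cone W" and a: "a \<noteq> (0 :: complex)"
  have av: "a *s v \<in> cone W" using cone_scale[OF v a] .
  have hom: "s c (a *s v) = a powi twist c * s c v" if "c \<in> cols" for c using s' v a that by blast
  have "vector_part s (a *s v) = a *s vector_part s v"
    using hom by (simp add: vector_part_def vec_eq_iff twist_def N_columns_def)
  \<comment> \<open>The gradient of degree \<open>d i - 1\<close> meets a vector of degree
    1.\<close>
  then have "dev i (a *s v) (vector_part s (a *s v)) = a ^ d i * dev i v (vector_part s v)"
    using dev_scale[OF i, of a v] by (simp add: dev_scale_arg)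
  moreover have "ev i (a *s v) * s (Inr i) (a *s v) = a ^ d i * (ev i v * s (Inr i) v)" if "i < l"
    using hom[of "Inr i"] i that ev_scale[OF i] by (simp add: twist_def N_columns_def)
  ultimately show "\<N> W s i (a *s v) = a powi int (d i) * \<N> W s i v"
    unfolding N_apply[OF i v] N_apply[OF i av] by (auto simp: distrib_left)
qed

lemma N_hom: "omodule_hom \<G> \<H> \<N> UNIV"
  unfolding omodule_hom_def twisted_ops
proof (rule allI, rule impI, intro conjI)
  fix W :: "'n cproj set" assume "open W \<and> W \<subseteq> UNIV"
  then show "\<N> W \<in> carrier (Sec \<G> W) \<rightarrow> carrier (Sec \<H> W)" using N_carrier by blast
  show "\<forall>s\<in>carrier (Sec \<G> W). \<forall>t\<in>carrier (Sec \<G> W).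
      \<N> W (\<lambda>c\<in>cols. \<lambda>v\<in>cone W. s c v + t c v) = (\<lambda>i\<in>{1..l}. \<lambda>v\<in>cone W. \<N> W s i v + \<N> W t i v)"
    unfolding matrix_map_def
    by (intro ballI restrict_ext) (simp add: distrib_left sum.distrib)
  show "\<forall>g\<in>carrier (structure_ring W). \<forall>s\<in>carrier (Sec \<G> W).
      \<N> W (\<lambda>c\<in>cols. \<lambda>v\<in>cone W. g (cproj_class v) * s c v) =
      (\<lambda>i\<in>{1..l}. \<lambda>v\<in>cone W. g (cproj_class v) * \<N> W s i v)"
    unfolding matrix_map_def
    by (intro ballI restrict_ext) (simp add: sum_distrib_left mult_ac)
  show "\<forall>W'. open W' \<and> W' \<subseteq> W \<longrightarrow> (\<forall>s\<in>carrier (Sec \<G> W).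
      \<N> W' (\<lambda>c\<in>cols. restrict (s c) (cone W')) = (\<lambda>i\<in>{1..l}. restrict (\<N> W s i) (cone W')))"
    unfolding matrix_map_def
    by (intro allI impI ballI restrict_ext) (auto simp: in_cone_iff)
qed

definition in_kernel where
  "in_kernel W s \<longleftrightarrow> (\<forall>i\<in>{1..l}. \<forall>v\<in>cone W.
     dev i v (vector_part s v) + (if i < l then ev i v * s (Inr i) v else 0) = 0)"

lemma N_zero_iff: "\<N> W s = zero (Sec \<H> W) \<longleftrightarrow> in_kernel W s"
proof
  assume eq: "\<N> W s = zero (Sec \<H> W)"
  show "in_kernel W s"
    unfolding in_kernel_def
  proof (intro ballI)
    fix i v assume i: "i \<in> {1..l}" and v: "v \<in> cone W"
    have "\<N> W s i v = 0"
      unfolding eq twisted_ops by (simp only: restrict_apply i v if_True)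
    then show "dev i v (vector_part s v) + (if i < l then ev i v * s (Inr i) v else 0) = 0"
      unfolding N_apply[OF i v] .
  qed
next
  assume k: "in_kernel W s"
  have "\<N> W s i = (\<lambda>v\<in>cone W. 0)" if i: "i \<in> {1..l}" for i
  proof (rule restrict_eqI)
    show "\<N> W s i \<in> extensional (cone W)" using i by (simp add: matrix_map_def)
    show "\<N> W s i v = 0" if "v \<in> cone W" for v
      using N_apply[OF i that, of s] k i that unfolding in_kernel_def by simp
  qed
  then show "\<N> W s = zero (Sec \<H> W)"
    unfolding twisted_ops by (intro restrict_eqI) (auto simp: matrix_map_def)
qed

text \<open>On \<open>U\<close> the forms of the frame satisfy \<open>\<Sum>\<^sub>j \<partial>\<^sub>j f\<^sub>i (dx\<^sub>j - x\<^sub>j / d\<^sub>l d log f\<^sub>l) = f\<^sub>i (d log f\<^sub>i -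
  d\<^sub>i / d\<^sub>l d log f\<^sub>l)\<close> by Euler's relation. Applying a functional yields row \<open>i\<close> of \<open>N\<close>.\<close>

lemma dual_map_in_kernel:
  assumes \<phi>: "log_functional W \<phi>" and W: "open W"
  shows "in_kernel W (dual_map W \<phi>)"
  unfolding in_kernel_def
proof (intro ballI)
  fix i v assume i: "i \<in> {1..l}" and v: "v \<in> cone W"
  obtain m where m: "v $ m \<noteq> 0" "open (W \<inter> chart m)" "v \<in> cone (W \<inter> chart m)"
    using chart_neighbourhood[OF W v] .
  define V where "V = W \<inter> chart m"
  have V: "open V" "V \<subseteq> W" "V \<subseteq> chart m" "v \<in> cone V" using m by (auto simp: V_def)
  \<comment> \<open>Coefficients of Euler's relation between the generators, divided by
    \<open>x_m ^ d_i\<close> so that they have degree 0; the factor \<open>x_m\<close> in the first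
    kind undoes the denominator of the frame.\<close>
  define A where "A = (\<lambda>c x. case c of Inl j \<Rightarrow> dev i x (axis j 1) * x $ m / (x $ m) ^ d i
     | Inr k \<Rightarrow> if k = i then - ev i x / (x $ m) ^ d i else 0)"
  define a where "a = (\<lambda>c q. A c (rep_cproj q))"
  have Ahom: "A c (b *s x) = A c x" if "b \<noteq> 0" for c b x
  proof (cases c)
    case (Inl j)
    have "A c (b *s x) = (b * dev i (b *s x) (axis j 1)) * x $ m / (b ^ d i * (x $ m) ^ d i)"
      by (simp add: A_def Inl power_mult_distrib mult_ac)
    also have "\<dots> = A c x"
      unfolding dev_scale[OF i] using that by (simp add: A_def Inl)
    finally show ?thesis .
  next
    case (Inr k)
    then show ?thesis using that ev_scale[OF i, of b x] by (simp add: A_def power_mult_distrib)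
  qed
  have a: "a c (cproj_class x) = A c x" if "x \<in> cone V" for c x
    unfolding a_def by (rule descend_class[OF Ahom that])
  have V': "open (cone V)" using V(1) open_cone by blast
  have vm: "x $ m \<noteq> 0" if "x \<in> cone V" for x using cone_subset_chart[OF V(3) that] .
  have ahol: "holomorphic_fun V (a c)" for c
    unfolding a_def
  proof (rule holomorphic_fun_descend)
    have "cholomorphic_on (\<lambda>x. mp_eval (mp_pderiv j (f i)) x * x $ m / (x $ m) ^ d i) (cone V)" for j
      using vm by (intro cholomorphic_on_mult cholomorphic_on_divide cholomorphic_on_power
          cholomorphic_on_nth mp_eval_cholomorphic V') auto
    moreover have "cholomorphic_on (\<lambda>x. - ev i x / (x $ m) ^ d i) (cone V)"
      using vm by (intro cholomorphic_on_minus cholomorphic_on_divide cholomorphic_on_power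
          cholomorphic_on_nth ev_cholomorphic V') auto
    ultimately show "cholomorphic_on (A c) (cone V)"
      using cholomorphic_on_const[OF V', of 0] unfolding A_def dev_axis
      by (cases c; cases "c = Inr i") simp_all
  qed (rule Ahom)
  have rel: "(\<Sum>c\<in>cols. A c x * frame m c x w) = 0" if x: "x \<in> cone (V \<inter> U)" for x w
  proof -
    have x': "x \<in> cone V" "x \<in> cone U" using x by (auto simp: cone_Int)
    define r where "r = dev l x w / ev l x / of_nat (d l)"
    have nz: "x $ m \<noteq> 0" "ev i x \<noteq> 0" "ev l x \<noteq> 0"
      using vm[OF x'(1)] ev_nonzero[OF x'(2)] i l_mem by auto
    have "(\<Sum>j\<in>UNIV. A (Inl j) x * frame m (Inl j) x w) =
        (\<Sum>j\<in>UNIV. (w $ j * dev i x (axis j 1) - r * (x $ j * dev i x (axis j 1))) / (x $ m) ^ d i)"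
      using nz by (intro sum.cong) (simp_all add: A_def frame_def r_def field_simps)
    also have "\<dots> = (dev i x w - r * dev i x x) / (x $ m) ^ d i"
      unfolding dev_expand[of i x w] dev_expand[of i x x]
      by (simp add: sum_subtractf sum_distrib_left sum_divide_distrib diff_divide_distrib)
    also have "dev i x x = of_nat (d i) * ev i x" using ev_euler[OF i] .
    finally have 1: "(\<Sum>j\<in>UNIV. A (Inl j) x * frame m (Inl j) x w) =
        (dev i x w - r * (of_nat (d i) * ev i x)) / (x $ m) ^ d i" .
    have "(\<Sum>k\<in>{1..<l}. A (Inr k) x * frame m (Inr k) x w) =
        (\<Sum>k\<in>{1..<l}. if k = i then A (Inr i) x * frame m (Inr i) x w else 0)"
      by (intro sum.cong) (auto simp: A_def)
    also have "\<dots> = (if i < l then A (Inr i) x * frame m (Inr i) x w else 0)"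
      using i by simp
    also have "\<dots> = (if i < l then - (dev i x w - r * (of_nat (d i) * ev i x)) / (x $ m) ^ d i else 0)"
      using nz d_nonzero by (auto simp: A_def frame_def r_def field_simps)
    finally have 2: "(\<Sum>k\<in>{1..<l}. A (Inr k) x * frame m (Inr k) x w) =
        (if i < l then - (dev i x w - r * (of_nat (d i) * ev i x)) / (x $ m) ^ d i else 0)" .
    \<comment> \<open>Row l has no second block to cancel the first one, but its bracket vanishes by
      the choice of r.\<close>
    have 3: "dev i x w - r * (of_nat (d i) * ev i x) = 0" if "\<not> i < l"
    proof -
      have "i = l" using that i by simp
      then show ?thesis using nz d_nonzero by (simp add: r_def)
    qed
    show ?thesis unfolding sum_N_columns 1 2 using 3 by (cases "i < l") (simp_all add: diff_divide_distrib)
  qed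
  \<comment> \<open>The zero form is evaluated twice: with the coefficients of the relation and with
    zero coefficients.\<close>
  let ?\<omega> = "restrict (\<lambda>v w. 0) (cone (V \<inter> U))"
  have "\<phi> V ?\<omega> (cproj_class v) = (\<Sum>c\<in>cols. a c (cproj_class v) * (dual_map W \<phi> c v / weight m c v))"
    by (rule functional_evaluation[OF \<phi> W V(1-3) ahol _ _ V(4)])
      (use a rel in \<open>auto simp: cone_Int\<close>)
  moreover have "\<phi> V ?\<omega> (cproj_class v) = (\<Sum>c\<in>cols. 0 * (dual_map W \<phi> c v / weight m c v))"
    by (rule functional_evaluation[OF \<phi> W V(1-3) holomorphic_fun_const[OF V(1)] _ _ V(4)]) auto
  ultimately have 0: "(\<Sum>c\<in>cols. A c v * (dual_map W \<phi> c v / weight m c v)) = 0"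
    using a[OF V(4)] by simp
  have nz: "v $ m \<noteq> 0" using m(1) .
  have "(\<Sum>j\<in>UNIV. A (Inl j) v * (dual_map W \<phi> (Inl j) v / weight m (Inl j) v)) =
      (\<Sum>j\<in>UNIV. vector_part (dual_map W \<phi>) v $ j * dev i v (axis j 1) / (v $ m) ^ d i)"
    using nz by (intro sum.cong) (simp_all add: A_def weight_def vector_part_def)
  also have "\<dots> = dev i v (vector_part (dual_map W \<phi>) v) / (v $ m) ^ d i"
    unfolding dev_expand[of i v "vector_part (dual_map W \<phi>) v"] sum_divide_distrib ..
  finally have 1: "(\<Sum>j\<in>UNIV. A (Inl j) v * (dual_map W \<phi> (Inl j) v / weight m (Inl j) v)) =
      dev i v (vector_part (dual_map W \<phi>) v) / (v $ m) ^ d i" .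
  have "(\<Sum>k\<in>{1..<l}. A (Inr k) v * (dual_map W \<phi> (Inr k) v / weight m (Inr k) v)) =
        (\<Sum>k\<in>{1..<l}. if k = i then ev i v * dual_map W \<phi> (Inr i) v / (v $ m) ^ d i else 0)"
    by (intro sum.cong) (auto simp: A_def weight_def)
  also have "\<dots> = (if i < l then ev i v * dual_map W \<phi> (Inr i) v else 0) / (v $ m) ^ d i"
    using i by simp
  finally have "(dev i v (vector_part (dual_map W \<phi>) v) +
      (if i < l then ev i v * dual_map W \<phi> (Inr i) v else 0)) / (v $ m) ^ d i = 0"
    using 0 unfolding sum_N_columns 1 by (simp add: add_divide_distrib)
  then show "dev i v (vector_part (dual_map W \<phi>) v) +
      (if i < l then ev i v * dual_map W \<phi> (Inr i) v else 0) = 0"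
    using nz by simp
qed

section \<open>Density of the complement of the divisors\<close>

text \<open>In adapted coordinates the divisors are coordinate hyperplanes through the origin, so a
  point all of whose coordinates equal a small b > 0 avoids them.\<close>

lemma open_meets_U:
  assumes W: "open W" "p \<in> W"
  shows "\<exists>q\<in>W. q \<in> U"
proof -
  obtain V0 z \<sigma> where ad0: "adapted p V0 z \<sigma>" using adapted_exists by blast
  define V where "V = V0 \<inter> W"
  have V: "open V" "V \<subseteq> V0" "p \<in> V"
    using open_Int[OF adapted_coordinatesD(2)[OF ad0] W(1)] adapted_coordinatesD(3)[OF ad0] W(2)
    by (auto simp: V_def)
  have ad: "adapted p V z \<sigma>" using adapted_subset[OF ad0 V] .
  note adD = adapted_coordinatesD[OF ad]
  have "open (z ` V)" "0 \<in> z ` V"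
    using local_coordinates_open(2)[OF adD(1)] adD(3,4) by force+
  then obtain e where e: "e > 0" "ball 0 e \<subseteq> z ` V" using openE by blast
  define y :: "complex ^ 'n" where "y = (\<chi> k. 1)"
  define b where "b = e / (2 * (norm y + 1))"
  have b: "b > 0" "b * norm y < e"
  proof -
    have "norm y + 1 > 0" by (simp add: add_nonneg_pos)
    then show "b > 0" using e(1) by (simp add: b_def)
    have "b * norm y < b * (2 * (norm y + 1))"
      using \<open>b > 0\<close> by (intro mult_strict_left_mono) (auto intro: add_nonneg_pos)
    also have "\<dots> = e" using \<open>norm y + 1 > 0\<close> by (simp add: b_def)
    finally show "b * norm y < e" .
  qed
  then have "b *\<^sub>R y \<in> ball 0 e" by (simp add: dist_norm)
  then obtain q where q: "q \<in> V" "z q = b *\<^sub>R y" using e(2) by (metis imageE subsetD)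
  have "q \<notin> D i" if "i \<in> {1..l}" for i
  proof (cases "i \<in> through p")
    case True
    then show ?thesis using adD(6)[OF True q(1)] q(2) b(1) by (simp add: y_def)
  next
    case False
    show ?thesis using adD(7)[OF that False q(1)] .
  qed
  then show ?thesis using q(1) by (intro bexI[of _ q]) (auto simp: V_def U_def)
qed

text \<open>Non-triviality of this filter is what makes limits along the complement unique. It lifts
  density from projective space to the cone.\<close>

lemma cone_U_dense:
  assumes V: "open V" "v \<in> cone V"
  shows "at v within cone (V \<inter> U) \<noteq> bot"
proof -
  have "v islimpt cone (V \<inter> U)"
  proof (cases "v \<in> cone U")
    case True
    then have "v \<in> cone (V \<inter> U)" using V by (simp add: cone_Int)
    moreover have "open (cone (V \<inter> U))" using open_Int[OF V(1) open_U] open_cone by blast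
    ultimately show ?thesis by (rule interior_limit_point[OF interior_open[THEN equalityD2[THEN subsetD]], rotated])
  next
    case False
    show ?thesis
      unfolding islimpt_def
    proof (intro allI impI)
      fix T assume T: "v \<in> T" "open T"
      define T' where "T' = T \<inter> cone V"
      have T': "open T'" "v \<in> T'" "0 \<notin> T'"
        using T V open_Int[OF T(2) iffD1[OF open_cone V(1)]] by (auto simp: T'_def cone_def)
      \<comment> \<open>The saturation of T' is a union of preimages under scalings, so T' has an
        open image. A point of that image in U comes from a point of T' itself, which is as close to
        v as required.\<close>
      have "cone (cproj_class ` T') = (\<Union>c\<in>-{0}. (\<lambda>x. c *s x) -` T')"
      proof (rule subset_antisym; rule subsetI)
        fix x assume "x \<in> cone (cproj_class ` T')"
        then obtain t where t: "x \<noteq> 0" "t \<in> T'" "cproj_class x = cproj_class t" by (auto simp: cone_def)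
        then have "t \<noteq> 0" using T'(3) by auto
        then obtain c where c: "t = c *s x" using iffD1[OF cproj_class_eq_iff[OF t(1)] t(3)] by blast
        then have "c \<noteq> 0" using \<open>t \<noteq> 0\<close> by auto
        then show "x \<in> (\<Union>c\<in>-{0}. (\<lambda>x. c *s x) -` T')" using c t(2) by auto
      next
        fix x assume "x \<in> (\<Union>c\<in>-{0}. (\<lambda>x. c *s x) -` T')"
        then obtain c where c: "c \<noteq> 0" "c *s x \<in> T'" by auto
        then have "x \<noteq> 0" using T'(3) by auto
        moreover have "cproj_class x = cproj_class (c *s x)" 
          by (rule cproj_class_scale[OF c(1), symmetric])
        ultimately show "x \<in> cone (cproj_class ` T')" using c(2) by (auto simp: cone_def)
      qed
      moreover have "open ((\<lambda>x. c *s x) -` T')" for c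
        by (rule open_vimage[OF T'(1)])
          (intro continuous_on_vector_smult continuous_on_const continuous_on_id)
      ultimately have "open (cproj_class ` T')" unfolding open_cone by (auto intro: open_UN)
      moreover have "cproj_class v \<in> cproj_class ` T'" using T'(2) by blast
      ultimately obtain q where q: "q \<in> cproj_class ` T'" "q \<in> U" using open_meets_U by blast
      then obtain x where x: "x \<in> T'" "cproj_class x \<in> U" by blast
      then have "x \<in> cone (V \<inter> U)" using T'(3) by (auto simp: T'_def cone_def)
      moreover have "x \<noteq> v" using False x V(2) by (auto simp: cone_def)
      ultimately show "\<exists>y\<in>cone (V \<inter> U). y \<in> T \<and> y \<noteq> v" using x(1) by (auto simp: T'_def)
    qed
  qed
  then show ?thesis by (simp add: trivial_limit_within)
qed

text \<open>Row l of the kernel condition makes \<open>d log f_l\<close> vanish on the vector field,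
  which removes all corrections; row i turns the value of \<open>d log f_i\<close> into minus the
  entry \<open>Inr i\<close>. The right-hand side has no pole along the divisors, and therefore the
  contraction extends.\<close>

lemma frame_vector_part:
  assumes k: "in_kernel W s" and v: "v \<in> cone (W \<inter> U)" and m: "v $ m \<noteq> 0" and c: "c \<in> cols"
  shows "frame m c v (vector_part s v) = s c v / weight m c v"
proof -
  have v': "v \<in> cone W" "v \<in> cone U" using v by (auto simp: cone_Int)
  have row: "dev i v (vector_part s v) + (if i < l then ev i v * s (Inr i) v else 0) = 0" if "i \<in> {1..l}" for i
    using k that v'(1) unfolding in_kernel_def by blast
  have l0: "dev l v (vector_part s v) = 0" using row[OF l_mem] by simp
  show ?thesis
  proof (cases c)
    case (Inl j)
    then have "frame m c v (vector_part s v) = vector_part s v $ j / weight m c v"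
      by (simp add: frame_def weight_def l0)
    then show ?thesis by (simp add: Inl vector_part_def)
  next
    case (Inr i)
    then have i: "i \<in> {1..l}" "i < l" using c by (auto simp: N_columns_def)
    have "dev i v (vector_part s v) = - (ev i v * s (Inr i) v)" using row[OF i(1)] i(2) by (simp add: eq_neg_iff_add_eq_0)
    then show ?thesis using ev_nonzero[OF v'(2) i(1)] by (simp add: Inr frame_def weight_def l0)
  qed
qed

section \<open>The functional attached to an element of the kernel\<close>

text \<open>Contraction with the vector field of s. A section \<omega> lives off the divisors only,
  so its contraction at a point of a divisor has to be taken as a limit.\<close>

definition kernel_functional where
  "kernel_functional W s = (\<lambda>V\<in>{V. open V \<and> V \<subseteq> W}. \<lambda>\<omega>\<in>log_forms V. \<lambda>p\<in>V.
     Lim (at (rep_cproj p) within cone (V \<inter> U)) (\<lambda>v. \<omega> v (vector_part s v)))"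

context
  fixes W s
  assumes W: "open W" and s: "s \<in> carrier (Sec \<G> W)" and ker: "in_kernel W s"
begin

lemma section_hom: "c \<in> cols \<Longrightarrow> v \<in> cone W \<Longrightarrow> a \<noteq> 0 \<Longrightarrow> s c (a *s v) = a powi twist c * s c v"
  using s unfolding twisted_carrier by blast

lemma section_weight_hom:
  assumes "c \<in> cols" "v \<in> cone W" "a \<noteq> 0"
  shows "s c (a *s v) / weight m c (a *s v) = s c v / weight m c v"
  using section_hom[OF assms] weight_scale[OF assms(3), of m c v] assms(3) by simp

lemma section_weight_cholomorphic:
  assumes "c \<in> cols" "open V" "V \<subseteq> W" "V \<subseteq> chart m"
  shows "cholomorphic_on (\<lambda>v. s c v / weight m c v) (cone V)"
proof -
  have V: "open (cone V)" "cone V \<subseteq> cone W" using assms open_cone cone_mono by blast+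
  have "cholomorphic_on (s c) (cone W)" using s assms(1) unfolding twisted_carrier by blast
  then show ?thesis
    using V weight_nonzero[OF cone_subset_chart[OF assms(4)]]
    by (intro cholomorphic_on_divide weight_cholomorphic) (auto elim: cholomorphic_on_subset)
qed

text \<open>Off the divisors and near p the contraction equals, by \<open>frame_vector_part\<close>,
  a combination h that is holomorphic on all of \<open>cone V'\<close>, hence continuous at the
  representative of p.\<close>

lemma contraction_tendsto:
  assumes V: "open V" "V \<subseteq> W" and V': "open V'" "V' \<subseteq> V" "V' \<subseteq> chart m" and p: "p \<in> V'"
    and u: "\<And>c. holomorphic_fun V' (u c)"
    and \<omega>: "\<And>v w. v \<in> cone (V' \<inter> U) \<Longrightarrow> \<omega> v w = (\<Sum>c\<in>cols. u c (cproj_class v) * frame m c v w)"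
  shows "((\<lambda>v. \<omega> v (vector_part s v)) \<longlongrightarrow>
      (\<Sum>c\<in>cols. u c p * (s c (rep_cproj p) / weight m c (rep_cproj p))))
    (at (rep_cproj p) within cone (V \<inter> U))"
proof -
  define h where "h = (\<lambda>v. \<Sum>c\<in>cols. u c (cproj_class v) * (s c v / weight m c v))"
  have V'c: "open (cone V')" using V'(1) open_cone by blast
  have r: "rep_cproj p \<in> cone V'" using p by (simp add: rep_in_cone)
  have "cholomorphic_on h (cone V')"
    unfolding h_def using u V V'
    by (intro cholomorphic_on_sum cholomorphic_on_mult section_weight_cholomorphic V'c)
      (auto simp: holomorphic_fun_def)
  then have "isCont h (rep_cproj p)"
    using cholomorphic_on_continuous V'c r continuous_on_eq_continuous_at by blast
  then have "(h \<longlongrightarrow> h (rep_cproj p)) (at (rep_cproj p) within cone (V \<inter> U))"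
    by (simp add: continuous_at_imp_continuous_at_within continuous_within[symmetric])
  moreover have "h v = \<omega> v (vector_part s v)" if v: "v \<in> cone (V \<inter> U)" "v \<in> cone V'" for v
  proof -
    have v': "v \<in> cone (V' \<inter> U)" "v \<in> cone (W \<inter> U)" using v V(2) by (auto simp: in_cone_iff)
    show ?thesis
      unfolding \<omega>[OF v'(1)] h_def
      using frame_vector_part[OF ker v'(2) cone_subset_chart[OF V'(3) v(2)]] by (intro sum.cong) auto
  qed
  then have "eventually (\<lambda>v. h v = \<omega> v (vector_part s v)) (at (rep_cproj p) within cone (V \<inter> U))"
    unfolding eventually_at_topological using V'c r by blast
  ultimately have "((\<lambda>v. \<omega> v (vector_part s v)) \<longlongrightarrow> h (rep_cproj p)) (at (rep_cproj p) within cone (V \<inter> U))"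
    by (rule Lim_transform_eventually)
  then show ?thesis by (simp add: h_def)
qed

lemma contraction_convergent:
  assumes V: "open V" "V \<subseteq> W" and \<omega>: "\<omega> \<in> log_forms V" and p: "p \<in> V"
  shows "((\<lambda>v. \<omega> v (vector_part s v)) \<longlongrightarrow> kernel_functional W s V \<omega> p) (at (rep_cproj p) within cone (V \<inter> U))"
proof -
  obtain m where m: "p \<in> chart m" using ex_chart by blast
  obtain V' where V': "open V'" "p \<in> V'" "V' \<subseteq> V" "V' \<subseteq> chart m"
    "\<omega> \<in> frame_span m V'"
    using log_bundle_local_frame[OF \<omega> p m] .
  obtain u where u: "\<And>c. holomorphic_fun V' (u c)"
    "\<And>v w. v \<in> cone (V' \<inter> U) \<Longrightarrow> \<omega> v w = (\<Sum>c\<in>cols. u c (cproj_class v) * frame m c v w)"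
    using hol_spanD[OF V'(5)] by blast
  note t = contraction_tendsto[OF V V'(1,3,4,2) u]
  have "at (rep_cproj p) within cone (V \<inter> U) \<noteq> bot"
    by (rule cone_U_dense[OF V(1)]) (simp add: rep_in_cone p)
  from tendsto_Lim[OF this t] t V \<omega> p show ?thesis by (simp add: kernel_functional_def)
qed

lemma kernel_functional_eqI:
  assumes V: "open V" "V \<subseteq> W" and \<omega>: "\<omega> \<in> log_forms V" and p: "p \<in> V"
    and "((\<lambda>v. \<omega> v (vector_part s v)) \<longlongrightarrow> L) (at (rep_cproj p) within cone (V \<inter> U))"
  shows "kernel_functional W s V \<omega> p = L"
proof -
  have "at (rep_cproj p) within cone (V \<inter> U) \<noteq> bot"
    by (rule cone_U_dense[OF V(1)]) (simp add: rep_in_cone p)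
  then show ?thesis using contraction_convergent[OF V \<omega> p] assms(5) by (rule tendsto_unique)
qed

text \<open>Near each point the limit is the explicit holomorphic combination of
  \<open>contraction_tendsto\<close>; additivity, linearity and compatibility with restriction
  follow from uniqueness of limits.\<close>

lemma kernel_functional_log_functional: "log_functional W (kernel_functional W s)"
proof (rule log_functionalI)
  fix V \<omega> assume V: "open V" "V \<subseteq> W" and \<omega>: "\<omega> \<in> log_forms V"
  show "kernel_functional W s V \<omega> \<in> extensional V" using V \<omega> by (simp add: kernel_functional_def)
  show "holomorphic_fun V (kernel_functional W s V \<omega>)"
  proof (rule holomorphic_fun_local[OF V(1)])
    fix p assume p: "p \<in> V"
    obtain m where m: "p \<in> chart m" using ex_chart by blast
    obtain V' where V': "open V'" "p \<in> V'" "V' \<subseteq> V" "V' \<subseteq> chart m"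
      "\<omega> \<in> frame_span m V'"
      using log_bundle_local_frame[OF \<omega> p m] .
    obtain u where u: "\<And>c. holomorphic_fun V' (u c)"
      "\<And>v w. v \<in> cone (V' \<inter> U) \<Longrightarrow> \<omega> v w = (\<Sum>c\<in>cols. u c (cproj_class v) * frame m c v w)"
      using hol_spanD[OF V'(5)] by blast
    have V'W: "V' \<subseteq> W" using V'(3) V(2) by blast
    have "holomorphic_fun V' (\<lambda>q. s c (rep_cproj q) / weight m c (rep_cproj q))" if c: "c \<in> cols" for c
      by (rule holomorphic_fun_descend[OF section_weight_cholomorphic[OF c V'(1) V'W V'(4)]])
        (rule section_weight_hom[OF c subsetD[OF cone_mono[OF V'W]]])
    then have "holomorphic_fun V' (\<lambda>q. \<Sum>c\<in>cols. u c q * (s c (rep_cproj q) / weight m c (rep_cproj q)))"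
      using u(1) by (intro holomorphic_fun_sum[OF V'(1)] holomorphic_fun_mult)
    moreover have "kernel_functional W s V \<omega> q = (\<Sum>c\<in>cols. u c q * (s c (rep_cproj q) / weight m c (rep_cproj q)))"
      if q: "q \<in> V'" for q
      using q V'(3) by (intro kernel_functional_eqI[OF V \<omega>] contraction_tendsto[OF V V'(1,3,4) q u]) auto
    ultimately have "holomorphic_fun V' (kernel_functional W s V \<omega>)"
      using holomorphic_fun_cong[of V' "\<lambda>q. \<Sum>c\<in>cols. u c q * (s c (rep_cproj q) / weight m c (rep_cproj q))"]
      by simp
    then show "\<exists>V'. p \<in> V' \<and> holomorphic_fun V' (kernel_functional W s V \<omega>)" using V'(2) by blast
  qed
next
  fix V \<omega> \<eta> p assume V: "open V" "V \<subseteq> W" and \<omega>: "\<omega> \<in> log_forms V"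
    and \<eta>: "\<eta> \<in> log_forms V" and p: "p \<in> V"
  show "kernel_functional W s V (\<lambda>v\<in>cone (V \<inter> U). \<lambda>w. \<omega> v w + \<eta> v w) p =
      kernel_functional W s V \<omega> p + kernel_functional W s V \<eta> p"
  proof (rule kernel_functional_eqI[OF V log_bundle_add[OF V(1) \<omega> \<eta>] p])
    show "((\<lambda>v. (\<lambda>v\<in>cone (V \<inter> U). \<lambda>w. \<omega> v w + \<eta> v w) v (vector_part s v)) \<longlongrightarrow>
        kernel_functional W s V \<omega> p + kernel_functional W s V \<eta> p) (at (rep_cproj p) within cone (V \<inter> U))"
      by (rule Lim_transform_eventually[OF tendsto_add[OF contraction_convergent[OF V \<omega> p]
              contraction_convergent[OF V \<eta> p]] eventually_eq_within]) simp
  qed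
next
  fix V g \<omega> p assume V: "open V" "V \<subseteq> W" and g: "holomorphic_fun V g"
    and \<omega>: "\<omega> \<in> log_forms V" and p: "p \<in> V"
  have "isCont (\<lambda>v. g (cproj_class v)) (rep_cproj p)"
    using cholomorphic_on_continuous[OF g[unfolded holomorphic_fun_def]] iffD1[OF open_cone V(1)]
      rep_in_cone[of p V] p continuous_on_eq_continuous_at by blast
  then have g': "((\<lambda>v. g (cproj_class v)) \<longlongrightarrow> g p) (at (rep_cproj p) within cone (V \<inter> U))"
    using continuous_at_imp_continuous_at_within[of "rep_cproj p" "\<lambda>v. g (cproj_class v)"]
    by (simp add: continuous_within)
  show "kernel_functional W s V (\<lambda>v\<in>cone (V \<inter> U). \<lambda>w. g (cproj_class v) * \<omega> v w) p =
      g p * kernel_functional W s V \<omega> p"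
  proof (rule kernel_functional_eqI[OF V log_bundle_smult[OF V(1) g \<omega>] p])
    show "((\<lambda>v. (\<lambda>v\<in>cone (V \<inter> U). \<lambda>w. g (cproj_class v) * \<omega> v w) v (vector_part s v)) \<longlongrightarrow>
        g p * kernel_functional W s V \<omega> p) (at (rep_cproj p) within cone (V \<inter> U))"
      by (rule Lim_transform_eventually[OF tendsto_mult[OF g' contraction_convergent[OF V \<omega> p]]
            eventually_eq_within]) simp
  qed
next
  fix V V' \<omega> p assume V: "open V" "V \<subseteq> W" and V': "open V'" "V' \<subseteq> V" and \<omega>: "\<omega> \<in> log_forms V" and p: "p \<in> V'"
  have V'W: "V' \<subseteq> W" and pV: "p \<in> V" using V V' p by auto
  have "cone (V' \<inter> U) \<subseteq> cone (V \<inter> U)" using V'(2) by (intro cone_mono) blast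
  from tendsto_within_subset[OF contraction_convergent[OF V \<omega> pV] this]
  have t: "((\<lambda>v. \<omega> v (vector_part s v)) \<longlongrightarrow> kernel_functional W s V \<omega> p) (at (rep_cproj p) within cone (V' \<inter> U))" .
  show "kernel_functional W s V' (restrict \<omega> (cone (V' \<inter> U))) p = kernel_functional W s V \<omega> p"
  proof (rule kernel_functional_eqI[OF V'(1) V'W log_bundle_restrict[OF V' \<omega>] p])
    show "((\<lambda>v. restrict \<omega> (cone (V' \<inter> U)) v (vector_part s v)) \<longlongrightarrow> kernel_functional W s V \<omega> p)
        (at (rep_cproj p) within cone (V' \<inter> U))"
      by (rule Lim_transform_eventually[OF t eventually_eq_within]) simp
  qed
qed

lemma kernel_functional_carrier: "kernel_functional W s \<in> carrier (Sec (dual_sheaf \<Omega>) W)"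
  unfolding dual_carrier using kernel_functional_log_functional
  by (auto simp: kernel_functional_def)

text \<open>The contraction of a generator is the entry of s divided by its weight, and
  \<open>frame_value\<close> multiplies by the weight again.\<close>

lemma dual_map_kernel_functional: "dual_map W (kernel_functional W s) = s"
proof -
  have "dual_map W (kernel_functional W s) = (\<lambda>c\<in>cols. \<lambda>v\<in>cone W. s c v)"
  proof (rule dual_map_cong[OF W])
    fix c v m assume c: "c \<in> cols" and v: "v \<in> cone W" and m: "v $ m \<noteq> 0"
    let ?V = "W \<inter> chart m"
    let ?r = "rep_cproj (cproj_class v)"
    have V: "open ?V" using W open_chart by (rule open_Int)
    have p: "cproj_class v \<in> ?V" using v m by (simp add: in_cone_iff in_chart_class)
    let ?u = "\<lambda>c' q. if c' = c then 1 else 0 :: complex"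
    have "((\<lambda>v. frame_section m c ?V v (vector_part s v)) \<longlongrightarrow>
        (\<Sum>c'\<in>cols. ?u c' (cproj_class v) * (s c' ?r / weight m c' ?r))) (at ?r within cone (?V \<inter> U))"
      by (rule contraction_tendsto[OF V Int_lower1 V subset_refl Int_lower2 p])
        (use c V in \<open>auto simp: frame_section_def intro: holomorphic_fun_const
          simp: if_distrib[of "\<lambda>x. x * _"] cong: if_cong\<close>)
    then have t: "((\<lambda>v. frame_section m c ?V v (vector_part s v)) \<longlongrightarrow> s c ?r / weight m c ?r)
        (at ?r within cone (?V \<inter> U))"
      unfolding sum_kronecker[OF finite_N_columns c] .
    have "kernel_functional W s ?V (frame_section m c ?V) (cproj_class v) = s c ?r / weight m c ?r"
      by (rule kernel_functional_eqI[OF V Int_lower1 frame_section_carrier[OF V Int_lower2 c] p t])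
    also have "\<dots> = s c v / weight m c v"
    proof -
      obtain a where a: "a \<noteq> 0" "?r = a *s v" using rep_cproj_class[OF cone_nonzero[OF v]] .
      show ?thesis unfolding a(2) by (rule section_weight_hom[OF c v a(1)])
    qed
    finally show "frame_value W (kernel_functional W s) m c v = s c v"
      using weight_nonzero[OF m] by (simp add: frame_value_def)
  qed
  also have "\<dots> = s"
    using s unfolding twisted_carrier
    by (intro extensionalityI[of _ cols]) (auto intro!: extensionalityI[of _ "cone W"])
  finally show ?thesis .
qed

end

text \<open>An element of the kernel has a preimage on all of W, so W itself serves as V. Conversely
  the kernel condition is pointwise, so local preimages suffice.\<close>

lemma exact_middle:
  assumes W: "open W" and s: "s \<in> carrier (Sec \<G> W)"
  shows "\<N> W s = zero (Sec \<H> W) \<longleftrightarrow>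
    (\<forall>p\<in>W. \<exists>V. open V \<and> p \<in> V \<and> V \<subseteq> W \<and>
       (\<exists>r\<in>carrier (Sec (dual_sheaf \<Omega>) V). dual_map V r = Res \<G> V s))"
  unfolding N_zero_iff
proof
  assume k: "in_kernel W s"
  have "Res \<G> W s = s"
    unfolding twisted_ops using s unfolding twisted_carrier
    by (intro extensionalityI[of _ cols]) (auto intro!: extensionalityI[of _ "cone W"])
  then have "dual_map W (kernel_functional W s) = Res \<G> W s"
    using dual_map_kernel_functional[OF W s k] by simp
  then show "\<forall>p\<in>W. \<exists>V. open V \<and> p \<in> V \<and> V \<subseteq> W \<and>
       (\<exists>r\<in>carrier (Sec (dual_sheaf \<Omega>) V). dual_map V r = Res \<G> V s)"
    using W kernel_functional_carrier[OF W s k] by blast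
next
  assume h: "\<forall>p\<in>W. \<exists>V. open V \<and> p \<in> V \<and> V \<subseteq> W \<and>
       (\<exists>r\<in>carrier (Sec (dual_sheaf \<Omega>) V). dual_map V r = Res \<G> V s)"
  show "in_kernel W s"
    unfolding in_kernel_def
  proof (intro ballI)
    fix i v assume i: "i \<in> {1..l}" and v: "v \<in> cone W"
    then have "cproj_class v \<in> W" by (simp add: in_cone_iff)
    then obtain V r where V: "open V" "cproj_class v \<in> V"
      and r: "r \<in> carrier (Sec (dual_sheaf \<Omega>) V)" "dual_map V r = Res \<G> V s" using h by blast
    have vV: "v \<in> cone V" using V(2) v by (simp add: in_cone_iff)
    have eq: "dual_map V r c v = s c v" if "c \<in> cols" for c
      unfolding r(2) twisted_ops using that vV by simp
    have "dev i v (vector_part (dual_map V r) v) + (if i < l then ev i v * dual_map V r (Inr i) v else 0) = 0"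
      using dual_map_in_kernel[OF dual_carrierD(1)[OF r(1)] V(1)] i vV unfolding in_kernel_def by blast
    moreover have "vector_part (dual_map V r) v = vector_part s v" using eq by (simp add: vector_part_def N_columns_def)
    moreover have "dual_map V r (Inr i) v = s (Inr i) v" if "i < l"
      using eq[of "Inr i"] that i by (simp add: N_columns_def)
    ultimately show "dev i v (vector_part s v) + (if i < l then ev i v * s (Inr i) v else 0) = 0"
      by (cases "i < l") auto
  qed
qed


section \<open>Surjectivity of the matrix\<close>

text \<open>The gradients of the equations through \<open>p\<close> are independent by the normal crossings condition.
  If \<open>p\<close> does not lie on \<open>D\<^sub>l\<close>, the remaining row \<open>l\<close> is separated from them by the Euler field.\<close>

lemma dual_vectors_through:
  assumes v: "v \<noteq> 0"
  obtains e :: "nat \<Rightarrow> complex ^ ('n option)"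
  where "\<And>i k. i \<in> through (cproj_class v) \<Longrightarrow> k \<in> through (cproj_class v) \<Longrightarrow>
    dev i v (e k) = (if i = k then 1 else 0)"
proof -
  define p where "p = cproj_class v"
  obtain m where m: "p \<in> chart m" using ex_chart by blast
  then have vm: "v $ m \<noteq> 0" using in_chart_class[OF v] by (simp add: p_def)
  obtain V0 z \<sigma> where ad0: "adapted p V0 z \<sigma>" using adapted_exists by blast
  define V where "V = V0 \<inter> chart m"
  have V: "open V" "V \<subseteq> V0" "p \<in> V"
    using open_Int[OF adapted_coordinatesD(2)[OF ad0] open_chart] adapted_coordinatesD(3)[OF ad0] m
    by (auto simp: V_def)
  have ad: "adapted p V z \<sigma>" using adapted_subset[OF ad0 V] .
  have Vm: "V \<subseteq> chart m" by (simp add: V_def)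
  note adD = adapted_coordinatesD[OF ad]
  have vV: "v \<in> cone V" using V(3) v by (simp add: in_cone_iff p_def)
  obtain w :: "'n \<Rightarrow> complex ^ ('n option)"
    where w: "\<And>k k'. differential (\<lambda>q. z q $ k) v (w k') = (if k = k' then 1 else 0)"
    using coordinates_dual_vectors[OF adD(1) vV] by blast
  \<comment> \<open>At v both the equation and the coordinate vanish, so the undifferentiated terms
    drop out and the gradient is a unit times the differential of the coordinate.\<close>
  have "\<exists>a. a \<noteq> 0 \<and> (\<forall>u. dev i v u = a * differential (\<lambda>q. z q $ \<sigma> i) v u)" if i: "i \<in> through p" for i
  proof -
    obtain h where h: "holomorphic_fun V h" "\<And>q. q \<in> V \<Longrightarrow> h q \<noteq> 0"
      "\<And>q. q \<in> V \<Longrightarrow> equation i m q = z q $ \<sigma> i * h q"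
      using equation_unit[OF ad Vm i] by blast
    have il: "i \<in> {1..l}" "p \<in> D i" using i by (auto simp: through_def)
    have ev0: "ev i v = 0" using in_D_iff[OF il(1) v] il(2) by (simp add: p_def)
    have z0: "z (cproj_class v) $ \<sigma> i = 0" using adD(6)[OF i V(3)] il(2) by (simp add: p_def)
    have "dev i v u = h p * (v $ m) ^ d i * differential (\<lambda>q. z q $ \<sigma> i) v u" for u
    proof -
      have "dev i v u / (v $ m) ^ d i = differential (equation i m) v u"
        using differential_equation[OF il(1), of v m u] vm ev0 by simp
      also have "\<dots> = differential (\<lambda>q. z q $ \<sigma> i) v u * h p"
        using differential_mult[OF coordinate_holomorphic[OF adD(1)] h(1) h(3) vV] z0 by (simp add: p_def)
      finally show ?thesis using vm by (simp add: field_simps)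
    qed
    then show ?thesis using h(2)[OF V(3)] vm by (intro exI[of _ "h p * (v $ m) ^ d i"]) simp
  qed
  then obtain a where a: "\<And>i. i \<in> through p \<Longrightarrow> a i \<noteq> 0"
    "\<And>i u. i \<in> through p \<Longrightarrow> dev i v u = a i * differential (\<lambda>q. z q $ \<sigma> i) v u"
    by metis
  have "dev i v (inverse (a k) *s w (\<sigma> k)) = (if i = k then 1 else 0)"
    if "i \<in> through p" "k \<in> through p" for i k
    using that a inj_on_eq_iff[OF adD(5) that] by (simp add: dev_scale_arg w)
  then show thesis using that[of "\<lambda>k. inverse (a k) *s w (\<sigma> k)"] by (simp add: p_def)
qed

lemma dual_vectors:
  assumes v: "v \<noteq> 0"
  obtains b :: "nat \<Rightarrow> complex ^ ('n option)"
  where "\<And>i k. i \<in> insert l (through (cproj_class v)) \<Longrightarrow> k \<in> insert l (through (cproj_class v)) \<Longrightarrow>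
    dev i v (b k) = (if i = k then 1 else 0)"
proof -
  let ?A = "through (cproj_class v)"
  obtain e :: "nat \<Rightarrow> complex ^ ('n option)"
    where e: "\<And>i k. i \<in> ?A \<Longrightarrow> k \<in> ?A \<Longrightarrow> dev i v (e k) = (if i = k then 1 else 0)"
    using dual_vectors_through[OF v] by blast
  show thesis
  proof (cases "l \<in> ?A")
    case True
    then show thesis using that[of e] e by (simp add: insert_absorb)
  next
    case False
    then have evl: "ev l v \<noteq> 0" using in_D_iff[OF l_mem v] l_mem by (simp add: through_def)
    \<comment> \<open>The normalised radial vector: by Euler's relation row i takes on it a multiple
      of \<open>ev i v\<close>, which is 1 for row l and 0 for the rows through the point.\<close>
    define E where "E = inverse (of_nat (d l) * ev l v) *s v"
    have El: "dev l v E = 1"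
      using evl d_nonzero by (simp add: E_def dev_scale_arg ev_euler[OF l_mem] field_simps)
    have Ei: "dev i v E = 0" if "i \<in> ?A" for i
      using that in_D_iff[OF _ v, of i] ev_euler[of i v] by (simp add: E_def dev_scale_arg through_def)
    have diff: "dev i v (x - y) = dev i v x - dev i v y" for i x y
      by (rule linear_diff[OF chas_derivative_linear[OF ev_derivative]])
    \<comment> \<open>Subtracting a multiple of E kills row l on the old vectors and leaves the
      other rows unchanged.\<close>
    define b where "b = (\<lambda>k. if k = l then E else e k - dev l v (e k) *s E)"
    have "dev i v (b k) = (if i = k then 1 else 0)" if "i \<in> insert l ?A" "k \<in> insert l ?A" for i k
      using that El Ei e False by (auto simp: b_def diff dev_scale_arg)
    then show thesis using that by blast
  qed
qed

lemma dev_cholomorphic: "open S \<Longrightarrow> cholomorphic_on (\<lambda>x. dev i x w) S"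
  unfolding dev_def
  by (intro cholomorphic_on_sum cholomorphic_on_mult mp_eval_cholomorphic cholomorphic_on_const)

lemma dev_sum: "dev i v (\<Sum>k\<in>K. c k *s w k) = (\<Sum>k\<in>K. dev i v (w k) * c k)"
  using linear_sum[OF chas_derivative_linear[OF ev_derivative], of i v "\<lambda>k. c k *s w k" K]
  by (simp add: dev_scale_arg mult.commute)

text \<open>The rows split into two kinds. Where \<open>ev i v\<close> is non-zero and i < l, the
  entry \<open>Inr i\<close> solves the row by division. The other rows are those with
  \<open>ev i v = 0\<close>, and always row l, which has no entry of its own; they are solved
  together by the vector part.\<close>

lemma N_local_solution:
  assumes W: "open W" and t: "t \<in> carrier (Sec \<H> W)" and v: "v \<in> cone W"
  obtains T F \<tau> where "open T" "v \<in> T" "T \<subseteq> cone W"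
    "\<And>j. cholomorphic_on (\<lambda>x. F x $ j) T" "\<And>i. cholomorphic_on (\<tau> i) T"
    "\<And>i x. i \<in> {1..l} \<Longrightarrow> x \<in> T \<Longrightarrow> dev i x (F x) + (if i < l then ev i x * \<tau> i x else 0) = t i x"
proof -
  have v0: "v \<noteq> 0" using cone_nonzero[OF v] .
  define A where "A = insert l (through (cproj_class v))"
  have A: "finite A" "A \<subseteq> {1..l}" "l \<in> A" using l_mem by (auto simp: A_def through_def)
  obtain b where b: "\<And>i k. i \<in> A \<Longrightarrow> k \<in> A \<Longrightarrow> dev i v (b k) = (if i = k then 1 else 0)"
    using dual_vectors[OF v0] unfolding A_def by blast
  define S where "S = cone W \<inter> (\<Inter>i\<in>{1..l} - A. {x. ev i x \<noteq> 0})"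
  have "open {x. ev i x \<noteq> 0}" for i
    by (intro open_Collect_neq cholomorphic_on_continuous[OF ev_cholomorphic] continuous_on_const open_UNIV)
  then have S: "open S" using W by (auto simp: S_def open_cone intro!: open_Int open_INT)
  have vS: "v \<in> S" using v in_D_iff[OF _ v0] by (auto simp: S_def A_def through_def)
  have tS: "cholomorphic_on (t i) S" if "i \<in> {1..l}" for i
  proof -
    have "cholomorphic_on (t i) (cone W)" using t that unfolding twisted_carrier by blast
    then show ?thesis using S by (rule cholomorphic_on_subset) (simp add: S_def)
  qed
  \<comment> \<open>With the vectors b dual to the gradients at v, the coefficient matrix is the
    identity at v, as elimination requires.\<close>
  have "\<exists>T c. open T \<and> v \<in> T \<and> T \<subseteq> S \<and> (\<forall>i\<in>A. cholomorphic_on (c i) T) \<and>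
      (\<forall>x\<in>T. \<forall>i\<in>A. (\<Sum>k\<in>A. dev i x (b k) * c k x) = t i x)"
    using A(2) by (intro cholomorphic_linear_system[OF A(1) vS S] dev_cholomorphic[OF S] b tS) auto
  then obtain T c where T: "open T" "v \<in> T" "T \<subseteq> S" and c: "\<And>i. i \<in> A \<Longrightarrow> cholomorphic_on (c i) T"
    and eq: "\<And>x i. x \<in> T \<Longrightarrow> i \<in> A \<Longrightarrow> (\<Sum>k\<in>A. dev i x (b k) * c k x) = t i x"
    by blast
  define F where "F = (\<lambda>x. \<Sum>k\<in>A. c k x *s b k)"
  define \<tau> where "\<tau> = (\<lambda>i x. if i \<in> {1..l} - A then (t i x - dev i x (F x)) / ev i x else 0)"
  have F: "cholomorphic_on (\<lambda>x. F x $ j) T" for j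
    unfolding F_def sum_component vector_smult_component
    using c by (intro cholomorphic_on_sum cholomorphic_on_mult cholomorphic_on_const T(1))
  have devF: "cholomorphic_on (\<lambda>x. dev i x (F x)) T" for i
    unfolding dev_def using F by (intro cholomorphic_on_sum cholomorphic_on_mult mp_eval_cholomorphic T(1))
  have \<tau>: "cholomorphic_on (\<tau> i) T" for i
  proof (cases "i \<in> {1..l} - A")
    case True
    have "cholomorphic_on (\<lambda>x. (t i x - dev i x (F x)) / ev i x) T"
      using True T(3)
      by (intro cholomorphic_on_divide cholomorphic_on_diff devF ev_cholomorphic T(1)
          cholomorphic_on_subset[OF tS T(1,3)]) (auto simp: S_def)
    then show ?thesis using True by (simp add: \<tau>_def)
  next
    case False
    then have "\<tau> i = (\<lambda>x. 0)" unfolding \<tau>_def by (simp only: if_False)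
    then show ?thesis using cholomorphic_on_const[OF T(1)] by simp
  qed
  have "dev i x (F x) + (if i < l then ev i x * \<tau> i x else 0) = t i x" if i: "i \<in> {1..l}" and x: "x \<in> T" for i x
  proof (cases "i \<in> A")
    case True
    then show ?thesis using eq[OF x True] by (simp add: \<tau>_def F_def dev_sum)
  next
    case False
    then have "ev i x \<noteq> 0" "i < l" using i x T(3) A(3) by (auto simp: S_def order.strict_iff_order)
    then show ?thesis using i False by (simp add: \<tau>_def)
  qed
  moreover have "T \<subseteq> cone W" using T(3) by (auto simp: S_def)
  ultimately show thesis using that T(1,2) F \<tau> by blast
qed

text \<open>A solution near a point with \<open>x\<^sub>m = 1\<close> becomes homogeneous when it is composed with
  \<open>x \<mapsto> x / x\<^sub>m\<close> and multiplied by the appropriate powers of \<open>x\<^sub>m\<close>.\<close>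

lemma N_surjective:
  assumes W: "open W" and t: "t \<in> carrier (Sec \<H> W)" and p: "p \<in> W"
  shows "\<exists>V. open V \<and> p \<in> V \<and> V \<subseteq> W \<and> (\<exists>s\<in>carrier (Sec \<G> V). \<N> V s = Res \<H> V t)"
proof -
  obtain m where m: "p \<in> chart m" using ex_chart by blast
  define nrm :: "complex ^ ('n option) \<Rightarrow> complex ^ ('n option)" where "nrm = (\<lambda>x. inverse (x $ m) *s x)"
  define v where "v = nrm (rep_cproj p)"
  have rm: "rep_cproj p $ m \<noteq> 0" using m by (simp add: chart_def)
  have vm: "v $ m = 1" using rm by (simp add: v_def nrm_def)
  have pv: "cproj_class v = p" unfolding v_def nrm_def using rm by (simp add: cproj_class_scale)
  have vW: "v \<in> cone W" unfolding v_def nrm_def using rm p by (intro cone_scale) (auto simp: rep_in_cone)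
  obtain T F \<tau> where T: "open T" "v \<in> T" "T \<subseteq> cone W"
    and F: "\<And>j. cholomorphic_on (\<lambda>x. F x $ j) T" and \<tau>: "\<And>i. cholomorphic_on (\<tau> i) T"
    and sol: "\<And>i x. i \<in> {1..l} \<Longrightarrow> x \<in> T \<Longrightarrow> dev i x (F x) + (if i < l then ev i x * \<tau> i x else 0) = t i x"
    using N_local_solution[OF W t vW] by blast
  \<comment> \<open>Membership depends only on the line through x, so T' is the full cone over its
    image V.\<close>
  define T' where "T' = {x. x $ m \<noteq> 0} \<inter> nrm -` T"
  define V where "V = cproj_class ` T'"
  have om: "open {x :: complex ^ ('n option). x $ m \<noteq> 0}" by (intro open_Collect_neq continuous_intros)
  have nrm_scale: "nrm (a *s x) = nrm x" if "a \<noteq> 0" for a x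
    using that by (simp add: nrm_def vec_eq_iff)
  have x_nrm: "x = x $ m *s nrm x" if "x $ m \<noteq> 0" for x
    using that by (simp add: nrm_def vec_eq_iff)
  have nrm_hol: "cholomorphic_on (\<lambda>x. nrm x $ j) S" if "open S" "S \<subseteq> {x. x $ m \<noteq> 0}" for S j
  proof -
    have "cholomorphic_on (\<lambda>x. x $ j / x $ m) S"
      using that by (intro cholomorphic_on_divide cholomorphic_on_nth) auto
    then show ?thesis by (simp add: nrm_def divide_inverse mult.commute)
  qed
  have "continuous_on {x. x $ m \<noteq> 0} nrm"
    by (rule continuous_on_vec_iff) (rule cholomorphic_on_continuous[OF nrm_hol[OF om subset_refl]])
  then have T': "open T'" unfolding T'_def using om T(1) by (rule continuous_open_preimage)
  have coneV: "cone V = T'"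
    unfolding V_def by (rule cone_class_image) (auto simp: T'_def nrm_scale)
  have V: "open V" unfolding open_cone coneV by (rule T')
  have Tm: "x $ m \<noteq> 0" "nrm x \<in> T" if "x \<in> T'" for x using that by (auto simp: T'_def)
  have "p \<in> V"
  proof -
    have "nrm v = v" using vm by (simp add: nrm_def)
    then have "v \<in> T'" using vm T(2) by (simp add: T'_def)
    then show ?thesis using pv by (auto simp: V_def)
  qed
  moreover have "V \<subseteq> W"
  proof
    fix q assume "q \<in> V"
    then obtain x where x: "x \<in> T'" "q = cproj_class x" by (auto simp: V_def)
    have "nrm x \<in> cone W" using Tm(2)[OF x(1)] T(3) by blast
    moreover have "cproj_class (nrm x) = cproj_class x"
      unfolding nrm_def using Tm(1)[OF x(1)] by (intro cproj_class_scale) simp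
    ultimately show "q \<in> W" using x(2) by (simp add: in_cone_iff)
  qed
  moreover define s where "s = (\<lambda>c\<in>cols. \<lambda>x\<in>cone V.
      case c of Inl j \<Rightarrow> x $ m * F (nrm x) $ j | Inr i \<Rightarrow> \<tau> i (nrm x))"
  have "s \<in> carrier (Sec \<G> V)"
    unfolding twisted_carrier
  proof (intro conjI ballI allI impI)
    show "s \<in> extensional cols" by (simp add: s_def)
    fix c assume c: "c \<in> cols"
    then show "s c \<in> extensional (cone V)" by (simp add: s_def)
    have nT: "cholomorphic_on (\<lambda>x. g (nrm x)) T'" if "cholomorphic_on g T" for g
      by (rule cholomorphic_on_compose[OF T' nrm_hol[OF T'] that Tm(2)]) (auto simp: T'_def)
    have "cholomorphic_on (\<lambda>x. case c of Inl j \<Rightarrow> x $ m * F (nrm x) $ j | Inr i \<Rightarrow> \<tau> i (nrm x)) T'"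
      using cholomorphic_on_mult[OF cholomorphic_on_nth[OF T', of m] nT[OF F]] nT[OF \<tau>]
      by (cases c) auto
    then show "cholomorphic_on (s c) (cone V)"
      unfolding coneV by (rule cholomorphic_on_cong) (use c in \<open>simp add: s_def coneV\<close>)
    fix x a assume x: "x \<in> cone V" and a: "a \<noteq> (0 :: complex)"
    show "s c (a *s x) = a powi twist c * s c x"
      using c x cone_scale[OF x a] by (cases c) (auto simp: s_def twist_def nrm_scale[OF a])
  qed
  moreover have "\<N> V s = Res \<H> V t"
    unfolding twisted_ops
  proof (rule restrict_eqI)
    show "\<N> V s \<in> extensional {1..l}" by (simp add: matrix_map_def)
    fix i assume i: "i \<in> {1..l}"
    show "\<N> V s i = restrict (t i) (cone V)"
    proof (rule restrict_eqI)
      show "\<N> V s i \<in> extensional (cone V)" using i by (simp add: matrix_map_def)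
      fix x assume x: "x \<in> cone V"
      \<comment> \<open>Every x is \<open>a *s y\<close> with y in T, where the local solution
        holds; both sides of row i scale by \<open>a ^ d i\<close>.\<close>
      define a y where "a = x $ m" and "y = nrm x"
      have y: "y \<in> T" "a \<noteq> 0" "x = a *s y" using x Tm x_nrm unfolding coneV a_def y_def by blast+
      have "vector_part s x = a *s F y"
        using x by (simp add: vector_part_def s_def a_def y_def vec_eq_iff N_columns_def)
      then have 1: "dev i x (vector_part s x) = a ^ d i * dev i y (F y)"
        using dev_scale[OF i, of a y "F y"] y(3) by (simp add: dev_scale_arg)
      have 2: "ev i x * s (Inr i) x = a ^ d i * (ev i y * \<tau> i y)" if "i < l"
      proof -
        have "s (Inr i) x = \<tau> i y" using that i x by (simp add: s_def y_def N_columns_def)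
        then show ?thesis using ev_scale[OF i, of a y] y(3) by simp
      qed
      have "\<N> V s i x = a ^ d i * (dev i y (F y) + (if i < l then ev i y * \<tau> i y else 0))"
        unfolding N_apply[OF i x] 1 using 2 by (simp add: distrib_left)
      also have "\<dots> = a powi int (d i) * t i y" using sol[OF i y(1)] by simp
      also have "\<dots> = t i x"
      proof -
        have "y \<in> cone W" using y(1) T(3) by blast
        then show ?thesis using t i y(2,3) unfolding twisted_carrier by simp
      qed
      finally show "\<N> V s i x = t i x" .
    qed
  qed
  ultimately show ?thesis using V by blast
qed

theorem dual_log_bundle_sequence:
  "short_exact_sequence (dual_sheaf \<Omega>) \<G> \<H> dual_map \<N>"
  unfolding short_exact_sequence_def
  by (intro conjI allI impI ballI dual_map_hom N_hom dual_map_inj exact_middle N_surjective)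

end

theorem theorem4p3:
  fixes D :: "nat \<Rightarrow> 'n::finite cproj set"
    and f :: "nat \<Rightarrow> 'n option mpoly"
    and d :: "nat \<Rightarrow> nat"
    and l :: nat
  assumes "l \<ge> 1"
    and "\<And>i. i \<in> {1..l} \<Longrightarrow> smooth_hypersurface (D i) (f i) (d i)"
    and "inj_on D {1..l}"
    and "normal_crossings {1..l} D"
  shows "\<exists>\<alpha>. short_exact_sequence
     (dual_sheaf (log_bundle {1..l} D))
     (direct_sum (N_columns l)
        (\<lambda>c. case c of Inl j \<Rightarrow> twisting_sheaf 1 | Inr k \<Rightarrow> twisting_sheaf 0))
     (direct_sum {1..l} (\<lambda>i. twisting_sheaf (int (d i))))
     \<alpha>
     (matrix_map {1..l} (N_columns l) (N_matrix f))"
proof -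
  interpret hypersurface_arrangement D f d l
    using assms by unfold_locales
  have eq: "(\<lambda>c. twisting_sheaf (twist c)) =
      (\<lambda>c :: 'n option + nat. case c of Inl j \<Rightarrow> twisting_sheaf 1 | Inr k \<Rightarrow>
         (twisting_sheaf 0 :: ('n, complex ^ ('n option) \<Rightarrow> complex) omodule_sheaf))"
    by (auto simp: twist_def fun_eq_iff split: sum.split)
  show ?thesis
    using dual_log_bundle_sequence unfolding \<Omega>_def eq by (rule exI[where x = dual_map])
qed

end
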